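(* Let $n\ge 2$, $N=\binom n2$, let $\mathcal K=\bigcup_{k\in\mathbb Z_{>0}}\mathbb C((t^{1/k}))$ be the field of Puiseux series, and let $\mathbf i=(i_1,\dots,i_N)$ be an arbitrary reduced expression $s_{i_1}\cdots s_{i_N}$ of the longest element $w_0$ of $S_n$. Let $\alpha^{\mathbf i}_1,\dots,\alpha^{\mathbf i}_N$ be the associated ordering of the positive roots $R_+=\{\alpha_{ij}=\epsilon_i-\epsilon_j\mid 1\le i<j\le n\}$. Let $m_{\alpha^{\mathbf i}_1},\dots,m_{\alpha^{\mathbf i}_N}\in\mathcal K$ be Puiseux series with positive (real) leading coefficients and non-negative valuations $\mu_\alpha=\mathrm{Val}(m_\alpha)$. If the product $$\mathbf y_{i_1}\big(m_{\alpha^{\mathbf i}_1}^{-1}\big)\cdots\mathbf y_{i_N}\big(m_{\alpha^{\mathbf i}_N}^{-1}\big)\in GL_n(\mathcal K)$$ is a Toeplitz matrix, then the valuations form an ideal filling, i.e. $\{n_{ij}=\mu_{\alpha_{ij}}\}_{1\le i<j\le n}$ is an ideal filling. Moreover, every ideal filling with rational entries arises in this way: for every ideal filling $\{n_{ij}\}_{1\le i<j\le n}$ with all $n_{ij}\in\mathbb Q$ there are Puiseux series $m_\alpha$ ($\alpha\in R_+$) with positive leading coefficients and $\mathrm{Val}(m_{\alpha_{ij}})=n_{ij}$ such that the product $\mathbf y_{i_1}\big(m_{\alpha^{\mathbf i}_1}^{-1}\big)\cdots\mathbf y_{i_N}\big(m_{\alpha^{\mathbf i}_N}^{-1}\big)$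 is a Toeplitz matrix.
   Context: For $1\le i\le n-1$, $\mathbf y_i(z)=\phi_i\begin{pmatrix}1&0\\ z&1\end{pmatrix}$, where $\phi_i:SL_2\to GL_n$ places a $2\times2$ matrix in rows and columns $i,i+1$ (identity elsewhere); thus $\mathbf y_i(z)=I+zE_{i+1,i}$. $S_n$ is generated by the simple reflections $s_i=(i\;i{+}1)$ and acts on $\epsilon_1,\dots,\epsilon_n$ by permuting indices. The ordering of the positive roots given by $\mathbf i$ is $\alpha^{\mathbf i}_1=\alpha_{i_1,i_1+1}$ and $\alpha^{\mathbf i}_j=s_{i_1}\cdots s_{i_{j-1}}\alpha_{i_j,i_j+1}$ for $j=2,\dots,N$; each positive root occurs exactly once. The valuation $\mathrm{Val}$ of a nonzero Puiseux series is the exponent of its first non-zero (lowest order) term; its leading coefficient is the coefficient of that term. A matrix is Toeplitz if its entries are constant along each diagonal. A filling is a collection $\{n_{ij}\}_{1\le i<j\le n}$ of non-negative real numbers; it is an ideal filling if $n_{ij}=\max\{n_{i+1,j},n_{i,j-1}\}$ whenever $j-i\ge2$. *)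

theory Defs
  imports
    Complex_Main
    "HOL-Computational_Algebra.Formal_Laurent_Series"
    "HOL-Combinatorics.Permutations"
    "Jordan_Normal_Form.Matrix"
begin

section \<open>Puiseux series\<close>

text \<open>
  A Puiseux series is given by its coefficient function \<open>q \<mapsto> c\<^sub>q\<close>, standing for the formal sum
  of all \<open>c\<^sub>q t\<^sup>q\<close>.  It lies in \<open>K((t\<^sup>1\<^sup>/\<^sup>k))\<close> iff its exponents lie in \<open>(1/k)\<int>\<close> and are bounded
  below, so the type below is the union of these fields over all \<open>k > 0\<close>.
\<close>

typedef (overloaded) 'a puiseux =
  "{c :: rat \<Rightarrow> 'a::zero. \<exists>k>0. \<exists>b. \<forall>q. c q \<noteq> 0 \<longrightarrow> q * of_nat k \<in> \<int> \<and> b \<le> q}"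
  morphisms pcoeff Abs_puiseux
proof
  show "(\<lambda>q. 0) \<in> {c :: rat \<Rightarrow> 'a. \<exists>k>0. \<exists>b. \<forall>q. c q \<noteq> 0 \<longrightarrow> q * of_nat k \<in> \<int> \<and> b \<le> q}"
    by (auto intro: exI[of _ 1])
qed

lemma puiseux_eqI: "(\<And>q. pcoeff f q = pcoeff g q) \<Longrightarrow> f = g"
  by (metis ext pcoeff_inject)

instantiation puiseux :: (field) "{zero,one,plus,uminus,minus,times,inverse}"
begin

definition "(0 :: 'a puiseux) = Abs_puiseux (\<lambda>q. 0)"

definition "(1 :: 'a puiseux) = Abs_puiseux (\<lambda>q. if q = 0 then 1 else 0)"

definition "f + g = Abs_puiseux (\<lambda>q. pcoeff f q + pcoeff g q)"

definition "- f = Abs_puiseux (\<lambda>q. - pcoeff f q)"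

definition "f - g = Abs_puiseux (\<lambda>q. pcoeff f q - pcoeff g q)"

text \<open>The index set of the sum is finite, see the lemma \<open>finite_conv\<close> below.\<close>

definition "f * g = Abs_puiseux
  (\<lambda>q. \<Sum>a | pcoeff f a \<noteq> 0 \<and> pcoeff g (q - a) \<noteq> 0. pcoeff f a * pcoeff g (q - a))"

definition "inverse f = (if f = 0 then 0 else THE g :: 'a puiseux. f * g = 1)"

definition "(f :: 'a puiseux) div g = f * inverse g"

instance ..

end

text \<open>
  The field axioms are transported from Laurent series: \<open>of_fls k F\<close> is \<open>F(t\<^sup>1\<^sup>/\<^sup>k)\<close>, and finitely
  many Puiseux series have a common denominator \<open>k\<close>.
\<close>

definition of_fls :: "nat \<Rightarrow> 'a::zero fls \<Rightarrow> 'a puiseux" where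
  "of_fls k F = Abs_puiseux
     (\<lambda>q. if q * of_nat k \<in> \<int> then fls_nth F \<lfloor>q * of_nat k\<rfloor> else 0)"

lemma fls_bound:
  obtains b where "\<And>n. fls_nth F n \<noteq> 0 \<Longrightarrow> b \<le> n"
  by (meson fls_subdegree_leI)

lemma pcoeff_of_fls:
  assumes "k > 0"
  shows "pcoeff (of_fls k F) q = (if q * of_nat k \<in> \<int> then fls_nth F \<lfloor>q * of_nat k\<rfloor> else 0)"
proof -
  obtain b where b: "\<And>n. fls_nth F n \<noteq> 0 \<Longrightarrow> b \<le> n"
    using fls_bound[of F] by blast
  have "of_int b / of_nat k \<le> q" if "q * of_nat k \<in> \<int>" "fls_nth F \<lfloor>q * of_nat k\<rfloor> \<noteq> 0" for q :: rat
  proof -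
    have "of_int b \<le> q * of_nat k" using b[OF that(2)] by (simp add: le_floor_iff)
    then show ?thesis using assms by (simp add: divide_le_eq)
  qed
  then show ?thesis
    unfolding of_fls_def using assms
    by (subst Abs_puiseux_inverse)
       (auto intro!: exI[of _ k] exI[of _ "of_int b / of_nat k"] split: if_splits)
qed

lemma pcoeff_of_fls_frac:
  assumes "k > 0"
  shows "pcoeff (of_fls k F) (of_int n / of_nat k) = fls_nth F n"
  using assms by (simp add: pcoeff_of_fls)

lemma of_fls_supp:
  assumes "k > 0" "pcoeff (of_fls k F) q \<noteq> 0"
  shows "\<exists>n. q = of_int n / of_nat k"
proof -
  have "q * of_nat k \<in> \<int>" using assms by (simp add: pcoeff_of_fls split: if_splits)
  then obtain n where "q * of_nat k = of_int n" by (auto elim: Ints_cases)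
  then have "q = of_int n / of_nat k" using assms by (simp add: field_simps)
  then show ?thesis by blast
qed

lemma of_fls_cong:
  assumes "k > 0"
    and "\<And>q. pcoeff f q \<noteq> 0 \<Longrightarrow> q * of_nat k \<in> \<int>"
    and "\<And>n. pcoeff f (of_int n / of_nat k) = fls_nth F n"
  shows "f = of_fls k F"
proof (rule puiseux_eqI)
  fix q
  show "pcoeff f q = pcoeff (of_fls k F) q"
  proof (cases "q * of_nat k \<in> \<int>")
    case True
    then obtain n where "q * of_nat k = of_int n" by (auto elim: Ints_cases)
    then have "q = of_int n / of_nat k" using assms(1) by (simp add: field_simps)
    then show ?thesis using assms(1,3) by (simp add: pcoeff_of_fls_frac)
  next
    case False
    then show ?thesis using assms(1,2) by (auto simp: pcoeff_of_fls)
  qed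
qed

lemma of_fls_ex:
  assumes "k > 0" "\<And>q. pcoeff f q \<noteq> 0 \<Longrightarrow> q * of_nat k \<in> \<int>"
  shows "\<exists>F. f = of_fls k F"
proof -
  obtain b where b: "\<And>q. pcoeff f q \<noteq> 0 \<Longrightarrow> b \<le> q"
    using pcoeff[of f] by auto
  have "pcoeff f (of_int n / of_nat k) = 0" if "n < \<lfloor>b * of_nat k\<rfloor>" for n
  proof (rule ccontr)
    assume "pcoeff f (of_int n / of_nat k) \<noteq> 0"
    from b[OF this] have "b * of_nat k \<le> of_int n" using assms(1) by (simp add: le_divide_eq)
    then have "\<lfloor>b * of_nat k\<rfloor> \<le> n" by linarith
    with that show False by simp
  qed
  then have "fls_nth (Abs_fls (\<lambda>n. pcoeff f (of_int n / of_nat k))) n = pcoeff f (of_int n / of_nat k)" for n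
    by (intro nth_Abs_fls_ex_lower_bound) blast
  then have "f = of_fls k (Abs_fls (\<lambda>n. pcoeff f (of_int n / of_nat k)))"
    by (intro of_fls_cong assms) simp_all
  then show ?thesis by blast
qed

lemma pcoeff_denom:
  fixes f :: "'a::zero puiseux"
  obtains k where "k > 0" "\<And>q. pcoeff f q \<noteq> 0 \<Longrightarrow> q * of_nat k \<in> \<int>"
  using pcoeff[of f] by auto

lemma of_fls_common3:
  fixes f g h :: "'a::zero puiseux"
  obtains k F G H where "k > 0" "f = of_fls k F" "g = of_fls k G" "h = of_fls k H"
proof -
  obtain a where a: "a > 0" "\<And>q. pcoeff f q \<noteq> 0 \<Longrightarrow> q * of_nat a \<in> \<int>" using pcoeff_denom[of f] by blast
  obtain b where b: "b > 0" "\<And>q. pcoeff g q \<noteq> 0 \<Longrightarrow> q * of_nat b \<in> \<int>" using pcoeff_denom[of g] by blast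
  obtain c where c: "c > 0" "\<And>q. pcoeff h q \<noteq> 0 \<Longrightarrow> q * of_nat c \<in> \<int>" using pcoeff_denom[of h] by blast
  define k where "k = a * b * c"
  have k: "k > 0" using a b c by (simp add: k_def)
  have *: "q * of_nat (x * y) \<in> \<int>" if "q * of_nat x \<in> \<int>" for q :: rat and x y
    using Ints_mult[OF that Ints_of_nat[of y]] by (simp add: mult.assoc)
  have "\<exists>F. f = of_fls k F"
    using *[OF a(2), of _ "b * c"] by (intro of_fls_ex k) (simp add: k_def ac_simps)
  moreover have "\<exists>G. g = of_fls k G"
    using *[OF b(2), of _ "a * c"] by (intro of_fls_ex k) (simp add: k_def ac_simps)
  moreover have "\<exists>H. h = of_fls k H"
    using *[OF c(2), of _ "a * b"] by (intro of_fls_ex k) (simp add: k_def ac_simps)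
  ultimately show thesis using that k by blast
qed

lemma of_fls_inject: "k > 0 \<Longrightarrow> of_fls k F = of_fls k G \<longleftrightarrow> F = G"
  by (metis fls_eqI pcoeff_of_fls_frac)

lemma of_fls_0: "k > 0 \<Longrightarrow> of_fls k 0 = (0 :: 'a::field puiseux)"
  unfolding of_fls_def zero_puiseux_def by (rule arg_cong[where f = Abs_puiseux]) auto

lemma of_fls_1:
  assumes "k > 0"
  shows "of_fls k 1 = (1 :: 'a::field puiseux)"
proof -
  have *: "q = 0" if "q * of_nat k \<in> \<int>" "\<lfloor>q * of_nat k\<rfloor> = 0" for q :: rat
  proof -
    from that(1) obtain n where n: "q * of_nat k = of_int n" by (auto elim: Ints_cases)
    with that(2) have "n = 0" by simp
    with n assms show ?thesis by simp
  qed
  have "(\<lambda>q::rat. if q * of_nat k \<in> \<int> then fls_nth (1 :: 'a fls) \<lfloor>q * of_nat k\<rfloor> else 0) =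
      (\<lambda>q. if q = 0 then 1 else 0)"
  proof (rule ext)
    fix q :: rat
    show "(if q * of_nat k \<in> \<int> then fls_nth (1 :: 'a fls) \<lfloor>q * of_nat k\<rfloor> else 0) =
        (if q = 0 then 1 else 0)"
      using *[of q] by (cases "q = 0") auto
  qed
  then show ?thesis
    unfolding of_fls_def one_puiseux_def by simp
qed

lemma of_fls_add: "k > 0 \<Longrightarrow> of_fls k F + of_fls k G = of_fls k (F + G :: 'a::field fls)"
  unfolding plus_puiseux_def of_fls_def[of k "F + G"]
  by (auto simp: pcoeff_of_fls intro!: arg_cong[where f = Abs_puiseux])

lemma of_fls_uminus: "k > 0 \<Longrightarrow> - of_fls k F = of_fls k (- F :: 'a::field fls)"
  unfolding uminus_puiseux_def of_fls_def[of k "- F"]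
  by (auto simp: pcoeff_of_fls intro!: arg_cong[where f = Abs_puiseux])

lemma of_fls_diff: "k > 0 \<Longrightarrow> of_fls k F - of_fls k G = of_fls k (F - G :: 'a::field fls)"
  unfolding minus_puiseux_def of_fls_def[of k "F - G"]
  by (auto simp: pcoeff_of_fls intro!: arg_cong[where f = Abs_puiseux])

lemma conv_fls:
  fixes F G :: "'a::field fls"
  assumes "k > 0"
  defines "S \<equiv> \<lambda>q. {a. pcoeff (of_fls k F) a \<noteq> 0 \<and> pcoeff (of_fls k G) (q - a) \<noteq> 0}"
  shows "finite (S q)"
    and "(\<Sum>a\<in>S q. pcoeff (of_fls k F) a * pcoeff (of_fls k G) (q - a)) = pcoeff (of_fls k (F * G)) q"
proof -
  define \<phi> :: "int \<Rightarrow> rat" where "\<phi> n = of_int n / of_nat k" for n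
  have inj: "inj \<phi>" using assms(1) by (auto simp: inj_on_def \<phi>_def)
  have nth: "pcoeff (of_fls k H) (\<phi> n) = fls_nth H n" for H :: "'a fls" and n
    using assms(1) by (simp add: \<phi>_def pcoeff_of_fls_frac)
  have diff: "\<phi> n - \<phi> i = \<phi> (n - i)" for n i
    by (simp add: \<phi>_def diff_divide_distrib)
  have "finite (S q) \<and> (\<Sum>a\<in>S q. pcoeff (of_fls k F) a * pcoeff (of_fls k G) (q - a)) = pcoeff (of_fls k (F * G)) q"
  proof (cases "\<exists>n. q = \<phi> n")
    case True
    then obtain n where q: "q = \<phi> n" by blast
    define T where "T = {i. fls_nth F i \<noteq> 0 \<and> fls_nth G (n - i) \<noteq> 0}"
    have ST: "S q = \<phi> ` T"
    proof (intro equalityI subsetI)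
      fix a assume a: "a \<in> S q"
      then obtain i where "a = \<phi> i"
        using of_fls_supp[OF assms(1), of F a] unfolding S_def \<phi>_def by blast
      then show "a \<in> \<phi> ` T" using a by (auto simp: S_def T_def q diff nth)
    qed (auto simp: S_def T_def q diff nth)
    have T: "T \<subseteq> {fls_subdegree F..n - fls_subdegree G}"
      by (auto simp: T_def fls_subdegree_leI dest: fls_subdegree_leI)
    have fin: "finite T" by (rule finite_subset[OF T]) simp
    have "(\<Sum>a\<in>S q. pcoeff (of_fls k F) a * pcoeff (of_fls k G) (q - a)) =
        (\<Sum>i\<in>T. fls_nth F i * fls_nth G (n - i))"
      unfolding ST using inj by (subst sum.reindex) (auto simp: inj_on_def q diff nth)
    also have "\<dots> = (\<Sum>i = fls_subdegree F..n - fls_subdegree G. fls_nth F i * fls_nth G (n - i))"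
      by (rule sum.mono_neutral_left) (use T in \<open>auto simp: T_def\<close>)
    also have "\<dots> = pcoeff (of_fls k (F * G)) q"
      by (simp add: q nth fls_times_nth(2))
    finally show ?thesis using fin ST by simp
  next
    case False
    have "S q = {}"
    proof (rule ccontr)
      assume "S q \<noteq> {}"
      then obtain a where "a \<in> S q" by blast
      then obtain i j where "a = \<phi> i" "q - a = \<phi> j"
        using of_fls_supp[OF assms(1), of F a] of_fls_supp[OF assms(1), of G "q - a"]
        unfolding S_def \<phi>_def by blast
      then have "q = \<phi> i + \<phi> j" by (simp add: algebra_simps)
      then have "q = \<phi> (i + j)" by (simp add: \<phi>_def add_divide_distrib)
      with False show False by blast
    qed
    moreover have "pcoeff (of_fls k (F * G)) q = 0"
      using of_fls_supp[OF assms(1), of "F * G" q] False by (auto simp: \<phi>_def)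
    ultimately show ?thesis by simp
  qed
  then show "finite (S q)"
    and "(\<Sum>a\<in>S q. pcoeff (of_fls k F) a * pcoeff (of_fls k G) (q - a)) = pcoeff (of_fls k (F * G)) q"
    by blast+
qed

lemma of_fls_mult: "k > 0 \<Longrightarrow> of_fls k F * of_fls k G = of_fls k (F * G :: 'a::field fls)"
  unfolding times_puiseux_def by (simp add: conv_fls(2) pcoeff_inverse)

instance puiseux :: (field) comm_ring_1
proof
  fix f g h :: "'a puiseux"
  obtain k F G H where k: "k > 0" and fgh: "f = of_fls k F" "g = of_fls k G" "h = of_fls k H"
    by (rule of_fls_common3)
  note hom = of_fls_add[OF k] of_fls_uminus[OF k] of_fls_diff[OF k] of_fls_mult[OF k]
    of_fls_0[OF k, symmetric] of_fls_1[OF k, symmetric] of_fls_inject[OF k]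
  show "f * g * h = f * (g * h)" unfolding fgh hom by (rule mult.assoc)
  show "f * g = g * f" unfolding fgh hom by (rule mult.commute)
  show "1 * f = f" unfolding fgh hom by (rule mult_1_left)
  show "f + g + h = f + (g + h)" unfolding fgh hom by (rule add.assoc)
  show "f + g = g + f" unfolding fgh hom by (rule add.commute)
  show "0 + f = f" unfolding fgh hom by (rule add_0)
  show "- f + f = 0" unfolding fgh hom by (rule left_minus)
  show "f - g = f + - g" unfolding fgh hom by (rule diff_conv_add_uminus)
  show "(f + g) * h = f * h + g * h" unfolding fgh hom by (rule distrib_right)
  show "(0 :: 'a puiseux) \<noteq> 1" unfolding hom by (rule zero_neq_one)
qed

instance puiseux :: (field) field
proof
  fix f g :: "'a puiseux"
  show "f div g = f * inverse g" by (simp add: divide_puiseux_def)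
  show "inverse (0 :: 'a puiseux) = 0" by (simp add: inverse_puiseux_def)
  assume nz: "f \<noteq> 0"
  obtain k F G H where k: "k > 0" and f: "f = of_fls k F" "g = of_fls k G" "g = of_fls k H"
    by (rule of_fls_common3)
  have "F \<noteq> 0" using nz k f by (auto simp: of_fls_0)
  then have ex: "f * of_fls k (inverse F) = 1"
    by (simp add: f of_fls_mult[OF k] of_fls_1[OF k])
  have "f * (THE g. f * g = 1) = 1"
  proof (rule theI[of "\<lambda>g. f * g = 1"])
    show "f * of_fls k (inverse F) = 1" by (rule ex)
    fix g assume "f * g = 1"
    then show "g = of_fls k (inverse F)"
      by (metis ex mult.assoc mult.commute mult_1)
  qed
  then show "inverse f * f = 1" using nz by (simp add: inverse_puiseux_def mult.commute)
qed

lemma finite_conv: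
  fixes f g :: "'a::field puiseux"
  shows "finite {a. pcoeff f a \<noteq> 0 \<and> pcoeff g (q - a) \<noteq> 0}"
proof -
  obtain k F G H where "k > 0" "f = of_fls k F" "g = of_fls k G" "g = of_fls k H"
    by (rule of_fls_common3)
  then show ?thesis using conv_fls(1) by blast
qed

lemma pcoeff_simps:
  fixes f g :: "'a::field puiseux"
  shows "pcoeff 0 q = (0 :: 'a)"
    and "pcoeff 1 q = (if q = 0 then 1 else 0 :: 'a)"
    and "pcoeff (f + g) q = pcoeff f q + pcoeff g q"
    and "pcoeff (- f) q = - pcoeff f q"
    and "pcoeff (f - g) q = pcoeff f q - pcoeff g q"
    and "pcoeff (f * g) q =
      (\<Sum>a | pcoeff f a \<noteq> 0 \<and> pcoeff g (q - a) \<noteq> 0. pcoeff f a * pcoeff g (q - a))"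
proof -
  obtain k F G H where k: "k > 0" and fg: "f = of_fls k F" "g = of_fls k G" "g = of_fls k H"
    by (rule of_fls_common3)
  show "pcoeff 0 q = (0 :: 'a)"
    using pcoeff_of_fls[OF k, of "0 :: 'a fls" q] by (simp add: of_fls_0[OF k])
  show "pcoeff 1 q = (if q = 0 then 1 else 0 :: 'a)"
    unfolding one_puiseux_def
    by (subst Abs_puiseux_inverse) (auto intro!: exI[of _ "1::nat"] exI[of _ "0::rat"])
  show "pcoeff (f + g) q = pcoeff f q + pcoeff g q" "pcoeff (- f) q = - pcoeff f q"
    "pcoeff (f - g) q = pcoeff f q - pcoeff g q"
    by (auto simp: fg of_fls_add[OF k] of_fls_uminus[OF k] of_fls_diff[OF k] pcoeff_of_fls[OF k])
  show "pcoeff (f * g) q =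
      (\<Sum>a | pcoeff f a \<noteq> 0 \<and> pcoeff g (q - a) \<noteq> 0. pcoeff f a * pcoeff g (q - a))"
    by (simp only: fg(1,2) of_fls_mult[OF k] conv_fls(2)[OF k])
qed

text \<open>The valuation is meaningful for nonzero series only.\<close>

definition Val :: "'a::zero puiseux \<Rightarrow> rat" where
  "Val f = (LEAST q. pcoeff f q \<noteq> 0)"

definition leading_coeff :: "'a::zero puiseux \<Rightarrow> 'a" where
  "leading_coeff f = pcoeff f (Val f)"

lemma Val_attained:
  fixes f :: "'a::field puiseux"
  assumes "f \<noteq> 0"
  shows "leading_coeff f \<noteq> 0" and "pcoeff f q \<noteq> 0 \<Longrightarrow> Val f \<le> q"
proof -
  obtain k F G H where k: "k > 0" and f: "f = of_fls k F" "f = of_fls k G" "f = of_fls k H"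
    by (rule of_fls_common3)
  have F: "F \<noteq> 0" using assms k f by (auto simp: of_fls_0)
  define v :: rat where "v = of_int (fls_subdegree F) / of_nat k"
  have 1: "pcoeff f v \<noteq> 0"
    using F k by (simp add: f(1) v_def pcoeff_of_fls_frac)
  have 2: "v \<le> q" if q0: "pcoeff f q \<noteq> 0" for q
  proof -
    obtain n where q: "q = of_int n / of_nat k" using of_fls_supp[OF k, of F q] q0 f(1) by blast
    then have "fls_subdegree F \<le> n" using q0 k by (simp add: f(1) pcoeff_of_fls_frac fls_subdegree_leI)
    then show ?thesis using k by (simp add: q v_def divide_right_mono)
  qed
  have v: "Val f = v" unfolding Val_def by (rule Least_equality) (use 1 2 in auto)
  show "leading_coeff f \<noteq> 0" "pcoeff f q \<noteq> 0 \<Longrightarrow> Val f \<le> q"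
    using 1 2 by (simp_all add: leading_coeff_def v)
qed

text \<open>This entails \<open>f \<noteq> 0\<close>, since \<open>leading_coeff 0 = 0\<close>.\<close>

definition pos_leading_coeff :: "complex puiseux \<Rightarrow> bool" where
  "pos_leading_coeff f \<longleftrightarrow> (\<exists>r::real. r > 0 \<and> leading_coeff f = of_real r)"

lemma pos_leading_coeff_nonzero: "pos_leading_coeff f \<Longrightarrow> f \<noteq> 0"
  by (auto simp: pos_leading_coeff_def leading_coeff_def pcoeff_simps)


section \<open>Matrices\<close>

text \<open>
  Matrices are indexed from 0, whereas \<open>i\<close> counts rows and columns from 1: rows and columns
  \<open>i, i + 1\<close> are the 0-based indices \<open>i - 1, i\<close>.
\<close>

definition phi :: "nat \<Rightarrow> nat \<Rightarrow> 'a::zero_neq_one mat \<Rightarrow> 'a mat" where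
  "phi n i A = mat n n (\<lambda>(r, c).
     if r \<in> {i - 1, i} \<and> c \<in> {i - 1, i} then A $$ (r - (i - 1), c - (i - 1))
     else if r = c then 1 else 0)"

definition y_mat :: "nat \<Rightarrow> nat \<Rightarrow> 'a::zero_neq_one \<Rightarrow> 'a mat" where
  "y_mat n i z = phi n i (mat_of_rows_list 2 [[1, 0], [z, 1]])"

lemma y_mat_eq:
  assumes "1 \<le> i" "i < n"
  shows "y_mat n i z =
    mat n n (\<lambda>(r, c). if r = c then 1 else if r = i \<and> c = i - 1 then z else 0)"
  using assms
  by (intro eq_matI) (auto simp: y_mat_def phi_def mat_of_rows_list_def)

definition toeplitz :: "'a mat \<Rightarrow> bool" where
  "toeplitz A \<longleftrightarrow> (\<forall>i j i' j'. i < dim_row A \<and> j < dim_col A \<and> i' < dim_row A \<and> j' < dim_col A \<and>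
     int i - int j = int i' - int j' \<longrightarrow> A $$ (i, j) = A $$ (i', j'))"


section \<open>Reduced words and positive roots\<close>

definition simple_refl :: "nat \<Rightarrow> nat \<Rightarrow> nat" where
  "simple_refl i = Transposition.transpose i (Suc i)"

definition word_perm :: "nat list \<Rightarrow> nat \<Rightarrow> nat" where
  "word_perm w = foldr (\<lambda>i p. simple_refl i \<circ> p) w id"

definition coxeter_length :: "nat \<Rightarrow> (nat \<Rightarrow> nat) \<Rightarrow> nat" where
  "coxeter_length n p = (LEAST l. \<exists>w. set w \<subseteq> {1..<n} \<and> word_perm w = p \<and> length w = l)"

definition reduced_expression :: "nat \<Rightarrow> nat list \<Rightarrow> (nat \<Rightarrow> nat) \<Rightarrow> bool" where
  "reduced_expression n w p \<longleftrightarrow>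
     set w \<subseteq> {1..<n} \<and> word_perm w = p \<and> length w = coxeter_length n p"

definition longest_element :: "nat \<Rightarrow> (nat \<Rightarrow> nat) \<Rightarrow> bool" where
  "longest_element n p \<longleftrightarrow> p permutes {1..n} \<and>
     (\<forall>p'. p' permutes {1..n} \<longrightarrow> coxeter_length n p' \<le> coxeter_length n p)"

text \<open>Elements of the lattice spanned by the \<open>\<epsilon>\<^sub>k\<close> are given by their coordinate functions.\<close>

definition eps :: "nat \<Rightarrow> nat \<Rightarrow> int" where
  "eps i = (\<lambda>k. if k = i then 1 else 0)"

definition alpha :: "nat \<Rightarrow> nat \<Rightarrow> nat \<Rightarrow> int" where
  "alpha i j = (\<lambda>k. eps i k - eps j k)"

definition positive_roots :: "nat \<Rightarrow> (nat \<Rightarrow> int) set" where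
  "positive_roots n = {alpha i j | i j. 1 \<le> i \<and> i < j \<and> j \<le> n}"

text \<open>The linear action with \<open>p \<cdot> \<epsilon>\<^sub>i = \<epsilon>\<^bsub>p i\<^esub>\<close>.\<close>

definition perm_act :: "(nat \<Rightarrow> nat) \<Rightarrow> (nat \<Rightarrow> int) \<Rightarrow> nat \<Rightarrow> int" where
  "perm_act p v = v \<circ> inv_into UNIV p"

lemma perm_act_eps: "bij p \<Longrightarrow> perm_act p (eps i) = eps (p i)"
  by (auto simp: perm_act_def eps_def fun_eq_iff bij_is_inj bij_is_surj inv_f_f surj_f_inv_f)

lemma perm_act_alpha: "bij p \<Longrightarrow> perm_act p (alpha i j) = alpha (p i) (p j)"
  using perm_act_eps[of p i] perm_act_eps[of p j]
  by (simp add: perm_act_def alpha_def fun_eq_iff)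

text \<open>
  Positions in a word are counted from 0, so \<open>word_root w j\<close> is the image of the simple root of
  the \<open>(j + 1)\<close>-st letter under the product of the first \<open>j\<close> simple reflections.
\<close>

definition word_root :: "nat list \<Rightarrow> nat \<Rightarrow> nat \<Rightarrow> int" where
  "word_root w j = perm_act (word_perm (take j w)) (alpha (w ! j) (Suc (w ! j)))"

definition y_product :: "nat \<Rightarrow> nat list \<Rightarrow> ((nat \<Rightarrow> int) \<Rightarrow> 'a::field) \<Rightarrow> 'a mat" where
  "y_product n w m =
     foldr (\<lambda>j A. y_mat n (w ! j) (inverse (m (word_root w j))) * A) [0..<length w] (1\<^sub>m n)"


section \<open>Ideal fillings\<close>

text \<open>Only the values \<open>f i j\<close> with \<open>1 \<le> i < j \<le> n\<close> are relevant.\<close>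

definition filling :: "nat \<Rightarrow> (nat \<Rightarrow> nat \<Rightarrow> real) \<Rightarrow> bool" where
  "filling n f \<longleftrightarrow> (\<forall>i j. 1 \<le> i \<and> i < j \<and> j \<le> n \<longrightarrow> 0 \<le> f i j)"

definition ideal_filling :: "nat \<Rightarrow> (nat \<Rightarrow> nat \<Rightarrow> real) \<Rightarrow> bool" where
  "ideal_filling n f \<longleftrightarrow> filling n f \<and>
     (\<forall>i j. 1 \<le> i \<and> j \<le> n \<and> i + 2 \<le> j \<longrightarrow> f i j = max (f (i + 1) j) (f i (j - 1)))"

end

theory Submission
  imports Defs
begin

text \<open>
  Braid moves replace parameters \<open>(a, b, c)\<close> by \<open>(b c / (a + c), a + c, a b / (a + c))\<close>, so they keep
  positivity, and they transport valuations that come from an ideal filling: a filling is ideal iff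
  \<open>n\<^sub>i\<^sub>k = max n\<^sub>i\<^sub>j n\<^sub>j\<^sub>k\<close> whenever \<open>i < j < k\<close>.  Tits' theorem therefore reduces both claims to one
  reduced word.

  For the standard word, with parameters \<open>a k l\<close>, peeling off the factors of a Toeplitz matrix produces
  the Pade table of its symbol \<open>h\<close>.  The two three-term recursions of the Pade denominators show that
  the product is Toeplitz iff the rectangular products \<open>S k l\<close> of the parameters satisfy the T-system
  \<open>S k l ^ 2 = S (k + 1) l * S (k - 1) l + S k (l + 1) * S k (l - 1)\<close>.  Its tropicalization is
  the condition that the filling is ideal.

  Conversely, given an ideal filling, the leading coefficients are a positive solution of the T-system
  without the terms of higher order; it is found between a sub- and a supersolution.  The
  linearization at this solution satisfies a discrete maximum principle, hence it is
  invertible, and the solution lifts order by order to Puiseux series.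
\<close>

section \<open>Leading terms of Puiseux series\<close>

text \<open>Positive leading coefficients are the bridge between series and valuations: sums of such
  series never cancel, so every subtraction-free identity survives as an identity in
  \<open>min\<close> and \<open>+\<close>. The obstacle is that a braid move normally changes the
  valuations; only if the middle root carries the maximum do they just travel with their roots.
  Hence in the first claim the filling is recognized as ideal on the standard word, and only then
  carried back to \<open>w\<close>. The parameter \<open>a k l\<close> belongs to the root with
  indices \<open>k\<close> and \<open>n + 1 - l\<close>, so raising \<open>k\<close> or
  \<open>l\<close> shortens the root, and the triangle \<open>k + l \<le> n\<close> lists the
  positive roots. The T-system lives at \<open>k + l < n\<close>, the roots of height at least 2,
  which are the places where an ideal filling is constrained. The rectangular products make it
  homogeneous, with boundary values 1 at \<open>k = 0\<close> and \<open>l = 0\<close>; on the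
  diagonal \<open>k + l = n\<close> they are free, and the converse takes pure powers of
  \<open>t\<close> there.\<close>

definition lead :: "rat \<Rightarrow> 'a::field \<Rightarrow> 'a puiseux \<Rightarrow> bool" where
  "lead v c f \<longleftrightarrow> pcoeff f v = c \<and> (\<forall>q<v. pcoeff f q = 0)"

lemma lead_Val:
  assumes "lead v c f" "c \<noteq> 0"
  shows "Val f = v" and "leading_coeff f = c"
proof -
  show "Val f = v"
    unfolding Val_def by (rule Least_equality) (use assms in \<open>auto simp: lead_def not_le intro: leI\<close>)
  then show "leading_coeff f = c" using assms by (simp add: leading_coeff_def lead_def)
qed

lemma Val_lead: "f \<noteq> 0 \<Longrightarrow> lead (Val f) (leading_coeff f) f"
  using Val_attained(2)[of f] by (force simp: lead_def leading_coeff_def)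

lemma lead_weaken: "lead v c f \<Longrightarrow> w < v \<Longrightarrow> lead w 0 f"
  by (auto simp: lead_def)

lemma lead_add: "lead v c f \<Longrightarrow> lead v d g \<Longrightarrow> lead v (c + d) (f + g)"
  by (auto simp: lead_def pcoeff_simps)

lemma lead_mult:
  assumes "lead v c f" "lead w d g"
  shows "lead (v + w) (c * d) (f * g)"
proof -
  \<comment> \<open>At total exponent at most \<open>v + w\<close> one of the two factors is below
    its leading exponent, except for the single pair \<open>v\<close>, \<open>w\<close>.\<close>
  have z: "pcoeff f a = 0 \<or> pcoeff g (q - a) = 0" if "q < v + w \<or> q = v + w \<and> a \<noteq> v" for a q
  proof (cases "a < v")
    case False
    then have "q - a < w" using that by auto
    then show ?thesis using assms by (simp add: lead_def)
  qed (use assms in \<open>simp add: lead_def\<close>)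
  have "pcoeff (f * g) q = 0" if "q < v + w" for q
    unfolding pcoeff_simps by (rule sum.neutral) (use z that in auto)
  moreover have "pcoeff (f * g) (v + w) = c * d"
  proof -
    have "pcoeff (f * g) (v + w) =
        (\<Sum>a\<in>{a. pcoeff f a \<noteq> 0 \<and> pcoeff g (v + w - a) \<noteq> 0} \<inter> {v}. pcoeff f a * pcoeff g (v + w - a))"
      unfolding pcoeff_simps
      by (rule sum.mono_neutral_right) (use finite_conv[of f g] z[of "v + w"] in auto)
    also have "\<dots> = (\<Sum>a\<in>{v}. pcoeff f a * pcoeff g (v + w - a))"
      by (rule sum.mono_neutral_left) auto
    finally show ?thesis using assms by (simp add: lead_def)
  qed
  ultimately show ?thesis by (simp add: lead_def)
qed

lemma pos_leadE:
  assumes "pos_leading_coeff f"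
  obtains r where "0 < r" "lead (Val f) (complex_of_real r) f"
  using assms Val_lead[OF pos_leading_coeff_nonzero[OF assms]]
  by (auto simp: pos_leading_coeff_def)

lemma pos_leadI:
  assumes "lead v (complex_of_real r) f" "0 < r"
  shows "pos_leading_coeff f" "Val f = v"
  using lead_Val[OF assms(1)] assms(2) by (auto simp: pos_leading_coeff_def)

lemma pos_one: "pos_leading_coeff 1" "Val (1 :: complex puiseux) = 0"
  using pos_leadI[of 0 1 1] by (simp_all add: lead_def pcoeff_simps)

lemma pos_mult:
  assumes "pos_leading_coeff f" "pos_leading_coeff g"
  shows "pos_leading_coeff (f * g)" and "Val (f * g) = Val f + Val g"
proof -
  obtain r where "0 < r" "lead (Val f) (complex_of_real r) f" using pos_leadE[OF assms(1)] .
  moreover obtain s where "0 < s" "lead (Val g) (complex_of_real s) g" using pos_leadE[OF assms(2)] .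
  ultimately show "pos_leading_coeff (f * g)" "Val (f * g) = Val f + Val g"
    using pos_leadI[of "Val f + Val g" "r * s" "f * g"] lead_mult by fastforce+
qed

lemma pos_add_aux:
  assumes "pos_leading_coeff f" "pos_leading_coeff g" "Val f \<le> Val g"
  shows "pos_leading_coeff (f + g)" and "Val (f + g) = Val f"
proof -
  obtain r where r: "0 < r" "lead (Val f) (complex_of_real r) f" using pos_leadE[OF assms(1)] .
  obtain s where s: "0 < s" "lead (Val g) (complex_of_real s) g" using pos_leadE[OF assms(2)] .
  \<comment> \<open>The coefficient of \<open>g\<close> at the exponent \<open>Val f\<close> is
    positive or zero, so it cannot cancel the positive one of \<open>f\<close>.\<close>
  have "\<exists>s'\<ge>0. lead (Val f) (complex_of_real s') g"
  proof (cases "Val f = Val g")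
    case True
    then show ?thesis using s by (intro exI[of _ s]) simp
  next
    case False
    then show ?thesis using lead_weaken[OF s(2), of "Val f"] assms(3) by (intro exI[of _ 0]) simp
  qed
  then obtain s' where s': "0 \<le> s'" "lead (Val f) (complex_of_real s') g" by blast
  then have "lead (Val f) (complex_of_real (r + s')) (f + g)"
    using lead_add[OF r(2) s'(2)] by simp
  then show "pos_leading_coeff (f + g)" "Val (f + g) = Val f"
    using pos_leadI[of "Val f" "r + s'" "f + g"] r(1) s'(1) by simp_all
qed

lemma pos_add:
  assumes "pos_leading_coeff f" "pos_leading_coeff g"
  shows "pos_leading_coeff (f + g)" and "Val (f + g) = min (Val f) (Val g)"
  using pos_add_aux[OF assms] pos_add_aux[OF assms(2,1)]
  by (cases "Val f \<le> Val g"; simp add: add.commute min_def)+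

lemma pos_inverse:
  assumes "pos_leading_coeff f"
  shows "pos_leading_coeff (inverse f)" and "Val (inverse f) = - Val f"
proof -
  have nz: "inverse f \<noteq> 0" using pos_leading_coeff_nonzero[OF assms] by simp
  obtain r where r: "0 < r" "lead (Val f) (complex_of_real r) f" using pos_leadE[OF assms] .
  define c v where "c = leading_coeff (inverse f)" and "v = Val (inverse f)"
  have c: "c \<noteq> 0" "lead v c (inverse f)"
    using Val_lead[OF nz] Val_attained(1)[OF nz] by (auto simp: c_def v_def)
  have l: "lead (Val f + v) (of_real r * c) 1"
    using lead_mult[OF r(2) c(2)] pos_leading_coeff_nonzero[OF assms] by simp
  then have "Val f + v = 0"
    using lead_Val(1)[OF l] pos_one r c by simp
  moreover have "of_real r * c = 1"
    using l \<open>Val f + v = 0\<close> by (simp add: lead_def pcoeff_simps)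
  then have "c = of_real (inverse r)" using r by (simp add: field_simps)
  ultimately have "lead (- Val f) (complex_of_real (inverse r)) (inverse f)"
    using c(2) by (simp add: add_eq_0_iff)
  then show "pos_leading_coeff (inverse f)" "Val (inverse f) = - Val f"
    using pos_leadI[of "- Val f" "inverse r" "inverse f"] r by simp_all
qed

lemma pos_divide:
  assumes "pos_leading_coeff f" "pos_leading_coeff g"
  shows "pos_leading_coeff (f / g)" and "Val (f / g) = Val f - Val g"
  using pos_mult[OF assms(1) pos_inverse(1)[OF assms(2)]] pos_inverse(2)[OF assms(2)]
  by (simp_all add: divide_inverse)

lemma pos_prod:
  assumes "\<And>x. x \<in> A \<Longrightarrow> pos_leading_coeff (f x)"
  shows "pos_leading_coeff (prod f A)" and "Val (prod f A) = (\<Sum>x\<in>A. Val (f x))"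
proof -
  have "pos_leading_coeff (prod f A) \<and> Val (prod f A) = (\<Sum>x\<in>A. Val (f x))"
    using assms by (induction A rule: infinite_finite_induct) (auto simp: pos_one pos_mult)
  then show "pos_leading_coeff (prod f A)" "Val (prod f A) = (\<Sum>x\<in>A. Val (f x))" by auto
qed

section \<open>Tropicalization of the T-system\<close>

text \<open>
  The hypothesis is the T-system \<open>S k l ^ 2 = S (k + 1) l * S (k - 1) l + S k (l + 1) * S k (l - 1)\<close>,
  divided by its left-hand side, in terms of the valuations \<open>- \<mu> i j\<close> of the factors of \<open>S\<close>.
\<close>

lemma tropical_T_system_imp_ideal:
  fixes \<mu> :: "nat \<Rightarrow> nat \<Rightarrow> 'a::linordered_idom"
  assumes T: "\<And>k l. 1 \<le> k \<Longrightarrow> 1 \<le> l \<Longrightarrow> k + l < n \<Longrightarrow>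
    max (\<Sum>j=1..l. \<mu> (Suc k) j - \<mu> k j) (\<Sum>i=1..k. \<mu> i (Suc l) - \<mu> i l) = 0"
  assumes "1 \<le> k" "1 \<le> l" "k + l < n"
  shows "\<mu> k l = max (\<mu> (Suc k) l) (\<mu> k (Suc l))"
proof -
  define R where "R k l = (\<Sum>j=1..l. \<mu> (Suc k) j - \<mu> k j)" for k l
  define C where "C k l = (\<Sum>i=1..k. \<mu> i (Suc l) - \<mu> i l)" for k l
  have T: "R k l \<le> 0" "C k l \<le> 0" "R k l = 0 \<or> C k l = 0" if "1 \<le> k" "1 \<le> l" "k + l < n" for k l
    using T[OF that] by (auto simp: R_def C_def max_def split: if_splits)
  have RS: "R k (Suc l) = R k l + (\<mu> (Suc k) (Suc l) - \<mu> k (Suc l))" for k l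
    by (simp add: R_def)
  have CS: "C (Suc k) l = C k l + (\<mu> (Suc k) (Suc l) - \<mu> (Suc k) l)" for k l
    by (simp add: C_def)
  have R_last: "\<mu> (Suc k) l = \<mu> k l"
    if "R k m = 0" "\<And>j. 1 \<le> j \<Longrightarrow> j \<le> m \<Longrightarrow> \<mu> (Suc k) j \<le> \<mu> k j" "1 \<le> l" "l \<le> m" for k l m
  proof -
    have "(\<Sum>j=1..m. \<mu> k j - \<mu> (Suc k) j) = 0" using that(1) by (simp add: R_def sum_subtractf)
    then have "\<mu> k l - \<mu> (Suc k) l = 0"
      using that by (subst (asm) sum_nonneg_eq_0_iff) auto
    then show ?thesis by simp
  qed
  have C_last: "\<mu> k (Suc l) = \<mu> k l"
    if "C m l = 0" "\<And>i. 1 \<le> i \<Longrightarrow> i \<le> m \<Longrightarrow> \<mu> i (Suc l) \<le> \<mu> i l" "1 \<le> k" "k \<le> m" for k l m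
  proof -
    have "(\<Sum>i=1..m. \<mu> i l - \<mu> i (Suc l)) = 0" using that(1) by (simp add: C_def sum_subtractf)
    then have "\<mu> k l - \<mu> k (Suc l) = 0"
      using that by (subst (asm) sum_nonneg_eq_0_iff) auto
    then show ?thesis by simp
  qed
  \<comment> \<open>A bound on the sum \<open>R k l\<close> bounds its last term only if
    \<open>R k (l - 1) = 0\<close>. Otherwise \<open>C k (l - 1) = 0\<close>; its terms are
    nonpositive by induction, so they all vanish, and the inequality is reached by a detour through
    column \<open>l - 1\<close>. The other inequality is the transposed argument.\<close>
  have ineq: "\<mu> (Suc k) l \<le> \<mu> k l \<and> \<mu> k (Suc l) \<le> \<mu> k l"
    if "1 \<le> k" "1 \<le> l" "k + l < n" for k l
    using that
  proof (induction "k + l" arbitrary: k l rule: less_induct)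
    case less
    have IH: "\<mu> (Suc i) j \<le> \<mu> i j" "\<mu> i (Suc j) \<le> \<mu> i j"
      if "1 \<le> i" "1 \<le> j" "i + j < k + l" for i j
      using less.hyps[of i j] that less.prems by auto
    have 1: "\<mu> (Suc k) l \<le> \<mu> k l"
    proof (cases "l = 1 \<or> R k (l - 1) = 0")
      case True
      then have "R k (l - 1) = 0" by (auto simp: R_def)
      then show ?thesis using T(1)[of k l] RS[of k "l - 1"] less.prems by simp
    next
      case False
      then obtain l' where l: "l = Suc l'" "1 \<le> l'" using less.prems by (cases l) auto
      have C0: "C k l' = 0" using T(3)[of k l'] False l less.prems by auto
      then have eq: "\<mu> k l = \<mu> k l'"
        using C_last[OF C0, of k] IH(2)[of _ l'] l less.prems by auto
      have "\<mu> (Suc k) l \<le> \<mu> (Suc k) l'"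
        using CS[of k l'] T(2)[of "Suc k" l'] C0 l less.prems by simp
      also have "\<dots> \<le> \<mu> k l'" using IH(1)[of k l'] l less.prems by simp
      finally show ?thesis by (simp add: eq)
    qed
    have 2: "\<mu> k (Suc l) \<le> \<mu> k l"
    proof (cases "k = 1 \<or> C (k - 1) l = 0")
      case True
      then have "C (k - 1) l = 0" by (auto simp: C_def)
      then show ?thesis using T(2)[of k l] CS[of "k - 1" l] less.prems by simp
    next
      case False
      then obtain k' where k: "k = Suc k'" "1 \<le> k'" using less.prems by (cases k) auto
      have R0: "R k' l = 0" using T(3)[of k' l] False k less.prems by auto
      then have eq: "\<mu> k l = \<mu> k' l"
        using R_last[OF R0, of l] IH(1)[of k'] k less.prems by auto
      have "\<mu> k (Suc l) \<le> \<mu> k' (Suc l)"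
        using RS[of k' l] T(1)[of k' "Suc l"] R0 k less.prems by simp
      also have "\<dots> \<le> \<mu> k' l" using IH(2)[of k' l] k less.prems by simp
      finally show ?thesis by (simp add: eq)
    qed
    show ?case using 1 2 by blast
  qed
  have "\<mu> (Suc k) l = \<mu> k l \<or> \<mu> k (Suc l) = \<mu> k l"
    using T(3)[OF assms(2-4)] R_last[of k l l] C_last[of k l k] ineq assms(2-4) by auto
  then show ?thesis using ineq[OF assms(2-4)] by (auto simp: max_def)
qed

text \<open>A strict drop from row \<open>k\<close> to row \<open>k + 1\<close> in a column
  \<open>i < l\<close> forces \<open>\<mu> k (i + 1) = \<mu> k i\<close>, while row
  \<open>k + 1\<close> does not increase, so the drop persists to the right. Equality in column
  \<open>l\<close> therefore gives equality in all columns up to \<open>l\<close>, and the whole sum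
  vanishes; the same holds with rows and columns exchanged.\<close>

lemma ideal_imp_tropical_T_system:
  fixes \<mu> :: "nat \<Rightarrow> nat \<Rightarrow> 'a::linordered_idom"
  assumes ideal: "\<And>k l. 1 \<le> k \<Longrightarrow> 1 \<le> l \<Longrightarrow> k + l < n \<Longrightarrow> \<mu> k l = max (\<mu> (Suc k) l) (\<mu> k (Suc l))"
  assumes kl: "1 \<le> k" "1 \<le> l" "k + l < n"
  shows "max (\<Sum>j=1..l. \<mu> (Suc k) j - \<mu> k j) (\<Sum>i=1..k. \<mu> i (Suc l) - \<mu> i l) = 0"
proof -
  have le: "\<mu> (Suc i) j \<le> \<mu> i j" "\<mu> i (Suc j) \<le> \<mu> i j" if "1 \<le> i" "1 \<le> j" "i + j < n" for i j
    using ideal[OF that] by auto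
  have R: "\<mu> (Suc k) j = \<mu> k j" if e: "\<mu> (Suc k) l = \<mu> k l" and j: "1 \<le> j" "j \<le> l" for j
  proof (rule ccontr)
    assume ne: "\<mu> (Suc k) j \<noteq> \<mu> k j"
    have "\<mu> (Suc k) i < \<mu> k i" if "j \<le> i" "i \<le> l" for i
      using that
    proof (induction i rule: dec_induct)
      case base
      then show ?case using ne le(1)[of k j] j kl by simp
    next
      case (step i)
      have "\<mu> k (Suc i) = \<mu> k i"
        using ideal[of k i] step j kl by (auto simp: max_def split: if_splits)
      then show ?case using step le(2)[of "Suc k" i] j kl by simp
    qed
    from this[of l] show False using e j by simp
  qed
  have C: "\<mu> i (Suc l) = \<mu> i l" if e: "\<mu> k (Suc l) = \<mu> k l" and i: "1 \<le> i" "i \<le> k" for i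
  proof (rule ccontr)
    assume ne: "\<mu> i (Suc l) \<noteq> \<mu> i l"
    have "\<mu> j (Suc l) < \<mu> j l" if "i \<le> j" "j \<le> k" for j
      using that
    proof (induction j rule: dec_induct)
      case base
      then show ?case using ne le(2)[of i l] i kl by simp
    next
      case (step j)
      have "\<mu> (Suc j) l = \<mu> j l"
        using ideal[of j l] step i kl by (auto simp: max_def split: if_splits)
      then show ?case using step le(1)[of j "Suc l"] i kl by simp
    qed
    from this[of k] show False using e i by simp
  qed
  have "(\<Sum>j=1..l. \<mu> (Suc k) j - \<mu> k j) \<le> 0" "(\<Sum>i=1..k. \<mu> i (Suc l) - \<mu> i l) \<le> 0"
    by (rule sum_nonpos; use le kl in simp)+
  moreover have "\<mu> (Suc k) l = \<mu> k l \<or> \<mu> k (Suc l) = \<mu> k l"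
    using ideal[OF kl] by (auto simp: max_def)
  then have "(\<Sum>j=1..l. \<mu> (Suc k) j - \<mu> k j) = 0 \<or> (\<Sum>i=1..k. \<mu> i (Suc l) - \<mu> i l) = 0"
    using R C by auto
  ultimately show ?thesis by (auto simp: max_def)
qed

section \<open>Reduced words\<close>

lemma simple_refl_apply: "simple_refl i x = (if x = i then Suc i else if x = Suc i then i else x)"
  by (simp add: simple_refl_def transpose_def)

lemma bij_simple_refl [simp]: "bij (simple_refl i)"
  by (simp add: simple_refl_def)

lemma simple_refl_invol [simp]: "simple_refl i (simple_refl i x) = x"
  by (simp add: simple_refl_def)

lemma comp_simple_refl_twice [simp]: "p \<circ> simple_refl i \<circ> simple_refl i = p"
  by (simp add: fun_eq_iff)

lemma simple_refl_braid:
  "j = Suc i \<or> i = Suc j \<Longrightarrow>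
    simple_refl i (simple_refl j (simple_refl i x)) = simple_refl j (simple_refl i (simple_refl j x))"
  by (elim disjE; simp add: simple_refl_apply)

lemma word_perm_simps [simp]:
  "word_perm [] = id" "word_perm (i # w) = simple_refl i \<circ> word_perm w"
  by (simp_all add: word_perm_def)

lemma word_perm_append: "word_perm (u @ v) = word_perm u \<circ> word_perm v"
  by (induction u) (simp_all only: word_perm_simps append.simps comp_assoc id_comp)

lemma bij_word_perm: "bij (word_perm w)"
  by (induction w) (simp_all only: word_perm_simps bij_id bij_comp bij_simple_refl)

lemma simple_refl_permutes: "i \<in> {1..<n} \<Longrightarrow> simple_refl i permutes {1..n}"
  unfolding simple_refl_def by (rule permutes_swap_id) auto

lemma word_perm_permutes: "set w \<subseteq> {1..<n} \<Longrightarrow> word_perm w permutes {1..n}"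
  by (induction w)
    (simp_all only: word_perm_simps permutes_id list.set insert_subset permutes_compose simple_refl_permutes)

section \<open>Inversion sets and reducedness\<close>

abbreviation pinv :: "(nat \<Rightarrow> nat) \<Rightarrow> nat \<Rightarrow> nat" where
  "pinv \<equiv> inv_into UNIV"

text \<open>With the inverse permutation the pairs are the positive roots that the inverse of
  \<open>p\<close> makes negative, which are the roots attached to the letters of a reduced word of
  \<open>p\<close> read from the left.\<close>

definition inversions :: "(nat \<Rightarrow> nat) \<Rightarrow> (nat \<times> nat) set" where
  "inversions p = {(x, y). x < y \<and> pinv p y < pinv p x}"

abbreviation pairs :: "nat \<Rightarrow> (nat \<times> nat) set" where
  "pairs n \<equiv> {(x, y). 1 \<le> x \<and> x < y \<and> y \<le> n}"

lemma pairs_Suc: "pairs (Suc n) = pairs n \<union> (\<lambda>x. (x, Suc n)) ` {1..n}"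
  by auto

lemma pairs_finite_card: "finite (pairs n) \<and> card (pairs n) = n choose 2"
proof (induction n)
  case 0
  have *: "pairs 0 = {}" by auto
  show ?case unfolding * by simp
next
  case (Suc n)
  have "card (pairs (Suc n)) = card (pairs n) + card ((\<lambda>x. (x, Suc n)) ` {1..n})"
    unfolding pairs_Suc by (rule card_Un_disjoint) (use Suc in auto)
  also have "card ((\<lambda>x. (x, Suc n)) ` {1..n}) = n" by (subst card_image) (auto simp: inj_on_def)
  finally show ?case
    using Suc unfolding pairs_Suc by (simp add: numeral_2_eq_2)
qed

lemma inversions_subset:
  assumes "p permutes {1..n}"
  shows "inversions p \<subseteq> pairs n"
proof -
  have q: "pinv p permutes {1..n}" using assms by (rule permutes_inv)
  have outside: "pinv p x = x" if "x \<notin> {1..n}" for x using permutes_not_in[OF q that] .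
  have inside: "pinv p x \<in> {1..n}" if "x \<in> {1..n}" for x using permutes_in_image[OF q] that by blast
  have "1 \<le> x \<and> y \<le> n" if "x < y" "pinv p y < pinv p x" for x y
  proof -
    have "x \<in> {1..n}"
    proof (rule ccontr)
      assume *: "x \<notin> {1..n}"
      then show False
        using outside[OF *] outside[of y] that by (cases "x = 0") auto
    qed
    moreover have "y \<in> {1..n}"
    proof (rule ccontr)
      assume *: "y \<notin> {1..n}"
      then show False using outside[OF *] inside[OF \<open>x \<in> {1..n}\<close>] that \<open>x \<in> {1..n}\<close> by auto
    qed
    ultimately show ?thesis by auto
  qed
  then show ?thesis by (auto simp: inversions_def)
qed

lemma inversions_ascent:
  assumes p: "bij p" and up: "p i < p (Suc i)"
  shows "inversions (p \<circ> simple_refl i) = insert (p i, p (Suc i)) (inversions p)"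
    and "(p i, p (Suc i)) \<notin> inversions p"
proof -
  have ip: "pinv p (p a) = a" for a using p by (simp add: bij_is_inj)
  have ss: "pinv (simple_refl i) = simple_refl i" by (rule inv_equality) simp_all
  have iq: "pinv (p \<circ> simple_refl i) x = simple_refl i (pinv p x)" for x
    using o_inv_distrib[OF p bij_simple_refl] ss by simp
  have "(x, y) \<in> inversions (p \<circ> simple_refl i) \<longleftrightarrow> (x, y) \<in> insert (p i, p (Suc i)) (inversions p)" for x y
  proof -
    obtain a b where ab: "x = p a" "y = p b" using p by (metis bij_pointE)
    have eq: "p c = p d \<longleftrightarrow> c = d" for c d using p by (auto simp: bij_def inj_def)
    show ?thesis
      using up by (auto simp: inversions_def iq ip ab eq simple_refl_apply)
  qed
  then show "inversions (p \<circ> simple_refl i) = insert (p i, p (Suc i)) (inversions p)" by auto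
  show "(p i, p (Suc i)) \<notin> inversions p" by (simp add: inversions_def ip)
qed

lemma inversions_descent:
  assumes p: "bij p" and down: "p (Suc i) < p i"
  shows "inversions p = insert (p (Suc i), p i) (inversions (p \<circ> simple_refl i))"
    and "(p (Suc i), p i) \<notin> inversions (p \<circ> simple_refl i)"
  using inversions_ascent[of "p \<circ> simple_refl i" i, unfolded comp_simple_refl_twice] bij_comp[OF bij_simple_refl p] down
  by (simp_all add: simple_refl_apply)

text \<open>Reducedness in a form that can be checked letter by letter: the root of every letter is
  positive. \<open>card_inversions_word\<close> identifies it with the length being the number of
  inversions.\<close>

definition ascending_word :: "nat list \<Rightarrow> bool" where
  "ascending_word w \<longleftrightarrow> (\<forall>j<length w. word_perm (take j w) (w ! j) < word_perm (take j w) (Suc (w ! j)))"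

lemma ascending_word_Nil [simp]: "ascending_word []"
  by (simp add: ascending_word_def)

lemma ascending_word_snoc:
  "ascending_word (w @ [i]) \<longleftrightarrow> ascending_word w \<and> word_perm w i < word_perm w (Suc i)"
  by (auto simp: ascending_word_def nth_append less_Suc_eq)

lemma card_inversions_word:
  assumes "set w \<subseteq> {1..<n}"
  shows "card (inversions (word_perm w)) \<le> length w"
    and "ascending_word w \<longleftrightarrow> card (inversions (word_perm w)) = length w"
proof -
  have fin: "finite (inversions (word_perm u))" if "set u \<subseteq> {1..<n}" for u
    using inversions_subset[OF word_perm_permutes[OF that]] pairs_finite_card finite_subset by blast
  have "card (inversions (word_perm w)) \<le> length w \<and>
      (ascending_word w \<longleftrightarrow> card (inversions (word_perm w)) = length w)"
    using assms
  proof (induction w rule: rev_induct)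
    case Nil
    have "inversions id = {}" by (auto simp: inversions_def)
    then show ?case by (simp add: id_def)
  next
    case (snoc i w)
    let ?p = "word_perm w"
    have p: "word_perm (w @ [i]) = ?p \<circ> simple_refl i" by (simp add: word_perm_append)
    show ?case
    proof (cases "?p i < ?p (Suc i)")
      case True
      then have "card (inversions (word_perm (w @ [i]))) = Suc (card (inversions ?p))"
        using inversions_ascent[OF bij_word_perm True] fin[of w] snoc.prems by (simp add: p)
      then show ?thesis using snoc True by (auto simp: ascending_word_snoc comp_def)
    next
      case False
      let ?q = "?p \<circ> simple_refl i"
      have "?p i \<noteq> ?p (Suc i)" by (metis bij_word_perm bij_is_inj injD n_not_Suc_n)
      then have "?p (Suc i) < ?p i" using False by simp
      from inversions_descent[OF bij_word_perm this]
      have "card (inversions ?p) = Suc (card (inversions ?q))"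
        using fin[of "w @ [i]"] snoc.prems by (simp add: p)
      then show ?thesis using snoc False by (auto simp: ascending_word_snoc p comp_def)
    qed
  qed
  then show "card (inversions (word_perm w)) \<le> length w"
    and "ascending_word w \<longleftrightarrow> card (inversions (word_perm w)) = length w" by auto
qed

lemma permutes_increasing_imp_id:
  assumes "p permutes {1..n}" "\<And>i. i \<in> {1..<n} \<Longrightarrow> p i < p (Suc i)"
  shows "p = id"
proof (rule permutes_natset_ge[OF assms(1)])
  show "\<forall>i\<in>{1..n}. i \<le> p i"
  proof
    fix i assume "i \<in> {1..n}"
    then have "1 \<le> i" "i \<le> n" by auto
    then show "i \<le> p i"
    proof (induction i rule: dec_induct)
      case base
      then show ?case using permutes_in_image[OF assms(1), of 1] by auto
    next
      case (step i)
      then show ?case using assms(2)[of i] by auto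
    qed
  qed
qed

text \<open>Bubble sort: a permutation other than the identity has a descent, and removing it leaves
  one inversion less.\<close>

lemma ascending_word_exists:
  assumes "p permutes {1..n}"
  shows "\<exists>w. set w \<subseteq> {1..<n} \<and> ascending_word w \<and> word_perm w = p"
  using assms
proof (induction "card (inversions p)" arbitrary: p rule: less_induct)
  case less
  show ?case
  proof (cases "\<forall>i\<in>{1..<n}. p i < p (Suc i)")
    case True
    then have "p = id" using permutes_increasing_imp_id less.prems by blast
    then show ?thesis by (intro exI[of _ "[]"]) simp
  next
    case False
    then obtain i where i: "i \<in> {1..<n}" "\<not> p i < p (Suc i)" by blast
    let ?q = "p \<circ> simple_refl i"
    have q: "?q permutes {1..n}" using permutes_compose[OF simple_refl_permutes[OF i(1)] less.prems] .
    have "p i \<noteq> p (Suc i)" by (metis permutes_inj[OF less.prems] injD n_not_Suc_n)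
    then have down: "p (Suc i) < p i" using i by simp
    then have up: "?q i < ?q (Suc i)" by (simp add: simple_refl_apply)
    have "finite (inversions ?q)" using inversions_subset[OF q] pairs_finite_card finite_subset by blast
    then have "card (inversions ?q) < card (inversions p)"
      unfolding inversions_descent(1)[OF permutes_bij[OF less.prems] down]
      using inversions_descent(2)[OF permutes_bij[OF less.prems] down] by (simp add: card_insert_if)
    from less.hyps[OF this q] obtain w where w: "set w \<subseteq> {1..<n}" "ascending_word w" "word_perm w = ?q"
      by blast
    then show ?thesis
      using i up by (intro exI[of _ "w @ [i]"]) (simp add: ascending_word_snoc word_perm_append)
  qed
qed

text \<open>An ascending word of \<open>w0\<close> has as many letters as \<open>w0\<close> has
  inversions, which is at least the length \<open>n choose 2\<close>. As there are only
  \<open>n choose 2\<close> pairs, every pair is an inversion.\<close>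

lemma reduced_expression_longest:
  assumes "longest_element n w0" "length w = n choose 2" "reduced_expression n w w0"
  shows "set w \<subseteq> {1..<n}" "ascending_word w" "inversions (word_perm w) = pairs n"
proof -
  show w: "set w \<subseteq> {1..<n}" using assms by (simp add: reduced_expression_def)
  have p: "w0 permutes {1..n}" using assms by (simp add: longest_element_def)
  have w0: "word_perm w = w0" using assms by (simp add: reduced_expression_def)
  obtain u where u: "set u \<subseteq> {1..<n}" "ascending_word u" "word_perm u = w0"
    using ascending_word_exists[OF p] by blast
  have "coxeter_length n w0 \<le> length u"
    unfolding coxeter_length_def by (rule Least_le) (use u in blast)
  moreover have "card (inversions w0) = length u" using card_inversions_word(2)[OF u(1)] u by simp
  moreover have "coxeter_length n w0 = n choose 2" using assms by (simp add: reduced_expression_def)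
  moreover have sub: "inversions w0 \<subseteq> pairs n" by (rule inversions_subset[OF p])
  then have "card (inversions w0) \<le> n choose 2"
    using card_mono[OF _ sub] pairs_finite_card[of n] by simp
  ultimately have c: "card (inversions w0) = n choose 2" by simp
  then show "ascending_word w" using card_inversions_word(2)[OF w] assms(2) w0 by simp
  show "inversions (word_perm w) = pairs n"
    using card_subset_eq[OF _ sub] pairs_finite_card[of n] c w0 by auto
qed

lemma inversions_full_pinv:
  assumes p: "p permutes {1..n}" "inversions p = pairs n"
  shows "pinv p = (\<lambda>x. if x \<in> {1..n} then n + 1 - x else x)" (is "_ = ?r")
proof -
  define r where "r = ?r"
  have rr: "r (r x) = x" for x by (auto simp: r_def)
  have "bij_betw r {1..n} {1..n}" by (rule bij_betwI[of r _ _ r]) (auto simp: r_def)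
  then have r: "r permutes {1..n}" by (rule bij_imp_permutes) (auto simp: r_def)
  have ip: "pinv p permutes {1..n}" using p(1) by (rule permutes_inv)
  have "r \<circ> pinv p = id"
  proof (rule permutes_increasing_imp_id[of _ n])
    show "r \<circ> pinv p permutes {1..n}" using permutes_compose[OF ip r] .
    fix i assume i: "i \<in> {1..<n}"
    then have "(i, Suc i) \<in> inversions p" using p(2) by simp
    then have "pinv p (Suc i) < pinv p i" by (simp add: inversions_def)
    moreover have "pinv p i \<in> {1..n}" "pinv p (Suc i) \<in> {1..n}"
      using permutes_in_image[OF ip] i by simp_all
    ultimately show "(r \<circ> pinv p) i < (r \<circ> pinv p) (Suc i)" by (simp add: r_def)
  qed
  then have "r (pinv p x) = x" for x by (simp add: fun_eq_iff)
  then have "pinv p x = r x" for x using rr[of "pinv p x"] by simp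
  then show ?thesis unfolding r_def by (rule ext)
qed

lemma inversions_full_unique:
  assumes p: "p permutes {1..n}" "inversions p = pairs n"
    and q: "q permutes {1..n}" "inversions q = pairs n"
  shows "p = q"
proof -
  have "pinv p = pinv q"
    unfolding inversions_full_pinv[OF p] inversions_full_pinv[OF q] ..
  then show ?thesis
    by (metis inv_inv_eq permutes_bij p(1) q(1))
qed

text \<open>
  Tits' theorem: reduced words of a permutation are related by braid moves.  If \<open>w\<close> and \<open>w'\<close> end in
  different letters \<open>i\<close>, \<open>j\<close>, then both are related to words that end in the longest element of the
  parabolic subgroup generated by \<open>i\<close> and \<open>j\<close>.
\<close>

lemma Tits_induct:
  assumes refl: "\<And>w. R w w" and trans: "\<And>u v w. R u v \<Longrightarrow> R v w \<Longrightarrow> R u w"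
    and snoc: "\<And>u v i. R u v \<Longrightarrow> ascending_word (u @ [i]) \<Longrightarrow> ascending_word (v @ [i]) \<Longrightarrow>
      word_perm u = word_perm v \<Longrightarrow> R (u @ [i]) (v @ [i])"
    and comm: "\<And>u i j. ascending_word (u @ [i, j]) \<Longrightarrow> {i, j} \<subseteq> {1..<n} \<Longrightarrow> Suc i < j \<or> Suc j < i \<Longrightarrow>
      R (u @ [i, j]) (u @ [j, i])"
    and braid: "\<And>u i j. ascending_word (u @ [i, j, i]) \<Longrightarrow> {i, j} \<subseteq> {1..<n} \<Longrightarrow> j = Suc i \<or> i = Suc j \<Longrightarrow>
      R (u @ [i, j, i]) (u @ [j, i, j])"
    and w: "set w \<subseteq> {1..<n}" "set w' \<subseteq> {1..<n}" "ascending_word w" "ascending_word w'"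
      "word_perm w = word_perm w'"
  shows "R w w'"
  using w
proof (induction "length w" arbitrary: w w')
  case 0
  then have "length w' = length w"
    using card_inversions_word(2)[of w n] card_inversions_word(2)[of w' n] by metis
  then show ?case using 0 refl by simp
next
  case (Suc m)
  have len: "length x = length y"
    if "set x \<subseteq> {1..<n}" "set y \<subseteq> {1..<n}" "ascending_word x" "ascending_word y"
      "word_perm x = word_perm y" for x y
    using that card_inversions_word(2)[of x n] card_inversions_word(2)[of y n] by simp
  have "length w' = Suc m" using len[OF Suc.prems] Suc.hyps(2) by simp
  then obtain v j where w': "w' = v @ [j]" by (cases w' rule: rev_cases) auto
  obtain u i where w: "w = u @ [i]" using Suc.hyps(2) by (cases w rule: rev_cases) auto
  have lu: "length u = m" using w Suc.hyps(2) by simp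
  have su: "set u \<subseteq> {1..<n}" "i \<in> {1..<n}" "set v \<subseteq> {1..<n}" "j \<in> {1..<n}"
    using Suc.prems w w' by auto
  define p where "p = word_perm w"
  have p': "p = word_perm w'" unfolding p_def by (rule Suc.prems(5))
  have pu: "word_perm u = p \<circ> simple_refl i"
    by (simp add: p_def w word_perm_append)
  have pv: "word_perm v = p \<circ> simple_refl j"
    by (simp add: p' w' word_perm_append)
  have au: "ascending_word u" "word_perm u i < word_perm u (Suc i)"
    "ascending_word v" "word_perm v j < word_perm v (Suc j)"
    using Suc.prems w w' by (simp_all add: ascending_word_snoc)
  have desc: "p (Suc i) < p i" "p (Suc j) < p j"
    using au(2,4) unfolding pu pv by (simp_all add: simple_refl_apply)
  have IH: "R u y" if "set y \<subseteq> {1..<n}" "ascending_word y" "word_perm u = word_perm y" for y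
    using Suc.hyps(1)[OF lu[symmetric]] su au that by blast
  have lv: "length v = m" using \<open>length w' = Suc m\<close> w' by simp
  have IH': "R y v" if "set y \<subseteq> {1..<n}" "ascending_word y" "word_perm y = word_perm v" for y
  proof -
    have "length y = m" using len[of y v] that su au lv by simp
    then show ?thesis using Suc.hyps(1)[of y v] su au that by blast
  qed
  have pp: "p permutes {1..n}" unfolding p_def using word_perm_permutes Suc.prems by blast
  show ?case
  proof (cases "i = j")
    case True
    then have "R u v" using IH[of v] su au pu pv by simp
    then show ?thesis using snoc[of u v i] Suc.prems pu pv True w w' by simp
  next
    case False
    show ?thesis
    proof (cases "Suc i < j \<or> Suc j < i")
      case far: True
      let ?q = "p \<circ> simple_refl i \<circ> simple_refl j"
      have "?q permutes {1..n}" using pp su by (intro permutes_compose simple_refl_permutes)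
      then obtain x where x: "set x \<subseteq> {1..<n}" "ascending_word x" "word_perm x = ?q"
        using ascending_word_exists by blast
      have xi: "word_perm (x @ [i]) = word_perm v" and xj: "word_perm (x @ [j]) = word_perm u"
        using far by (auto simp: word_perm_append x(3) pu pv fun_eq_iff simple_refl_apply)
      \<comment> \<open>With both letters stripped, the descents of \<open>p\<close> at
        \<open>i\<close> and \<open>j\<close> have become ascents, so either letter may be
        appended.\<close>
      have ai: "ascending_word (x @ [i])" and aj: "ascending_word (x @ [j])"
        using x(2) far desc by (auto simp: ascending_word_snoc x(3) simple_refl_apply)
      have aji: "ascending_word ((x @ [j]) @ [i])" and aij: "ascending_word ((x @ [i]) @ [j])"
        using au by (simp_all only: ascending_word_snoc[of "x @ [j]"] ascending_word_snoc[of "x @ [i]"] xi xj ai aj)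
      have "R u (x @ [j])" using IH[of "x @ [j]"] x(1) su aj xj by simp
      then have 1: "R (u @ [i]) ((x @ [j]) @ [i])"
        by (rule snoc) (use Suc.prems(3) w aji xj in simp_all)
      have 2: "R ((x @ [j]) @ [i]) ((x @ [i]) @ [j])"
        using comm[of x j i] far su aji by auto
      have "R (x @ [i]) v" using IH'[of "x @ [i]"] x(1) su ai xi by simp
      then have 3: "R ((x @ [i]) @ [j]) (v @ [j])"
        by (rule snoc) (use Suc.prems(4) w' aij xi in simp_all)
      show ?thesis unfolding w w' by (rule trans[OF 1 trans[OF 2 3]])
    next
      case near: False
      then have ij: "j = Suc i \<or> i = Suc j" using False by auto
      let ?q = "p \<circ> simple_refl i \<circ> simple_refl j \<circ> simple_refl i"
      have "?q permutes {1..n}" using pp su by (intro permutes_compose simple_refl_permutes)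
      then obtain x where x: "set x \<subseteq> {1..<n}" "ascending_word x" "word_perm x = ?q"
        using ascending_word_exists by blast
      have xij: "word_perm ((x @ [i]) @ [j]) = word_perm u" and xji: "word_perm ((x @ [j]) @ [i]) = word_perm v"
        by (simp_all add: word_perm_append x(3) pu pv fun_eq_iff simple_refl_braid[OF ij])
      have aij: "ascending_word ((x @ [i]) @ [j])" and aji: "ascending_word ((x @ [j]) @ [i])"
        unfolding ascending_word_snoc using x(2) ij desc
        by (elim disjE; simp add: word_perm_append x(3) simple_refl_apply)+
      have aiji: "ascending_word (((x @ [i]) @ [j]) @ [i])"
        and ajij: "ascending_word (((x @ [j]) @ [i]) @ [j])"
        using au by (simp_all only: ascending_word_snoc[of "(x @ [i]) @ [j]"]
          ascending_word_snoc[of "(x @ [j]) @ [i]"] xij xji aij aji)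
      have "R u ((x @ [i]) @ [j])" using IH[of "(x @ [i]) @ [j]"] x(1) su aij xij by simp
      then have 1: "R (u @ [i]) (((x @ [i]) @ [j]) @ [i])"
        by (rule snoc) (use Suc.prems(3) w aiji xij in simp_all)
      have 2: "R (((x @ [i]) @ [j]) @ [i]) (((x @ [j]) @ [i]) @ [j])"
        using braid[of x i j] ij su aiji by auto
      have "R ((x @ [j]) @ [i]) v" using IH'[of "(x @ [j]) @ [i]"] x(1) su aji xji by simp
      then have 3: "R (((x @ [j]) @ [i]) @ [j]) (v @ [j])"
        by (rule snoc) (use Suc.prems(4) w' ajij xji in simp_all)
      show ?thesis unfolding w w' by (rule trans[OF 1 trans[OF 2 3]])
    qed
  qed
qed

text \<open>A pair \<open>(x, y)\<close> stands for \<open>alpha x y\<close>. The accumulator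
  \<open>p\<close> is the permutation of the letters already read, so the list of a composite word
  splits as in \<open>roots_append\<close> and a braid move alters only a segment of it.\<close>

fun roots :: "(nat \<Rightarrow> nat) \<Rightarrow> nat list \<Rightarrow> (nat \<times> nat) list" where
  "roots p [] = []"
| "roots p (i # w) = (p i, p (Suc i)) # roots (p \<circ> simple_refl i) w"

lemma length_roots [simp]: "length (roots p w) = length w"
  by (induction w arbitrary: p) auto

lemma roots_append: "roots p (u @ v) = roots p u @ roots (p \<circ> word_perm u) v"
  by (induction u arbitrary: p) (simp_all add: comp_assoc)

lemma roots_ascending:
  assumes "ascending_word w"
  shows "distinct (roots id w)" "set (roots id w) = inversions (word_perm w)"
proof -
  have "distinct (roots id w) \<and> set (roots id w) = inversions (word_perm w)"
    using assms
  proof (induction w rule: rev_induct)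
    case Nil
    then show ?case by (simp add: inversions_def)
  next
    case (snoc i w)
    then have up: "word_perm w i < word_perm w (Suc i)"
      and IH: "distinct (roots id w)" "set (roots id w) = inversions (word_perm w)"
      by (simp_all add: ascending_word_snoc id_def)
    have "word_perm (w @ [i]) = word_perm w \<circ> simple_refl i" by (simp add: word_perm_append)
    moreover have "roots id (w @ [i]) = roots id w @ [(word_perm w i, word_perm w (Suc i))]"
      by (simp add: roots_append)
    ultimately show ?case
      using inversions_ascent[OF bij_word_perm up] IH by (simp add: comp_def id_def)
  qed
  then show "distinct (roots id w)" "set (roots id w) = inversions (word_perm w)" by auto
qed

lemma word_root_eq_alpha:
  assumes "j < length w"
  shows "word_root w j = case_prod alpha (roots id w ! j)"
proof -
  have "roots id w ! j = (word_perm (take j w) (w ! j), word_perm (take j w) (Suc (w ! j)))"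
    using assms
    by (subst id_take_nth_drop[OF assms]) (simp add: roots_append nth_append)
  then show ?thesis
    by (simp add: word_root_def perm_act_alpha[OF bij_word_perm])
qed

lemma alpha_inject:
  assumes "x < y" "x' < y'" "alpha x y = alpha x' y'"
  shows "x = x'" "y = y'"
proof -
  have "alpha x y x = alpha x' y' x" "alpha x y y = alpha x' y' y" using assms(3) by simp_all
  then show "x = x'" "y = y'" using assms(1,2) by (auto simp: alpha_def eps_def split: if_splits)
qed

section \<open>Braid moves on factorizations\<close>

text \<open>The parameters are a plain list, in contrast to \<open>y_product\<close>, where they are
  the inverses of values attached to roots: a braid move replaces them by new series.\<close>

definition yprod :: "nat \<Rightarrow> nat list \<Rightarrow> 'a::field list \<Rightarrow> 'a mat" where
  "yprod n w as = foldr (\<lambda>(i, a) A. y_mat n i a * A) (zip w as) (1\<^sub>m n)"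

lemma y_mat_carrier [simp]: "y_mat n i z \<in> carrier_mat n n"
  by (simp add: y_mat_def phi_def)

lemma dim_y_mat [simp]: "dim_row (y_mat n i z) = n" "dim_col (y_mat n i z) = n"
  by (simp_all add: y_mat_def phi_def)

lemma yprod_carrier [simp]: "yprod n w as \<in> carrier_mat n n"
proof -
  have "foldr (\<lambda>(i, a) A. y_mat n i a * A) xs (1\<^sub>m n) \<in> carrier_mat n n" for xs :: "(nat \<times> 'a) list"
    by (induction xs) (auto intro!: mult_carrier_mat)
  then show ?thesis by (simp add: yprod_def)
qed

lemma yprod_append:
  assumes "length w = length as"
  shows "yprod n (w @ w') (as @ as') = yprod n w as * yprod n w' as'"
  using assms
proof (induction w as rule: list_induct2)
  case Nil
  then show ?case by (simp add: yprod_def left_mult_one_mat[OF yprod_carrier, unfolded yprod_def])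
next
  case (Cons i w a as)
  then show ?case
    using assoc_mult_mat[OF y_mat_carrier yprod_carrier yprod_carrier, of n i a w as w' as']
    by (simp add: yprod_def)
qed

lemma yprod_Cons: "yprod n (i # w) (a # as) = y_mat n i a * yprod n w as"
  by (simp add: yprod_def)

lemma yprod_Nil: "yprod n [] [] = 1\<^sub>m n"
  by (simp add: yprod_def)

lemma y_mat_mult_left:
  assumes "1 \<le> i" "i < n" "A \<in> carrier_mat n n" "r < n" "c < n"
  shows "(y_mat n i z * A) $$ (r, c) = A $$ (r, c) + (if r = i then z * A $$ (i - 1, c) else (0 :: 'a :: field))"
proof -
  have "(y_mat n i z * A) $$ (r, c) = (\<Sum>k<n. y_mat n i z $$ (r, k) * A $$ (k, c))"
    using carrier_matD[OF assms(3)] assms(4,5) by (simp add: scalar_prod_def atLeast0LessThan)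
  also have "\<dots> = (\<Sum>k<n. (if k = r then A $$ (k, c) else 0) + (if k = i - 1 then (if r = i then z * A $$ (k, c) else 0) else 0))"
    using assms by (intro sum.cong) (auto simp: y_mat_eq)
  also have "\<dots> = A $$ (r, c) + (if r = i then z * A $$ (i - 1, c) else 0)"
    using assms less_trans[of "i - 1" i n] by (simp add: sum.distrib)
  finally show ?thesis .
qed

lemma y_mat_comm:
  assumes "{i, j} \<subseteq> {1..<n}" "Suc i < j \<or> Suc j < i" "A \<in> carrier_mat n n"
  shows "y_mat n i a * (y_mat n j b * A) = y_mat n j b * (y_mat n i a * (A :: 'a::field mat))"
proof (rule eq_matI)
  have c: "y_mat n k z * A \<in> carrier_mat n n" for k z
    using mult_carrier_mat[OF y_mat_carrier assms(3)] .
  show "dim_row (y_mat n i a * (y_mat n j b * A)) = dim_row (y_mat n j b * (y_mat n i a * A))"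
    "dim_col (y_mat n i a * (y_mat n j b * A)) = dim_col (y_mat n j b * (y_mat n i a * A))"
    using carrier_matD[OF assms(3)] by simp_all
  fix r s assume "r < dim_row (y_mat n j b * (y_mat n i a * A))" "s < dim_col (y_mat n j b * (y_mat n i a * A))"
  then have rs: "r < n" "s < n" using carrier_matD[OF assms(3)] by simp_all
  have ij: "1 \<le> i" "i < n" "1 \<le> j" "j < n" "i - 1 < n" "j - 1 < n" using assms(1) by auto
  show "(y_mat n i a * (y_mat n j b * A)) $$ (r, s) = (y_mat n j b * (y_mat n i a * A)) $$ (r, s)"
    using assms(2) rs ij
    by (auto simp: y_mat_mult_left[OF ij(1,2) c] y_mat_mult_left[OF ij(3,4) c]
      y_mat_mult_left[OF ij(1,2) assms(3)] y_mat_mult_left[OF ij(3,4) assms(3)])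
qed

text \<open>The hypotheses compare the entries of the two products of three factors, cleared of
  denominators. Besides the first one, the case \<open>j = Suc i\<close> rests on the second and the
  case \<open>i = Suc j\<close> on the third.\<close>

lemma y_mat_braid:
  assumes "{i, j} \<subseteq> {1..<n}" "j = Suc i \<or> i = Suc j" "A \<in> carrier_mat n n"
    and h: "x + z = b" "x * (a + c) = b * c" "(a + c) * z = a * b"
  shows "y_mat n i a * (y_mat n j b * (y_mat n i c * A)) =
    y_mat n j x * (y_mat n i (a + c) * (y_mat n j z * (A :: 'a::field mat)))"
    (is "?L = ?R")
proof (rule eq_matI)
  have c1: "y_mat n k z * A \<in> carrier_mat n n" for k z
    using mult_carrier_mat[OF y_mat_carrier assms(3)] .
  have c2: "y_mat n l y * (y_mat n k z * A) \<in> carrier_mat n n" for k z l y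
    using mult_carrier_mat[OF y_mat_carrier c1] .
  show "dim_row ?L = dim_row ?R" "dim_col ?L = dim_col ?R"
    using carrier_matD[OF assms(3)] by simp_all
  fix r s assume "r < dim_row ?R" "s < dim_col ?R"
  then have rs: "r < n" "s < n" using carrier_matD[OF assms(3)] by simp_all
  have ij: "1 \<le> i" "i < n" "1 \<le> j" "j < n" "i - 1 < n" "j - 1 < n" using assms(1) by auto
  note Y = y_mat_mult_left c1 c2 assms(3)
  show "?L $$ (r, s) = ?R $$ (r, s)"
    using assms(2)
  proof
    assume j: "j = Suc i"
    have L: "?L $$ (r, s) = A $$ (r, s) + (if r = i then (a + c) * A $$ (i - 1, s) else 0)
        + (if r = j then b * (A $$ (i, s) + c * A $$ (i - 1, s)) else 0)"
      using rs ij unfolding j by (auto simp: Y algebra_simps)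
    have "?R $$ (r, s) = A $$ (r, s) + (if r = i then (a + c) * A $$ (i - 1, s) else 0)
        + (if r = j then z * A $$ (i, s) + x * (A $$ (i, s) + (a + c) * A $$ (i - 1, s)) else 0)"
      using rs ij unfolding j by (auto simp: Y algebra_simps)
    moreover have "z * A $$ (i, s) + x * (A $$ (i, s) + (a + c) * A $$ (i - 1, s)) =
        (x + z) * A $$ (i, s) + x * (a + c) * A $$ (i - 1, s)" by (simp add: algebra_simps)
    ultimately show ?thesis unfolding L h by (simp add: algebra_simps)
  next
    assume j: "i = Suc j"
    have L: "?L $$ (r, s) = A $$ (r, s) + (if r = j then b * A $$ (j - 1, s) else 0)
        + (if r = i then (a + c) * A $$ (j, s) + a * b * A $$ (j - 1, s) else 0)"
      using rs ij unfolding j by (auto simp: Y algebra_simps)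
    have "?R $$ (r, s) = A $$ (r, s) + (if r = j then x * A $$ (j - 1, s) + z * A $$ (j - 1, s) else 0)
        + (if r = i then (a + c) * A $$ (j, s) + (a + c) * z * A $$ (j - 1, s) else 0)"
      using rs ij unfolding j by (auto simp: Y algebra_simps)
    then show ?thesis unfolding L h distrib_right[symmetric] by simp
  qed
qed

text \<open>The parameters are inverses of the series attached to the roots, hence the sign.\<close>

definition fits :: "(nat \<Rightarrow> nat \<Rightarrow> rat) \<Rightarrow> nat list \<Rightarrow> complex puiseux list \<Rightarrow> bool" where
  "fits \<mu> w as \<longleftrightarrow> list_all2 (\<lambda>a (x, y). Val a = - \<mu> x y) as (roots id w)"

definition ultra :: "nat \<Rightarrow> (nat \<Rightarrow> nat \<Rightarrow> 'a::linorder) \<Rightarrow> bool" where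
  "ultra n \<mu> \<longleftrightarrow> (\<forall>i j k. 1 \<le> i \<and> i < j \<and> j < k \<and> k \<le> n \<longrightarrow> \<mu> i k = max (\<mu> i j) (\<mu> j k))"

lemma fits_append:
  assumes "length u = length as"
  shows "fits \<mu> (u @ v) (as @ bs) \<longleftrightarrow> fits \<mu> u as \<and>
    list_all2 (\<lambda>a (x, y). Val a = - \<mu> x y) bs (roots (word_perm u) v)"
  using assms by (simp add: fits_def roots_append list_all2_append)

text \<open>
  The relation that braid moves establish between words: the parameters can be changed so that
  the product is kept and, for ideal fillings, also the tropical parametrization.
\<close>

definition transfers :: "nat \<Rightarrow> nat list \<Rightarrow> nat list \<Rightarrow> bool" where
  "transfers n w w' \<longleftrightarrow> (\<forall>as. length as = length w \<and> (\<forall>a\<in>set as. pos_leading_coeff a) \<longrightarrow>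
    (\<exists>as'. length as' = length w' \<and> (\<forall>a\<in>set as'. pos_leading_coeff a) \<and>
      yprod n w as = yprod n w' as' \<and> (\<forall>\<mu>. ultra n \<mu> \<longrightarrow> (fits \<mu> w as \<longleftrightarrow> fits \<mu> w' as'))))"

section \<open>Transfer of parametrizations between reduced words\<close>

lemma transfers_trans:
  assumes "transfers n u v" "transfers n v w"
  shows "transfers n u w"
  unfolding transfers_def
proof (intro allI impI)
  fix as assume as: "length as = length u \<and> (\<forall>a\<in>set as. pos_leading_coeff a)"
  from assms(1)[unfolded transfers_def, rule_format, OF this]
  obtain bs where bs: "length bs = length v \<and> (\<forall>a\<in>set bs. pos_leading_coeff a)"
    "yprod n u as = yprod n v bs" "\<forall>\<mu>. ultra n \<mu> \<longrightarrow> (fits \<mu> u as \<longleftrightarrow> fits \<mu> v bs)"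
    by blast
  from assms(2)[unfolded transfers_def, rule_format, OF bs(1)]
  obtain cs where cs: "length cs = length w" "\<forall>a\<in>set cs. pos_leading_coeff a"
    "yprod n v bs = yprod n w cs" "\<forall>\<mu>. ultra n \<mu> \<longrightarrow> (fits \<mu> v bs \<longleftrightarrow> fits \<mu> w cs)"
    by blast
  show "\<exists>as'. length as' = length w \<and> (\<forall>a\<in>set as'. pos_leading_coeff a) \<and>
      yprod n u as = yprod n w as' \<and> (\<forall>\<mu>. ultra n \<mu> \<longrightarrow> (fits \<mu> u as \<longleftrightarrow> fits \<mu> w as'))"
    using bs cs by (intro exI[of _ cs]) simp
qed

text \<open>Equal permutations give the appended letter the same root in both words, so its
  parameter is kept.\<close>

lemma transfers_snoc:
  assumes "transfers n u v" "word_perm u = word_perm v"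
  shows "transfers n (u @ [i]) (v @ [i])"
  unfolding transfers_def
proof (intro allI impI)
  fix as assume as: "length as = length (u @ [i]) \<and> (\<forall>a\<in>set as. pos_leading_coeff a)"
  then obtain bs b where bs: "as = bs @ [b]" by (cases as rule: rev_cases) auto
  then have "length bs = length u \<and> (\<forall>a\<in>set bs. pos_leading_coeff a)" using as by simp
  from assms(1)[unfolded transfers_def, rule_format, OF this]
  obtain bs' where *: "length bs' = length v" "\<forall>a\<in>set bs'. pos_leading_coeff a"
    "yprod n u bs = yprod n v bs'" "\<forall>\<mu>. ultra n \<mu> \<longrightarrow> (fits \<mu> u bs \<longleftrightarrow> fits \<mu> v bs')"
    by blast
  show "\<exists>as'. length as' = length (v @ [i]) \<and> (\<forall>a\<in>set as'. pos_leading_coeff a) \<and>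
      yprod n (u @ [i]) as = yprod n (v @ [i]) as' \<and>
      (\<forall>\<mu>. ultra n \<mu> \<longrightarrow> (fits \<mu> (u @ [i]) as \<longleftrightarrow> fits \<mu> (v @ [i]) as'))"
    using as * assms(2)
    by (intro exI[of _ "bs' @ [b]"]) (auto simp: bs yprod_append fits_append)
qed

lemma transfers_comm:
  assumes ij: "{i, j} \<subseteq> {1..<n}" "Suc i < j \<or> Suc j < i"
  shows "transfers n (u @ [i, j]) (u @ [j, i])"
  unfolding transfers_def
proof (intro allI impI)
  fix as assume as: "length as = length (u @ [i, j]) \<and> (\<forall>a\<in>set as. pos_leading_coeff a)"
  define bs where "bs = take (length u) as"
  have "length (drop (length u) as) = 2" using as by simp
  then obtain a b where ab: "drop (length u) as = [a, b]"
    by (auto simp: numeral_2_eq_2 length_Suc_conv simp del: length_drop)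
  have bs: "as = bs @ [a, b]" "length bs = length u"
    using as append_take_drop_id[of "length u" as] by (auto simp: bs_def ab)
  have r: "roots (word_perm u) [i, j] = [(word_perm u i, word_perm u (Suc i)), (word_perm u j, word_perm u (Suc j))]"
    "roots (word_perm u) [j, i] = [(word_perm u j, word_perm u (Suc j)), (word_perm u i, word_perm u (Suc i))]"
    using ij(2) by (auto simp: simple_refl_apply)
  have "yprod n [i, j] [a, b] = yprod n [j, i] [b, a]"
    unfolding yprod_Cons yprod_Nil by (rule y_mat_comm[OF ij one_carrier_mat])
  then show "\<exists>as'. length as' = length (u @ [j, i]) \<and> (\<forall>a\<in>set as'. pos_leading_coeff a) \<and>
      yprod n (u @ [i, j]) as = yprod n (u @ [j, i]) as' \<and>
      (\<forall>\<mu>. ultra n \<mu> \<longrightarrow> (fits \<mu> (u @ [i, j]) as \<longleftrightarrow> fits \<mu> (u @ [j, i]) as'))"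
    using as bs by (intro exI[of _ "bs @ [b, a]"]) (auto simp: yprod_append fits_append r simp del: roots.simps)
qed

text \<open>The middle root \<open>B\<close> is the sum of the outer roots \<open>A\<close> and
  \<open>C\<close>, so fitting an \<open>ultra\<close> filling entails
  \<open>Val b = min (Val a) (Val c)\<close>. Then the new parameters have the valuations
  \<open>Val c\<close>, \<open>Val b\<close>, \<open>Val a\<close>, in accordance with the reversed
  order of the roots.\<close>

lemma transfers_braid:
  assumes ij: "{i, j} \<subseteq> {1..<n}" "j = Suc i \<or> i = Suc j"
    and asc: "ascending_word (u @ [i, j, i])" and u: "set u \<subseteq> {1..<n}"
  shows "transfers n (u @ [i, j, i]) (u @ [j, i, j])"
  unfolding transfers_def
proof (intro allI impI)
  fix as assume as: "length as = length (u @ [i, j, i]) \<and> (\<forall>a\<in>set as. pos_leading_coeff a)"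
  define bs where "bs = take (length u) as"
  have "length (drop (length u) as) = 3" using as by simp
  then obtain a b c where abc: "drop (length u) as = [a, b, c]"
    by (auto simp: numeral_3_eq_3 length_Suc_conv simp del: length_drop)
  have bs: "as = bs @ [a, b, c]" "length bs = length u"
    using as append_take_drop_id[of "length u" as] by (auto simp: bs_def abc)
  have pos: "pos_leading_coeff a" "pos_leading_coeff b" "pos_leading_coeff c" using as bs by auto
  have ac: "pos_leading_coeff (a + c)" "Val (a + c) = min (Val a) (Val c)" using pos_add pos by auto
  define p where "p = word_perm u"
  have pp: "p permutes {1..n}" unfolding p_def by (rule word_perm_permutes[OF u])
  have asc1: "p i < p (Suc i)"
    using asc ascending_word_snoc[of "(u @ [i]) @ [j]" i] ascending_word_snoc[of "u @ [i]" j] ascending_word_snoc[of u i]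
    by (simp add: p_def)
  have asc3: "p (simple_refl i (simple_refl j i)) < p (simple_refl i (simple_refl j (Suc i)))"
    using asc ascending_word_snoc[of "(u @ [i]) @ [j]" i]
    by (simp add: p_def word_perm_append)
  obtain A B C where r: "roots p [i, j, i] = [A, B, C]" "roots p [j, i, j] = [C, B, A]"
    and ABC: "\<And>\<mu>. ultra n \<mu> \<Longrightarrow> case_prod \<mu> B = max (case_prod \<mu> A) (case_prod \<mu> C :: rat)"
    using ij(2)
  proof
    assume j: "j = Suc i"
    have "p i \<in> {1..n}" "p (Suc j) \<in> {1..n}" using permutes_in_image[OF pp] ij by auto
    then show thesis
      using j asc1 asc3
      by (intro that[of "(p i, p j)" "(p i, p (Suc j))" "(p j, p (Suc j))"])
         (auto simp: simple_refl_apply ultra_def)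
  next
    assume j: "i = Suc j"
    have "p j \<in> {1..n}" "p (Suc i) \<in> {1..n}" using permutes_in_image[OF pp] ij by auto
    then show thesis
      using j asc1 asc3
      by (intro that[of "(p i, p (Suc i))" "(p j, p (Suc i))" "(p j, p i)"])
         (auto simp: simple_refl_apply ultra_def max.commute)
  qed
  let ?a = "b * c / (a + c)" and ?b = "a + c" and ?c = "a * b / (a + c)"
  have pos': "pos_leading_coeff ?a" "pos_leading_coeff ?c"
    and V: "Val ?a = Val b + Val c - min (Val a) (Val c)" "Val ?c = Val a + Val b - min (Val a) (Val c)"
    using pos ac by (auto simp: pos_mult pos_divide)
  have nz: "a + c \<noteq> 0" using pos_leading_coeff_nonzero[OF ac(1)] .
  have "?a + ?c = b * (a + c) / (a + c)"
    unfolding add_divide_distrib[symmetric] by (simp add: algebra_simps)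
  then have h: "?a + ?c = b" "?a * ?b = b * c" "?b * ?c = a * b"
    using nz by simp_all
  have y: "yprod n [i, j, i] [a, b, c] = yprod n [j, i, j] [?a, ?b, ?c]"
    unfolding yprod_Cons yprod_Nil by (rule y_mat_braid[OF ij one_carrier_mat h])
  \<comment> \<open>In the converse direction, too, the maximum decides: fitting after the move
    forces \<open>Val b = min (Val a) (Val c)\<close> before it.\<close>
  have f: "list_all2 (\<lambda>a (x, y). Val a = - \<mu> x y) [a, b, c] [A, B, C] \<longleftrightarrow>
      list_all2 (\<lambda>a (x, y). Val a = - \<mu> x y) [?a, ?b, ?c] [C, B, A]" if "ultra n \<mu>" for \<mu>
    using ABC[OF that] by (auto simp: V ac case_prod_beta min_def max_def split: if_splits)
  show "\<exists>as'. length as' = length (u @ [j, i, j]) \<and> (\<forall>a\<in>set as'. pos_leading_coeff a) \<and>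
      yprod n (u @ [i, j, i]) as = yprod n (u @ [j, i, j]) as' \<and>
      (\<forall>\<mu>. ultra n \<mu> \<longrightarrow> (fits \<mu> (u @ [i, j, i]) as \<longleftrightarrow> fits \<mu> (u @ [j, i, j]) as'))"
    using as bs y f pos' ac
    by (intro exI[of _ "bs @ [?a, ?b, ?c]"])
       (simp add: yprod_append fits_append r p_def[symmetric] del: roots.simps list_all2_Cons)
qed

lemma transfers_ascending:
  assumes "set w \<subseteq> {1..<n}" "set w' \<subseteq> {1..<n}" "ascending_word w" "ascending_word w'"
    "word_perm w = word_perm w'"
  shows "transfers n w w'"
proof -
  \<comment> \<open>The range of the letters is carried inside \<open>R\<close>: the hypotheses that
    \<open>Tits_induct\<close> gives for a move do not bound the letters of the prefix
    \<open>u\<close>, which \<open>transfers_braid\<close> needs.\<close>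
  define R where "R u v \<longleftrightarrow> (set u \<subseteq> {1..<n} \<longrightarrow> set v \<subseteq> {1..<n} \<and> transfers n u v)" for u v
  have "R w w'"
  proof (rule Tits_induct[OF _ _ _ _ _ assms])
    show "R u u" for u by (auto simp: R_def transfers_def)
    show "R u w" if "R u v" "R v w" for u v w
      using that transfers_trans[of n u v w] unfolding R_def by blast
    show "R (u @ [i]) (v @ [i])" if "R u v" "word_perm u = word_perm v" for u v i
      using that transfers_snoc[of n u v i] by (simp add: R_def)
    show "R (u @ [i, j]) (u @ [j, i])" if "{i, j} \<subseteq> {1..<n}" "Suc i < j \<or> Suc j < i" for u i j
      using that(1) transfers_comm[OF that] by (simp add: R_def)
    show "R (u @ [i, j, i]) (u @ [j, i, j])"
      if "ascending_word (u @ [i, j, i])" "{i, j} \<subseteq> {1..<n}" "j = Suc i \<or> i = Suc j" for u i j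
      using that(2) transfers_braid[OF that(2,3,1)] by (simp add: R_def)
  qed
  then show ?thesis using assms(1) by (simp add: R_def)
qed

lemma y_product_eq_yprod:
  "y_product n w m = yprod n w (map (\<lambda>j. inverse (m (word_root w j))) [0..<length w])"
proof -
  have "zip w (map (\<lambda>j. inverse (m (word_root w j))) [0..<length w]) =
      map (\<lambda>j. (w ! j, inverse (m (word_root w j)))) [0..<length w]"
    by (rule nth_equalityI) auto
  then show ?thesis by (simp add: y_product_def yprod_def foldr_map comp_def)
qed

section \<open>Pade approximants and the T-system\<close>

text \<open>
  The denominators of the Pade approximants of a power series \<open>h\<close>, built from the parameters \<open>a\<close>
  of a factorization of the Toeplitz matrix of \<open>h\<close>: \<open>pade a k l * h\<close> has no terms in the
  degrees \<open>k, \<dots>, k + l - 1\<close>.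
\<close>

fun pade :: "(nat \<Rightarrow> nat \<Rightarrow> 'a::field) \<Rightarrow> nat \<Rightarrow> nat \<Rightarrow> 'a fps" where
  "pade a k 0 = 1"
| "pade a k (Suc l) = pade a (Suc k) l - fps_X * (fps_const (a k (Suc l)) * pade a k l)"

definition T_system :: "nat \<Rightarrow> (nat \<Rightarrow> nat \<Rightarrow> 'a::comm_ring_1) \<Rightarrow> bool" where
  "T_system n S \<longleftrightarrow> (\<forall>k l. 1 \<le> k \<and> 1 \<le> l \<and> k + l < n \<longrightarrow>
    S k l ^ 2 = S (Suc k) l * S (k - 1) l + S k (Suc l) * S k (l - 1))"

definition rect_prod :: "(nat \<Rightarrow> nat \<Rightarrow> 'a::comm_ring_1) \<Rightarrow> nat \<Rightarrow> nat \<Rightarrow> 'a" where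
  "rect_prod a k l = (\<Prod>i=1..k. \<Prod>j=1..l. a i j)"

lemma rect_prod_0 [simp]: "rect_prod a 0 l = 1" "rect_prod a k 0 = 1"
  by (simp_all add: rect_prod_def)

lemma rect_prod_Suc:
  "rect_prod a (Suc k) l = rect_prod a k l * (\<Prod>j=1..l. a (Suc k) j)"
  "rect_prod a k (Suc l) = rect_prod a k l * (\<Prod>i=1..k. a i (Suc l))"
  by (simp_all add: rect_prod_def prod.distrib)

lemma rect_prod_nonzero:
  fixes a :: "nat \<Rightarrow> nat \<Rightarrow> 'a::field"
  assumes "\<And>i j. 1 \<le> i \<Longrightarrow> 1 \<le> j \<Longrightarrow> i + j \<le> n \<Longrightarrow> a i j \<noteq> 0" "k + l \<le> n"
  shows "rect_prod a k l \<noteq> 0" "1 \<le> k \<Longrightarrow> (\<Prod>j=1..l. a k j) \<noteq> 0" "1 \<le> l \<Longrightarrow> (\<Prod>i=1..k. a i l) \<noteq> 0"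
  using assms by (auto simp: rect_prod_def)

lemma pade_nth_0 [simp]: "pade a k l $ 0 = 1"
  by (induction a k l rule: pade.induct) auto

lemma pade_degree: "l < e \<Longrightarrow> pade a k l $ e = 0"
proof (induction l arbitrary: k e)
  case (Suc l)
  then show ?case by (cases e) auto
qed simp

lemma pade_lead: "pade a k l $ l = (- 1) ^ l * (\<Prod>j=1..l. a k j)"
  by (induction l) (auto simp: pade_degree)

text \<open>Subtract the multiple of the denominator with the same constant term and divide by
  \<open>fps_X\<close>: the quotient has lower degree, and its product with \<open>h\<close>
  vanishes on a window that now reaches down to \<open>k - 1\<close>. By induction it is a multiple
  of the previous denominator, whose product with \<open>h\<close> does not vanish at
  \<open>k - 1\<close>, so it is 0.\<close>

lemma pade_unique:
  fixes h E :: "'a::field fps"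
  assumes van: "\<And>l e. k + l \<le> n \<Longrightarrow> e \<in> {k..<k + l} \<Longrightarrow> (pade a k l * h) $ e = 0"
    and nz: "\<And>l. k + l \<le> n \<Longrightarrow> (pade a k l * h) $ (k - 1) \<noteq> 0"
    and k: "1 \<le> k" "k + l \<le> n"
    and E: "\<And>e. l < e \<Longrightarrow> E $ e = 0" "\<And>e. e \<in> {k..<k + l} \<Longrightarrow> (E * h) $ e = 0"
  shows "E = fps_const (E $ 0) * pade a k l"
  using k(2) E
proof (induction l arbitrary: E)
  case 0
  then show ?case by (auto simp: fps_eq_iff)
next
  case (Suc l)
  define D where "D = E - fps_const (E $ 0) * pade a k (Suc l)"
  define D' where "D' = fps_shift 1 D"
  have "D $ 0 = 0" by (simp add: D_def del: pade.simps)
  then have D: "D = fps_X * D'" by (simp add: D'_def fps_eq_iff)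
  have "D' $ e = 0" if "l < e" for e
    using Suc.prems(2)[of "Suc e"] pade_degree[of "Suc l" "Suc e" a k] that
    by (simp add: D'_def D_def del: pade.simps)
  moreover have D'h: "(D' * h) $ e = 0" if "e \<in> {k - 1..<k + l}" for e
  proof -
    have "(D' * h) $ e = (D * h) $ Suc e" by (simp add: D mult.assoc)
    also have "\<dots> = (E * h) $ Suc e - E $ 0 * (pade a k (Suc l) * h) $ Suc e"
      by (simp add: D_def left_diff_distrib mult.assoc del: pade.simps)
    also have "\<dots> = 0"
    proof -
      have "Suc e \<in> {k..<k + Suc l}" using that k(1) by auto
      then show ?thesis using Suc.prems(3)[of "Suc e"] van[of "Suc l" "Suc e"] Suc.prems(1)
        by (simp del: pade.simps)
    qed
    finally show ?thesis .
  qed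
  ultimately have D': "D' = fps_const (D' $ 0) * pade a k l"
    using Suc.prems(1) by (intro Suc.IH) auto
  have "(D' * h) $ (k - 1) = D' $ 0 * (pade a k l * h) $ (k - 1)"
    by (subst D') (simp add: mult.assoc)
  then have "D' $ 0 = 0" using D'h[of "k - 1"] nz[of l] k(1) Suc.prems(1) by simp
  then have "D = 0" using D' D by simp
  then show ?case by (simp add: D_def del: pade.simps)
qed

context
  fixes a :: "nat \<Rightarrow> nat \<Rightarrow> 'a::field" and h :: "'a fps" and n :: nat
  assumes nz: "\<And>k l. 1 \<le> k \<Longrightarrow> 1 \<le> l \<Longrightarrow> k + l \<le> n \<Longrightarrow> a k l \<noteq> 0"
begin

text \<open>Uniqueness of the denominators yields a second recursion, expressing
  \<open>pade a (k + 1) (l + 1) - pade a (k + 1) l\<close> by \<open>pade a k l\<close>. Comparing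
  its top coefficient and the coefficient just below the vanishing window gives a relation between
  row and column products, which is the T-system up to a common factor.\<close>

lemma pade_vanishing_imp_T_system:
  assumes h0: "h $ 0 = 1"
    and van: "\<And>k l e. 1 \<le> k \<Longrightarrow> k + l \<le> n \<Longrightarrow> e \<in> {k..<k + l} \<Longrightarrow> (pade a k l * h) $ e = 0"
  shows "T_system n (rect_prod a)"
proof -
  \<comment> \<open>\<open>X k l\<close> and \<open>q k l\<close> are the quotients
    \<open>S k l / S (k - 1) l\<close> and \<open>S k (l + 1) / S k l\<close> of rectangular
    products.\<close>
  define X where "X k l = (\<Prod>j=1..l. a k j)" for k l
  define q where "q k l = (\<Prod>i=1..k. a i (Suc l))" for k l
  \<comment> \<open>This is the coefficient just below the vanishing window. Raising
    \<open>k\<close> multiplies it by an entry of column \<open>l + 1\<close>, since the left-hand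
    side of the recursion vanishes in that degree after multiplication by \<open>h\<close>.\<close>
  have p: "(pade a (Suc k) l * h) $ k = q k l" if "Suc k + l \<le> n" for k l
    using that
  proof (induction k)
    case 0
    then show ?case by (simp add: h0 q_def)
  next
    case (Suc k)
    have "(pade a (Suc k) (Suc l) * h) $ Suc k = 0" using Suc.prems by (intro van) auto
    then have "(pade a (Suc (Suc k)) l * h) $ Suc k = a (Suc k) (Suc l) * (pade a (Suc k) l * h) $ k"
      by (simp add: left_diff_distrib mult.assoc)
    then show ?case using Suc by (simp add: q_def)
  qed
  have q_nz: "q k l \<noteq> 0" if "Suc k + l \<le> n" for k l
    using rect_prod_nonzero(3)[of n a k "Suc l"] nz that by (simp add: q_def)
  have rel: "q k (Suc l) * X k l = q k l * X k l - X (Suc k) (Suc l) * q (k - 1) l"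
    if k: "1 \<le> k" "Suc k + Suc l \<le> n" for k l
  proof -
    \<comment> \<open>The difference has constant term 0, and after division by \<open>fps_X\<close>
      it satisfies the conditions that characterize \<open>pade a k l\<close> up to a
      scalar.\<close>
    define D where "D = pade a (Suc k) (Suc l) - pade a (Suc k) l"
    define E where "E = fps_shift 1 D"
    have "D $ 0 = 0" by (simp add: D_def del: pade.simps)
    then have D: "D = fps_X * E" by (simp add: E_def fps_eq_iff)
    have "E $ e = 0" if "l < e" for e
      using pade_degree[of "Suc l" "Suc e" a "Suc k"] pade_degree[of l "Suc e" a "Suc k"] that
      by (simp add: E_def D_def del: pade.simps)
    moreover have "(E * h) $ e = 0" if "e \<in> {k..<k + l}" for e
    proof -
      have "(E * h) $ e = (D * h) $ Suc e" by (simp add: D mult.assoc)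
      also have "\<dots> = 0"
        using van[of "Suc k" "Suc l" "Suc e"] van[of "Suc k" l "Suc e"] that k
        by (simp add: D_def left_diff_distrib del: pade.simps)
      finally show ?thesis .
    qed
    moreover have "(pade a k m * h) $ (k - 1) \<noteq> 0" if "k + m \<le> n" for m
      using p[of "k - 1" m] q_nz[of "k - 1" m] k that by simp
    ultimately have E: "E = fps_const (E $ 0) * pade a k l"
      using pade_unique[of k n a h l E] van k by simp
    have "E $ l = (- 1) ^ Suc l * X (Suc k) (Suc l)"
      using pade_lead[of a "Suc k" "Suc l"] pade_degree[of l "Suc l" a "Suc k"]
      by (simp add: E_def D_def X_def del: pade.simps)
    moreover have "E $ l = E $ 0 * ((- 1) ^ l * X k l)"
      by (subst E) (simp add: pade_lead X_def)
    ultimately have "(- 1) ^ l * (E $ 0 * X k l) = (- 1) ^ l * (- X (Suc k) (Suc l))"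
      by (simp add: mult.left_commute)
    then have E0: "E $ 0 * X k l = - X (Suc k) (Suc l)" by (subst (asm) mult_cancel_left) simp
    have "(E * h) $ (k - 1) = E $ 0 * (pade a k l * h) $ (k - 1)" by (subst E) (simp add: mult.assoc)
    moreover have "(D * h) $ k = (E * h) $ (k - 1)" using k by (simp add: D mult.assoc)
    moreover have "(D * h) $ k = q k (Suc l) - q k l"
      using p[of k l] p[of k "Suc l"] k by (simp add: D_def left_diff_distrib del: pade.simps)
    ultimately have "q k (Suc l) - q k l = E $ 0 * q (k - 1) l"
      using p[of "k - 1" l] k by simp
    then have "(q k (Suc l) - q k l) * X k l = - X (Suc k) (Suc l) * q (k - 1) l"
      using E0 by (metis mult.assoc mult.commute)
    then show ?thesis by (simp add: algebra_simps)
  qed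
  show ?thesis
    unfolding T_system_def
  proof (intro allI impI)
    fix k l assume kl: "1 \<le> k \<and> 1 \<le> l \<and> k + l < n"
    then obtain k' l' where k': "k = Suc k'" "l = Suc l'" by (metis Suc_le_D One_nat_def)
    let ?S = "rect_prod a"
    have 1: "?S (Suc k) l = ?S k l * X (Suc k) (Suc l')" by (simp add: rect_prod_Suc X_def k')
    have 2: "?S k (Suc l) = ?S k l * q k l" by (simp add: rect_prod_Suc q_def)
    have 3: "?S k l = ?S k l' * q k l'" by (simp add: k' rect_prod_Suc(2) q_def)
    have 4: "?S (k - 1) l = ?S (k - 1) l' * q (k - 1) l'" by (simp add: k' rect_prod_Suc(2) q_def)
    have 5: "?S k l' = ?S (k - 1) l' * X k l'" by (simp add: k' rect_prod_Suc(1) X_def)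
    have r: "q k l * X k l' = q k l' * X k l' - X (Suc k) (Suc l') * q (k - 1) l'"
      using rel[of k l'] kl k' by simp
    have "?S (Suc k) l * ?S (k - 1) l + ?S k (Suc l) * ?S k (l - 1) =
        ?S k l * ?S (k - 1) l' * (X (Suc k) (Suc l') * q (k - 1) l' + q k l * X k l')"
      unfolding 1 2 4 using 5 k' by (simp add: algebra_simps)
    also have "\<dots> = ?S k l * (?S (k - 1) l' * X k l' * q k l')"
      unfolding r by (simp add: algebra_simps)
    also have "\<dots> = ?S k l * ?S k l" by (simp only: 3 5[symmetric])
    finally show "?S k l ^ 2 = ?S (Suc k) l * ?S (k - 1) l + ?S k (Suc l) * ?S k (l - 1)"
      by (simp add: power2_eq_square)
  qed
qed

text \<open>Uniqueness cannot be invoked before the vanishing is known, so the second recursion of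
  \<open>pade\<close> is derived from the T-system alone. With it the vanishing and the coefficient
  just below the window are proved together by induction on \<open>l\<close>.\<close>

lemma T_system_imp_pade_vanishing:
  assumes T: "T_system n (rect_prod a)" and h: "\<And>k. k < n \<Longrightarrow> h $ k = rect_prod a k 1"
    and kl: "1 \<le> k" "k + l \<le> n" and e: "e \<in> {k..<k + l}"
  shows "(pade a k l * h) $ e = 0"
proof -
  let ?S = "rect_prod a"
  define X where "X k l = (\<Prod>j=1..l. a k j)" for k l
  define q where "q k l = (\<Prod>i=1..k. a i (Suc l))" for k l
  define b where "b k l = X (Suc k) (Suc l) / X k l" for k l
  have X_nz: "X k l \<noteq> 0" if "1 \<le> k" "k + l \<le> n" for k l
    using rect_prod_nonzero(2)[of n a k l] nz that by (simp add: X_def)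
  have S_nz: "?S k l \<noteq> 0" if "k + l \<le> n" for k l
    using rect_prod_nonzero(1)[of n a k l] nz that by simp
  have SX: "?S (Suc k) l = ?S k l * X (Suc k) l" for k l by (simp add: rect_prod_Suc X_def)
  have Sq: "?S k (Suc l) = ?S k l * q k l" for k l by (simp add: rect_prod_Suc q_def)
  have XS: "X (Suc k) (Suc l) = X (Suc k) l * a (Suc k) (Suc l)" for k l by (simp add: X_def)
  have qS: "q (Suc k) l = q k l * a (Suc k) (Suc l)" for k l by (simp add: q_def)
  have Xk: "X (Suc k) l = ?S (Suc k) l / ?S k l" if "k + l \<le> n" for k l
    using SX[of k l] S_nz[OF that] by simp
  have Ts: "?S (Suc k) (Suc l) ^ 2 = ?S (Suc (Suc k)) (Suc l) * ?S k (Suc l) + ?S (Suc k) (Suc (Suc l)) * ?S (Suc k) l"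
    if "Suc k + Suc l < n" for k l
    using T that unfolding T_system_def by force
  have aS: "a (Suc k) (Suc l) = ?S (Suc k) (Suc l) * ?S k l / (?S k (Suc l) * ?S (Suc k) l)"
    if "Suc k + Suc l \<le> n" for k l
    using S_nz[of k l] S_nz[of k "Suc l"] S_nz[of "Suc k" l] that
    by (simp add: field_simps SX Sq XS qS)
  have bS: "b (Suc k) l = ?S (Suc (Suc k)) (Suc l) * ?S k l / (?S (Suc k) (Suc l) * ?S (Suc k) l)"
    if "Suc k + Suc l \<le> n" for k l
    using S_nz[of k l] that
    by (simp add: b_def Xk)
  have ab: "b (Suc (Suc k)) l + a (Suc (Suc k)) (Suc (Suc l)) = a (Suc (Suc k)) (Suc l) + b (Suc k) (Suc l)"
    if "Suc (Suc k) + Suc (Suc l) \<le> n" for k l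
  proof -
    \<comment> \<open>\<open>sij\<close> stands for \<open>?S (k + 1 + i) (l + j)\<close> and
      \<open>sm1\<close> for \<open>?S k (l + 1)\<close>; the two equations are neighbouring
      instances of the T-system.\<close>
    have field: "s21 * s00 / (s11 * s10) + s12 * s01 / (s02 * s11) = s11 * s00 / (s01 * s10) + s12 * sm1 / (s02 * s01)"
      if T1: "s11 ^ 2 = s21 * s01 + s12 * s10" and T2: "s01 ^ 2 = s11 * sm1 + s02 * s00"
        and nz: "s11 \<noteq> 0" "s10 \<noteq> 0" "s02 \<noteq> 0" "s01 \<noteq> 0"
      for s00 s11 s10 s12 s01 s02 s21 sm1 :: 'a
    proof -
      have "s21 * s00 * s02 * s01 + s12 * s01 ^ 2 * s10 = s11 ^ 2 * s00 * s02 + s12 * sm1 * s11 * s10"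
        unfolding T1 T2 by (simp add: algebra_simps)
      then show ?thesis using nz by (simp add: divide_simps) (simp add: algebra_simps power2_eq_square)
    qed
    show ?thesis
      using field[OF Ts[of "Suc k" l] Ts[of k l]] S_nz that
      by (simp add: aS bS)
  qed
  have second: "pade a (Suc k) (Suc l) = pade a (Suc k) l - fps_X * (fps_const (b k l) * pade a k l)"
    if "1 \<le> k" "Suc k + Suc l \<le> n" for k l
    using that
  proof (induction l arbitrary: k)
    case 0
    then show ?case by (simp add: b_def X_def)
  next
    case (Suc l)
    then obtain k' where k: "k = Suc k'" by (cases k) auto
    \<comment> \<open>Both recursions have to be compatible. \<open>A\<close> and \<open>B\<close>
      equate the factors in front of \<open>pade a (k + 1) l\<close> and \<open>pade a k l\<close>
      after everything is expanded down to the index \<open>l\<close>.\<close>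
    have A: "b (Suc k) l + a (Suc k) (Suc (Suc l)) = a (Suc k) (Suc l) + b k (Suc l)"
      using ab[of k' l] Suc.prems k by simp
    have "b k (Suc l) * a k (Suc l) = a (Suc k) (Suc (Suc l)) * b k l"
      using X_nz[of k l] nz[of k "Suc l"] Suc.prems k by (simp add: b_def XS field_simps)
    then have B: "a (Suc k) (Suc (Suc l)) * b k l = b k (Suc l) * a k (Suc l)" by simp
    have "pade a (Suc k) (Suc (Suc l)) = pade a (Suc (Suc k)) l - fps_X * (fps_const (b (Suc k) l) * pade a (Suc k) l)
        - fps_X * (fps_const (a (Suc k) (Suc (Suc l))) * (pade a (Suc k) l - fps_X * (fps_const (b k l) * pade a k l)))"
      using Suc.IH[of "Suc k"] Suc.IH[of k] Suc.prems by (simp only: pade.simps(2)[of a "Suc k" "Suc l"])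
    also have "\<dots> = pade a (Suc (Suc k)) l
        - fps_X * (fps_const (b (Suc k) l + a (Suc k) (Suc (Suc l))) * pade a (Suc k) l)
        + fps_X * fps_X * (fps_const (a (Suc k) (Suc (Suc l)) * b k l) * pade a k l)"
      by (simp add: algebra_simps flip: fps_const_add fps_const_mult)
    also have "\<dots> = pade a (Suc k) (Suc l) - fps_X * (fps_const (b k (Suc l)) * pade a k (Suc l))"
      unfolding A B by (simp add: algebra_simps flip: fps_const_add fps_const_mult)
    finally show ?case .
  qed
  \<comment> \<open>In degree \<open>k\<close> the two terms of the defining recursion cancel,
    because the coefficients just below the windows differ by the factor \<open>a k (l + 1)\<close>.
    For \<open>k > 1\<close> the second recursion gives the new coefficient in degree
    \<open>k - 1\<close>.\<close>
  have main: "(\<forall>e\<in>{k..<k + l}. (pade a k l * h) $ e = 0) \<and> (pade a k l * h) $ (k - 1) = q (k - 1) l"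
    if "1 \<le> k" "k + l \<le> n" for k l
    using that
  proof (induction l arbitrary: k)
    case 0
    then show ?case by (simp add: h q_def rect_prod_def)
  next
    case (Suc l)
    have van1: "(pade a (Suc k) l * h) $ e = 0" if "e \<in> {Suc k..<Suc k + l}" for e
      using Suc.IH[of "Suc k"] Suc.prems that by auto
    have p1: "(pade a (Suc k) l * h) $ k = q k l"
      using Suc.IH[of "Suc k"] Suc.prems by auto
    have van0: "(pade a k l * h) $ e = 0" if "e \<in> {k..<k + l}" for e
      using Suc.IH[of k] Suc.prems that by auto
    have p0: "(pade a k l * h) $ (k - 1) = q (k - 1) l"
      using Suc.IH[of k] Suc.prems by auto
    obtain k' where k: "k = Suc k'" using Suc.prems by (cases k) auto
    have "(pade a k (Suc l) * h) $ e = 0" if "e \<in> {k..<k + Suc l}" for e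
    proof -
      have eq: "(pade a k (Suc l) * h) $ e = (pade a (Suc k) l * h) $ e - a k (Suc l) * (pade a k l * h) $ (e - 1)"
        using that k by (simp add: left_diff_distrib mult.assoc)
      show ?thesis
      proof (cases "e = k")
        case True
        then show ?thesis using eq p1 p0 k qS[of k' l] by simp
      next
        case False
        then have "e \<in> {Suc k..<Suc k + l}" "e - 1 \<in> {k..<k + l}" using that by auto
        then show ?thesis using eq van1[of e] van0[of "e - 1"] by simp
      qed
    qed
    moreover have "(pade a k (Suc l) * h) $ (k - 1) = q (k - 1) (Suc l)"
    proof (cases k')
      case 0
      then have "n > 0" using Suc.prems by simp
      then show ?thesis using 0 k by (simp add: h q_def del: pade.simps)
    next
      case (Suc m)
      have r: "1 \<le> k'" "Suc k' + Suc l \<le> n" "Suc m + Suc l < n" using Suc.prems k Suc by auto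
      have "(pade a k (Suc l) * h) $ k' = (pade a k l * h) $ k' - b k' l * (pade a k' l * h) $ (k' - 1)"
        using Suc r unfolding k second[OF r(1,2)] by (simp add: left_diff_distrib mult.assoc del: pade.simps)
      also have "\<dots> = q k' l - b k' l * q m l"
        using Suc.IH[of k'] r p0 k Suc by simp
      also have "\<dots> = q k' (Suc l)"
      proof -
        have qq: "q k l = ?S k (Suc l) / ?S k l" if "k + l \<le> n" for k l
          using Sq[of k l] S_nz[OF that] by simp
        show ?thesis
          using Ts[OF r(3)] S_nz[of m l] S_nz[of m "Suc l"] S_nz[of k' l] S_nz[of k' "Suc l"] r Suc
          by (simp add: qq bS field_simps power2_eq_square)
      qed
      finally show ?thesis by (simp add: k)
    qed
    ultimately show ?case by blast
  qed
  then show ?thesis using kl e by blast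
qed

end

section \<open>The standard reduced word\<close>

text \<open>
  The word consists of the blocks \<open>n - 1, \<dots>, l\<close> for \<open>l = 1, \<dots>, n - 1\<close>; \<open>std_index n m\<close> lists the
  pairs (letter, block) of the blocks after the first \<open>m\<close>.
\<close>

definition std_index :: "nat \<Rightarrow> nat \<Rightarrow> (nat \<times> nat) list" where
  "std_index n m = concat (map (\<lambda>l. map (\<lambda>r. (r, l)) (rev [l..<n])) [Suc m..<n])"

definition std_word :: "nat \<Rightarrow> nat list" where
  "std_word n = map fst (std_index n 0)"

text \<open>\<open>a k l\<close> sits at the letter \<open>k + l - 1\<close> of block
  \<open>l\<close>; by \<open>roots_std_word\<close> its root has the indices \<open>k\<close> and
  \<open>n + 1 - l\<close>.\<close>

definition std_params :: "nat \<Rightarrow> (nat \<Rightarrow> nat \<Rightarrow> 'a) \<Rightarrow> 'a list" where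
  "std_params n a = map (\<lambda>(r, l). a (Suc r - l) l) (std_index n 0)"

lemma set_std_index: "set (std_index n m) = {(r, l). m < l \<and> l \<le> r \<and> r < n}"
proof -
  have "set (std_index n m) = (\<Union>l\<in>{Suc m..<n}. (\<lambda>r. (r, l)) ` {l..<n})"
    by (simp add: std_index_def)
  then show ?thesis by (auto simp: image_iff)
qed

lemma std_index_step:
  "m < n \<Longrightarrow> std_index n m = (if Suc m < n then map (\<lambda>r. (r, Suc m)) (rev [Suc m..<n]) @ std_index n (Suc m) else [])"
  by (auto simp: std_index_def upt_conv_Cons)

lemma roots_block: "roots p (rev [l..<u]) = map (\<lambda>r. (p r, p u)) (rev [l..<u])"
proof (induction u arbitrary: p)
  case (Suc u)
  then show ?case by (auto simp: simple_refl_apply)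
qed simp

lemma word_perm_block_fix: "u < x \<Longrightarrow> word_perm (rev [l..<u]) x = x"
  by (induction u) (simp_all add: simple_refl_apply)

lemma word_perm_block: "l < x \<Longrightarrow> x \<le> u \<Longrightarrow> word_perm (rev [l..<u]) x = x - 1"
proof (induction u)
  case (Suc u)
  show ?case
  proof (cases "x = Suc u")
    case True
    then show ?thesis using Suc.prems by (simp add: word_perm_block_fix simple_refl_apply)
  next
    case False
    then have "x - 1 < u" "word_perm (rev [l..<u]) x = x - 1" using Suc by auto
    then show ?thesis using Suc.prems by (simp add: simple_refl_apply)
  qed
qed simp

text \<open>The roots of the next block see the permutation of the first \<open>m\<close> blocks
  only at indices above \<open>m\<close>, where it is the shift by \<open>m\<close>; so both claims
  go through one induction.\<close>

lemma roots_blocks: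
  assumes "m < n"
  shows "roots id (concat (map (\<lambda>l. rev [l..<n]) [1..<Suc m])) =
      concat (map (\<lambda>l. map (\<lambda>r. (Suc r - l, Suc n - l)) (rev [l..<n])) [1..<Suc m])"
    and "\<And>x. m < x \<Longrightarrow> x \<le> n \<Longrightarrow> word_perm (concat (map (\<lambda>l. rev [l..<n]) [1..<Suc m])) x = x - m"
proof -
  let ?w = "\<lambda>m. concat (map (\<lambda>l. rev [l..<n]) [1..<Suc m])"
  let ?r = "\<lambda>m. concat (map (\<lambda>l. map (\<lambda>r. (Suc r - l, Suc n - l)) (rev [l..<n])) [1..<Suc m])"
  have "roots id (?w m) = ?r m \<and> (\<forall>x. m < x \<and> x \<le> n \<longrightarrow> word_perm (?w m) x = x - m)"
    using assms
  proof (induction m)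
    case (Suc m)
    have w: "?w (Suc m) = ?w m @ rev [Suc m..<n]" and r: "?r (Suc m) = ?r m @ map (\<lambda>r. (r - m, n - m)) (rev [Suc m..<n])"
      by simp_all
    have IH: "roots id (?w m) = ?r m" "\<And>x. m < x \<Longrightarrow> x \<le> n \<Longrightarrow> word_perm (?w m) x = x - m"
      using Suc by (simp_all add: id_def del: upt_Suc)
    have n: "word_perm (?w m) n = n - m" using Suc.prems by (intro IH(2)) simp_all
    have "roots (word_perm (?w m)) (rev [Suc m..<n]) = map (\<lambda>r. (r - m, n - m)) (rev [Suc m..<n])"
      unfolding roots_block
    proof (rule map_cong[OF refl])
      fix r assume "r \<in> set (rev [Suc m..<n])"
      then have "m < r" "r \<le> n" by (simp_all del: upt_Suc)
      show "(word_perm (?w m) r, word_perm (?w m) n) = (r - m, n - m)"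
        unfolding n IH(2)[OF \<open>m < r\<close> \<open>r \<le> n\<close>] ..
    qed
    then have "roots id (?w (Suc m)) = ?r (Suc m)"
      unfolding w r roots_append IH(1) id_comp by simp
    moreover have "word_perm (?w (Suc m)) x = x - Suc m" if "Suc m < x" "x \<le> n" for x
    proof -
      have "word_perm (?w m) (x - 1) = x - 1 - m" using that by (intro IH(2)) simp_all
      then show ?thesis unfolding w word_perm_append o_apply word_perm_block[OF that] by simp
    qed
    ultimately show ?case by blast
  qed simp
  then show "roots id (?w m) = ?r m" "\<And>x. m < x \<Longrightarrow> x \<le> n \<Longrightarrow> word_perm (?w m) x = x - m" by auto
qed

lemma std_word_concat: "std_word n = concat (map (\<lambda>l. rev [l..<n]) [1..<n])"
  by (simp add: std_word_def std_index_def map_concat comp_def)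

lemma roots_std_word:
  assumes "1 \<le> n"
  shows "roots id (std_word n) = map (\<lambda>(r, l). (Suc r - l, Suc n - l)) (std_index n 0)"
proof -
  have "roots id (std_word n) = concat (map (\<lambda>l. map (\<lambda>r. (Suc r - l, Suc n - l)) (rev [l..<n])) [1..<n])"
    using roots_blocks(1)[of "n - 1" n] assms by (simp add: std_word_concat)
  then show ?thesis by (simp add: std_index_def map_concat comp_def)
qed

lemma ascending_word_roots:
  "ascending_word w \<longleftrightarrow> (\<forall>(x, y)\<in>set (roots id w). x < y)"
  by (induction w rule: rev_induct) (auto simp: ascending_word_snoc roots_append)

lemma std_word_reduced:
  assumes "1 \<le> n"
  shows "set (std_word n) \<subseteq> {1..<n}" "ascending_word (std_word n)" "inversions (word_perm (std_word n)) = pairs n"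
    "distinct (std_index n 0)"
proof -
  show set: "set (std_word n) \<subseteq> {1..<n}" by (auto simp: std_word_def set_std_index)
  show *: "ascending_word (std_word n)"
    unfolding ascending_word_roots roots_std_word[OF assms] by (auto simp: set_std_index)
  have "pairs n \<subseteq> (\<lambda>(r, l). (Suc r - l, Suc n - l)) ` set (std_index n 0)"
  proof
    fix z assume "z \<in> pairs n"
    then obtain x y where z: "z = (x, y)" "1 \<le> x" "x < y" "y \<le> n" by auto
    then have "z = (\<lambda>(r, l). (Suc r - l, Suc n - l)) (x + n - y, Suc n - y)" by auto
    moreover have "(x + n - y, Suc n - y) \<in> set (std_index n 0)" using z by (auto simp: set_std_index)
    ultimately show "z \<in> (\<lambda>(r, l). (Suc r - l, Suc n - l)) ` set (std_index n 0)" by blast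
  qed
  then have "pairs n \<subseteq> inversions (word_perm (std_word n))"
    using roots_ascending(2)[OF *] unfolding roots_std_word[OF assms] set_map by simp
  then show "inversions (word_perm (std_word n)) = pairs n"
    using inversions_subset[OF word_perm_permutes[OF set]] by (rule equalityI[rotated])
  show "distinct (std_index n 0)"
    using roots_ascending(1)[OF *] unfolding roots_std_word[OF assms] by (rule distinct_map[THEN iffD1, THEN conjunct1])
qed

lemma std_params_surj:
  assumes "1 \<le> n" "length as = length (std_word n)"
  obtains a where "as = std_params n a"
proof -
  define g where "g x = the (map_of (zip (std_index n 0) as) x)" for x
  have len: "length as = length (std_index n 0)" using assms(2) by (simp add: std_word_def)
  have "g (std_index n 0 ! i) = as ! i" if "i < length as" for i
    using map_of_zip_nth[of "std_index n 0" as i] std_word_reduced(4)[OF assms(1)] len that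
    by (simp add: g_def)
  then have "as = map g (std_index n 0)" using len by (intro nth_equalityI) auto
  also have "\<dots> = std_params n (\<lambda>k l. g (k + l - 1, l))"
    unfolding std_params_def by (rule map_cong) (auto simp: set_std_index)
  finally show thesis by (rule that)
qed

lemma set_std_params: "set (std_params n a) = {a k l | k l. 1 \<le> k \<and> 1 \<le> l \<and> k + l \<le> n}"
proof -
  have "a k l \<in> set (std_params n a)" if "1 \<le> k" "1 \<le> l" "k + l \<le> n" for k l
  proof -
    have "(k + l - 1, l) \<in> set (std_index n 0)" using that by (auto simp: set_std_index)
    moreover have "a k l = (\<lambda>(r, l). a (Suc r - l) l) (k + l - 1, l)" using that by simp
    ultimately show ?thesis unfolding std_params_def set_map by blast
  qed
  then show ?thesis by (fastforce simp: std_params_def set_std_index)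
qed

lemma fits_std_word:
  assumes "1 \<le> n"
  shows "fits \<mu> (std_word n) (std_params n a) \<longleftrightarrow>
    (\<forall>k l. 1 \<le> k \<and> 1 \<le> l \<and> k + l \<le> n \<longrightarrow> Val (a k l) = - \<mu> k (Suc n - l))"
proof -
  have "fits \<mu> (std_word n) (std_params n a) \<longleftrightarrow>
      (\<forall>(r, l)\<in>set (std_index n 0). Val (a (Suc r - l) l) = - \<mu> (Suc r - l) (Suc n - l))"
    by (simp add: fits_def std_params_def roots_std_word[OF assms] list_all2_map1 list_all2_map2
      list_all2_same case_prod_beta)
  also have "\<dots> \<longleftrightarrow> (\<forall>k l. 1 \<le> k \<and> 1 \<le> l \<and> k + l \<le> n \<longrightarrow> Val (a k l) = - \<mu> k (Suc n - l))"
  proof (intro iffI allI impI)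
    fix k l assume H: "\<forall>(r, l)\<in>set (std_index n 0). Val (a (Suc r - l) l) = - \<mu> (Suc r - l) (Suc n - l)"
      and kl: "1 \<le> k \<and> 1 \<le> l \<and> k + l \<le> n"
    then have "(k + l - 1, l) \<in> set (std_index n 0)" by (auto simp: set_std_index)
    from bspec[OF H this] show "Val (a k l) = - \<mu> k (Suc n - l)" using kl by simp
  qed (auto simp: set_std_index)
  finally show ?thesis .
qed

section \<open>Factorizations of Toeplitz matrices\<close>

text \<open>The entry in row \<open>r\<close> and column \<open>c\<close> collects descending paths
  from \<open>r\<close> to \<open>c\<close> whose step from \<open>r\<close> to \<open>r - 1\<close>
  uses the letter \<open>r\<close>. \<open>Q\<close> contains the rows that can be reached; no step
  inside it ends in \<open>c\<close>, so only the empty path counts.\<close>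

lemma yprod_entry:
  assumes "length w = length as" "set w \<subseteq> {1..<n}" "c < n"
    and Q: "\<And>r. r \<in> Q \<Longrightarrow> r \<in> set w \<Longrightarrow> r - 1 \<in> Q \<and> r - 1 \<noteq> c"
    and "r < n" "r \<in> Q"
  shows "yprod n w as $$ (r, c) = (if r = c then 1 else 0)"
  using assms(1,2) Q assms(5,6)
proof (induction w as arbitrary: r rule: list_induct2)
  case Nil
  then show ?case using assms(3) by (simp add: yprod_Nil)
next
  case (Cons i w a as)
  then have i: "1 \<le> i" "i < n" "i - 1 < n" by auto
  have IH: "yprod n w as $$ (r, c) = (if r = c then 1 else 0)" if "r < n" "r \<in> Q" for r
    by (rule Cons.IH) (use Cons.prems that in simp_all)
  have "yprod n (i # w) (a # as) $$ (r, c) =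
      yprod n w as $$ (r, c) + (if r = i then a * yprod n w as $$ (i - 1, c) else 0)"
    unfolding yprod_Cons by (rule y_mat_mult_left[OF i(1,2) yprod_carrier Cons.prems(3) assms(3)])
  then show ?case
    using IH[of r] IH[of "i - 1"] Cons.prems(2)[of i] Cons.prems(3,4) i by (cases "r = i") simp_all
qed

text \<open>The letters descend, so the factor of the letter \<open>r - 1\<close> acts before that
  of \<open>r\<close>. Row \<open>r - 1\<close> is therefore taken from the product itself and not
  from \<open>A\<close>.\<close>

lemma block_mult:
  assumes "1 \<le> l" "A \<in> carrier_mat n n" "c < n" "r < n" "u \<le> n"
  shows "(yprod n (rev [l..<u]) (map z (rev [l..<u])) * A) $$ (r, c) =
    A $$ (r, c) + (if l \<le> r \<and> r < u then z r * (yprod n (rev [l..<u]) (map z (rev [l..<u])) * A) $$ (r - 1, c) else 0)"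
proof -
  define B where "B u = yprod n (rev [l..<u]) (map z (rev [l..<u])) * A" for u
  have B0: "B u = A" if "u \<le> l" for u
    using that assms(2) by (simp add: B_def yprod_Nil)
  have BS: "B (Suc u) $$ (r, c) = B u $$ (r, c) + (if r = u then z u * B u $$ (u - 1, c) else 0)"
    if "l \<le> u" "u < n" "r < n" for u r
  proof -
    have "B (Suc u) = y_mat n u (z u) * B u"
      unfolding B_def using that(1) assoc_mult_mat[OF y_mat_carrier yprod_carrier assms(2)]
      by (simp add: yprod_Cons)
    moreover have "B u \<in> carrier_mat n n"
      unfolding B_def by (rule mult_carrier_mat[OF yprod_carrier assms(2)])
    ultimately show ?thesis
      using y_mat_mult_left[of u n "B u" r c "z u"] assms(1,3) that by simp
  qed
  have "B u $$ (r, c) = A $$ (r, c) + (if l \<le> r \<and> r < u then z r * B u $$ (r - 1, c) else 0)"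
    if "r < n" "u \<le> n" for u r
    using that
  proof (induction u arbitrary: r)
    case 0
    then show ?case by (simp add: B0)
  next
    case (Suc u)
    have IH: "B u $$ (r, c) = A $$ (r, c) + (if l \<le> r \<and> r < u then z r * B u $$ (r - 1, c) else 0)"
      using Suc.IH[of r] Suc.prems by simp
    show ?case
    proof (cases "l \<le> u")
      case True
      consider "r < u" | "r = u" | "u < r" by linarith
      then show ?thesis
      proof cases
        case 1
        then have "B (Suc u) $$ (r, c) = B u $$ (r, c)" "B (Suc u) $$ (r - 1, c) = B u $$ (r - 1, c)"
          using BS[OF True, of r] BS[OF True, of "r - 1"] Suc.prems by simp_all
        then show ?thesis using IH 1 by simp
      next
        case 2
        then have "r - 1 \<noteq> u" using True assms(1) by simp
        then have "B (Suc u) $$ (r - 1, c) = B u $$ (r - 1, c)"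
          using BS[OF True, of "r - 1"] Suc.prems by simp
        then show ?thesis using BS[OF True, of r] IH 2 True Suc.prems by simp
      next
        case 3
        then show ?thesis using BS[OF True, of r] IH Suc.prems by simp
      qed
    next
      case False
      then show ?thesis by (auto simp: B0)
    qed
  qed
  then show ?thesis using assms(4,5) unfolding B_def by blast
qed

context
  fixes a :: "nat \<Rightarrow> nat \<Rightarrow> 'a::field" and n :: nat
begin

definition tail_prod :: "nat \<Rightarrow> 'a mat" where
  "tail_prod m = yprod n (map fst (std_index n m)) (map (\<lambda>(r, l). a (Suc r - l) l) (std_index n m))"

lemma tail_prod_0: "tail_prod 0 = yprod n (std_word n) (std_params n a)"
  by (simp add: tail_prod_def std_word_def std_params_def)

lemma tail_prod_entries:
  assumes "r < n" "c < n" "r \<le> c \<or> r \<le> m \<or> c < m"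
  shows "tail_prod m $$ (r, c) = (if r = c then 1 else 0)"
proof -
  \<comment> \<open>The remaining letters exceed \<open>m\<close>. A step from a row up to
    \<open>c\<close> ends in a row before \<open>c\<close>, rows up to \<open>m\<close> admit no
    step, and every step ends in row \<open>m\<close> or later, hence never in
    \<open>c < m\<close>.\<close>
  define Q where "Q = (if r \<le> c then {..c} else if r \<le> m then {..m} else UNIV)"
  show ?thesis
    unfolding tail_prod_def
    by (rule yprod_entry[where Q = Q]) (use assms in \<open>auto simp: Q_def set_std_index split: if_splits\<close>)
qed

lemma tail_prod_step:
  assumes "m < r" "r < n" "c < n"
  shows "tail_prod m $$ (r, c) = tail_prod (Suc m) $$ (r, c) + a (r - m) (Suc m) * tail_prod m $$ (r - 1, c)"
proof -
  have "tail_prod m = yprod n (rev [Suc m..<n]) (map (\<lambda>r. a (r - m) (Suc m)) (rev [Suc m..<n])) * tail_prod (Suc m)"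
    using assms unfolding tail_prod_def
    by (subst (1 2) std_index_step) (simp_all add: yprod_append comp_def)
  then show ?thesis
    using block_mult[of "Suc m" "tail_prod (Suc m)" n c r n "\<lambda>r. a (r - m) (Suc m)"] assms
    by (simp add: tail_prod_def)
qed

text \<open>Solved for the next tail, \<open>tail_prod_step\<close> is the recursion of
  \<open>pade\<close> with \<open>k = r - m\<close> and \<open>l = m\<close>; the factor
  \<open>fps_X\<close> accounts for the row \<open>r - 1\<close>.\<close>

lemma tail_prod_Toeplitz:
  fixes h :: "'a fps"
  assumes h: "\<And>r c. r < n \<Longrightarrow> c < n \<Longrightarrow> tail_prod 0 $$ (r, c) = (if c \<le> r then h $ (r - c) else 0)"
    and "m \<le> r" "r < n" "c < n"
  shows "tail_prod m $$ (r, c) = (if c \<le> r then (pade a (Suc r - m) m * h) $ (r - c) else 0)"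
  using assms(2-)
proof (induction m arbitrary: r)
  case 0
  then show ?case using h by simp
next
  case (Suc m)
  have "tail_prod (Suc m) $$ (r, c) = tail_prod m $$ (r, c) - a (r - m) (Suc m) * tail_prod m $$ (r - 1, c)"
    using tail_prod_step[of m r c] Suc.prems by simp
  moreover have "tail_prod m $$ (r, c) = (if c \<le> r then (pade a (Suc (r - m)) m * h) $ (r - c) else 0)"
    using Suc.IH[of r] Suc.prems by (simp add: Suc_diff_le)
  moreover have "tail_prod m $$ (r - 1, c) = (if c \<le> r - 1 then (pade a (r - m) m * h) $ (r - 1 - c) else 0)"
    using Suc.IH[of "r - 1"] Suc.prems by simp
  ultimately show ?case
    using Suc.prems by (auto simp: left_diff_distrib mult.assoc not_le diff_right_commute)
qed

text \<open>The step runs the other way: \<open>tail_prod (m + 1)\<close> is known and the rows of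
  \<open>tail_prod m\<close> are built in increasing order from row \<open>m\<close>. That row is a
  row of the identity, which matches the Pade side by the vanishing and the constant term 1.\<close>

lemma tail_prod_vanishing:
  fixes h :: "'a fps"
  assumes van: "\<And>k l e. 1 \<le> k \<Longrightarrow> k + l \<le> n \<Longrightarrow> e \<in> {k..<k + l} \<Longrightarrow> (pade a k l * h) $ e = 0"
    and h0: "h $ 0 = 1" and "m \<le> r" "r < n" "c < n"
  shows "tail_prod m $$ (r, c) = (if c \<le> r then (pade a (Suc r - m) m * h) $ (r - c) else 0)"
  using assms(3-)
proof (induction "n - m" arbitrary: m r)
  case 0
  then show ?case by simp
next
  case (Suc x)
  have diag: "tail_prod m $$ (m, c) = (if c \<le> m then (pade a 1 m * h) $ (m - c) else 0)"
  proof (cases "c = m")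
    case True
    then show ?thesis using Suc.prems tail_prod_entries[of m c m] h0 by simp
  next
    case False
    then have "(pade a 1 m * h) $ (m - c) = 0" if "c \<le> m"
      using that Suc.prems by (intro van) auto
    then show ?thesis using Suc.prems False tail_prod_entries[of m c m] by simp
  qed
  from Suc.prems(1,2) show ?case
  proof (induction r rule: dec_induct)
    case base
    then show ?case using diag by simp
  next
    case (step r)
    have 1: "tail_prod m $$ (Suc r, c) = tail_prod (Suc m) $$ (Suc r, c) + a (Suc r - m) (Suc m) * tail_prod m $$ (r, c)"
      using tail_prod_step[of m "Suc r" c] step Suc.prems by simp
    have 2: "tail_prod (Suc m) $$ (Suc r, c) = (if c \<le> Suc r then (pade a (Suc r - m) (Suc m) * h) $ (Suc r - c) else 0)"
      using Suc.hyps(1)[of "Suc m" "Suc r"] Suc.hyps(2) step Suc.prems by (simp del: pade.simps)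
    have 3: "tail_prod m $$ (r, c) = (if c \<le> r then (pade a (Suc r - m) m * h) $ (r - c) else 0)"
      using step by simp
    show ?case
      unfolding 1 2 3 using step by (auto simp: left_diff_distrib mult.assoc not_le Suc_diff_le)
  qed
qed

lemma toeplitz_iff_T_system:
  assumes n: "1 \<le> n" and nz: "\<And>k l. 1 \<le> k \<Longrightarrow> 1 \<le> l \<Longrightarrow> k + l \<le> n \<Longrightarrow> a k l \<noteq> 0"
  shows "toeplitz (yprod n (std_word n) (std_params n a)) \<longleftrightarrow> T_system n (rect_prod a)"
proof
  let ?M = "yprod n (std_word n) (std_params n a)"
  have dim: "dim_row ?M = n" "dim_col ?M = n"
    using carrier_matD[OF yprod_carrier[of n "std_word n" "std_params n a"]] by auto
  assume T: "toeplitz ?M"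
  define h where "h = Abs_fps (\<lambda>e. if e < n then ?M $$ (e, 0) else 0)"
  have M: "tail_prod 0 $$ (r, c) = (if c \<le> r then h $ (r - c) else 0)" if rc: "r < n" "c < n" for r c
  proof (cases "c \<le> r")
    case True
    have "?M $$ (r, c) = ?M $$ (r - c, 0)"
      using T[unfolded toeplitz_def, rule_format, of r c "r - c" 0] rc True n by (simp add: dim of_nat_diff)
    then show ?thesis using True rc by (simp add: tail_prod_0 h_def)
  next
    case False
    then show ?thesis using tail_prod_entries[of r c 0] rc by simp
  qed
  have h0: "h $ 0 = 1" using M[of 0 0] tail_prod_entries[of 0 0 0] n by simp
  show "T_system n (rect_prod a)"
  proof (rule pade_vanishing_imp_T_system[OF nz h0])
    fix k l e assume kl: "1 \<le> k" "k + l \<le> n" "e \<in> {k..<k + l}"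
    \<comment> \<open>Row \<open>k + l - 1\<close> of \<open>tail_prod l\<close> involves
      \<open>pade a k l\<close>. For \<open>e \<ge> k\<close> the column \<open>?r - e\<close> lies
      before \<open>l\<close>, where this tail has an identity column.\<close>
    let ?r = "k + l - 1"
    have r: "Suc ?r - l = k" "?r - (?r - e) = e" "l \<le> ?r" "?r < n" "?r - e < n" "?r - e < l" "?r \<noteq> ?r - e" "?r - e \<le> ?r"
      using kl by auto
    have "tail_prod l $$ (?r, ?r - e) = (pade a k l * h) $ e"
      using tail_prod_Toeplitz[of h l ?r "?r - e", OF M r(3,4,5)] r(8) unfolding r(1,2) by simp
    moreover have "tail_prod l $$ (?r, ?r - e) = 0"
      using tail_prod_entries[OF r(4,5), of l] r(6,7) by simp
    ultimately show "(pade a k l * h) $ e = 0" by simp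
  qed
next
  assume T: "T_system n (rect_prod a)"
  let ?M = "yprod n (std_word n) (std_params n a)"
  have dim: "dim_row ?M = n" "dim_col ?M = n"
    using carrier_matD[OF yprod_carrier[of n "std_word n" "std_params n a"]] by auto
  \<comment> \<open>Column 0 of the product is determined by block 1 alone, hence by the rectangles
    of width 1.\<close>
  define h where "h = Abs_fps (\<lambda>k. rect_prod a k 1)"
  have van: "(pade a k l * h) $ e = 0" if "1 \<le> k" "k + l \<le> n" "e \<in> {k..<k + l}" for k l e
    using nz T that by (intro T_system_imp_pade_vanishing[of n a h k l e]) (auto simp: h_def)
  have entry: "?M $$ (r, c) = (if c \<le> r then h $ (r - c) else 0)" if "r < n" "c < n" for r c
    using tail_prod_vanishing[OF van, of 0 r c] that by (simp add: h_def tail_prod_0)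
  show "toeplitz ?M"
    unfolding toeplitz_def dim
  proof (intro allI impI, elim conjE)
    fix i j i' j' assume ij: "i < n" "j < n" "i' < n" "j' < n" and eq: "int i - int j = int i' - int j'"
    then have "j \<le> i \<longleftrightarrow> j' \<le> i'" "i - j = i' - j'" by linarith+
    then show "?M $$ (i, j) = ?M $$ (i', j')" using ij by (simp add: entry)
  qed
qed

end

section \<open>Solving the leading order and the linearized equations\<close>

text \<open>Knaster-Tarski on an interval: real-valued functions are only conditionally complete, so
  \<open>A\<close> and \<open>B\<close> supply the bounds for the pointwise supremum of the
  \<open>z\<close> with \<open>z \<le> F z\<close>.\<close>

lemma Tarski_between:
  fixes F :: "('i \<Rightarrow> real) \<Rightarrow> 'i \<Rightarrow> real"
  assumes mono: "\<And>z w. A \<le> z \<Longrightarrow> z \<le> w \<Longrightarrow> w \<le> B \<Longrightarrow> F z \<le> F w"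
    and AB: "A \<le> F A" "F B \<le> B" "A \<le> B"
  shows "\<exists>z. A \<le> z \<and> z \<le> B \<and> F z = z"
proof -
  define D where "D = {z. A \<le> z \<and> z \<le> B \<and> z \<le> F z}"
  define z where "z i = Sup ((\<lambda>w. w i) ` D)" for i
  have A: "A \<in> D" using AB by (simp add: D_def)
  have bdd: "bdd_above ((\<lambda>w. w i) ` D)" for i
    by (rule bdd_aboveI[of _ "B i"]) (auto simp: D_def le_fun_def)
  have up: "w \<le> z" if "w \<in> D" for w
    unfolding z_def le_fun_def using that bdd by (auto intro!: cSup_upper)
  have least: "z \<le> u" if "\<And>w. w \<in> D \<Longrightarrow> w \<le> u" for u
    unfolding z_def le_fun_def
  proof
    fix i
    show "Sup ((\<lambda>w. w i) ` D) \<le> u i"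
      using A that by (intro cSup_least) (auto simp: le_fun_def)
  qed
  have zB: "z \<le> B" by (rule least) (simp add: D_def)
  have Az: "A \<le> z" by (rule up[OF A])
  have zF: "z \<le> F z"
  proof (rule least)
    fix w assume w: "w \<in> D"
    then have "w \<le> F w" by (simp add: D_def)
    also have "F w \<le> F z" using w up[OF w] zB by (intro mono) (simp_all add: D_def)
    finally show "w \<le> F z" .
  qed
  have FzB: "F z \<le> B" using mono[OF Az zB order_refl] AB(2) by (rule order_trans)
  have "F z \<in> D"
    using mono[OF order_trans[OF Az order_refl] zF FzB] order_trans[OF Az zF] FzB by (simp add: D_def)
  then have "F z \<le> z" by (rule up)
  then show ?thesis using Az zB zF by (intro exI[of _ z]) auto
qed

text \<open>
  Leading coefficients: the equations hold with \<open>\<le>\<close> for the constant 1 and with \<open>\<ge>\<close> for the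
  function \<open>u\<close>, since \<open>u (k + 1) l * u (k - 1) l = u k l ^ 2 / 2\<close>.
\<close>

lemma leading_coeffs_exist:
  fixes P Q :: "nat \<Rightarrow> nat \<Rightarrow> bool"
  assumes PQ: "\<And>k l. 1 \<le> k \<Longrightarrow> 1 \<le> l \<Longrightarrow> k + l < n \<Longrightarrow> P k l \<or> Q k l"
  shows "\<exists>s :: nat \<Rightarrow> nat \<Rightarrow> real. (\<forall>k l. 0 < s k l) \<and>
    (\<forall>k l. \<not> (1 \<le> k \<and> 1 \<le> l \<and> k + l < n) \<longrightarrow> s k l = 1) \<and>
    (\<forall>k l. 1 \<le> k \<and> 1 \<le> l \<and> k + l < n \<longrightarrow> (s k l)\<^sup>2 =
      (if P k l then s (Suc k) l * s (k - 1) l else 0) + (if Q k l then s k (Suc l) * s k (l - 1) else 0))"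
proof -
  define I where "I k l \<longleftrightarrow> 1 \<le> k \<and> 1 \<le> l \<and> k + l < n" for k l
  define G where "G z k l = (if P k l then z (Suc k, l) * z (k - 1, l) else 0) +
    (if Q k l then z (k, Suc l) * z (k, l - 1) else 0)" for z :: "nat \<times> nat \<Rightarrow> real" and k l
  define F where "F z = (\<lambda>(k, l). if I k l then sqrt (G z k l) else 1)" for z
  \<comment> \<open>The exponent of the supersolution: its second difference is -1 in each variable,
    whence the factor 1/2 in the products of neighbours, and the square of \<open>n\<close> keeps it
    nonnegative for indices up to \<open>n\<close>, so that \<open>A \<le> B\<close>.\<close>
  define v :: "nat \<Rightarrow> nat \<Rightarrow> real" where "v k l = (real n)\<^sup>2 - ((real k)\<^sup>2 + (real l)\<^sup>2) / 2" for k l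
  define B :: "nat \<times> nat \<Rightarrow> real" where "B = (\<lambda>(k, l). if k \<le> n \<and> l \<le> n then 2 powr v k l else 1)"
  define A :: "nat \<times> nat \<Rightarrow> real" where "A = (\<lambda>_. 1)"
  have Gmono: "G z k l \<le> G w k l" if "A \<le> z" "z \<le> w" for z w k l
  proof -
    have zw: "1 \<le> z p" "z p \<le> w p" for p
      using le_funD[OF that(1), of p] le_funD[OF that(2), of p] by (simp_all add: A_def)
    have "0 \<le> z p" "0 \<le> w p" for p using zw[of p] by simp_all
    then have "z p * z q \<le> w p * w q" for p q
      using zw(2) by (intro mult_mono) simp_all
    then show ?thesis unfolding G_def by (intro add_mono) auto
  qed
  have mono: "F z \<le> F w" if "A \<le> z" "z \<le> w" for z w
    using Gmono[OF that] by (auto simp: F_def le_fun_def)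
  have AF: "A \<le> F A"
    using PQ by (auto simp: A_def F_def G_def I_def le_fun_def)
  have v0: "0 \<le> v k l" if "k \<le> n" "l \<le> n" for k l
  proof -
    have "(real k)\<^sup>2 + (real l)\<^sup>2 \<le> (real n)\<^sup>2 + (real n)\<^sup>2" using that by (intro add_mono power_mono) simp_all
    then show ?thesis by (simp add: v_def)
  qed
  have AB: "A \<le> B" using v0 by (auto simp: A_def B_def le_fun_def ge_one_powr_ge_zero)
  have FB: "F B \<le> B"
  proof (rule le_funI)
    fix p :: "nat \<times> nat"
    obtain k l where p: "p = (k, l)" by (cases p)
    show "F B p \<le> B p"
    proof (cases "I k l")
      case True
      then have kl: "1 \<le> k" "1 \<le> l" "k + l < n" "k - 1 \<le> n" "l - 1 \<le> n" by (auto simp: I_def)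
      have "v (Suc k) l + v (k - 1) l = 2 * v k l - 1"
        using kl by (simp add: v_def of_nat_diff power2_eq_square field_simps)
      then have 1: "B (Suc k, l) * B (k - 1, l) = 2 powr (2 * v k l - 1)"
        using kl by (simp add: B_def flip: powr_add)
      have "v k (Suc l) + v k (l - 1) = 2 * v k l - 1"
        using kl by (simp add: v_def of_nat_diff power2_eq_square field_simps)
      then have 2: "B (k, Suc l) * B (k, l - 1) = 2 powr (2 * v k l - 1)"
        using kl by (simp add: B_def flip: powr_add)
      have "G B k l \<le> 2 powr (2 * v k l - 1) + 2 powr (2 * v k l - 1)"
        unfolding G_def 1 2 by (intro add_mono) auto
      also have "\<dots> = (2 powr v k l)\<^sup>2"
        by (simp add: powr_diff power2_eq_square flip: powr_add)
      finally have "sqrt (G B k l) \<le> 2 powr v k l" by (intro real_le_lsqrt) simp_all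
      then show ?thesis using True kl by (simp add: F_def B_def p)
    next
      case False
      then show ?thesis using AB by (simp add: p F_def A_def le_fun_def)
    qed
  qed
  obtain z where z: "A \<le> z" "F z = z"
    using Tarski_between[of A B F] mono AF FB AB by blast
  have z1: "1 \<le> z p" for p using le_funD[OF z(1), of p] by (simp add: A_def)
  have "z (k, l) ^ 2 = G z k l" if "I k l" for k l
  proof -
    have "G A k l \<le> G z k l" by (rule Gmono) (use z(1) in auto)
    moreover have "0 \<le> G A k l" by (simp add: G_def A_def)
    moreover have "z (k, l) = sqrt (G z k l)" using fun_cong[OF z(2), of "(k, l)"] that by (simp add: F_def)
    ultimately show ?thesis by simp
  qed
  moreover have "z (k, l) = 1" if "\<not> I k l" for k l
    using fun_cong[OF z(2), of "(k, l)"] that by (simp add: F_def)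
  moreover have "0 < z p" for p using z1[of p] by simp
  ultimately show ?thesis
    by (intro exI[of _ "\<lambda>k l. z (k, l)"]) (auto simp: I_def G_def)
qed

text \<open>
  The linearized equations are solved between \<open>- c * \<phi>\<close> and \<open>c * \<phi>\<close> for the strictly concave
  function \<open>\<phi>\<close>.
\<close>

lemma linearization_real:
  fixes A B f :: "nat \<Rightarrow> nat \<Rightarrow> real"
  assumes AB: "\<And>k l. 1 \<le> k \<Longrightarrow> 1 \<le> l \<Longrightarrow> k + l < n \<Longrightarrow> 0 \<le> A k l \<and> 0 \<le> B k l \<and> A k l + B k l = 1"
  shows "\<exists>z :: nat \<Rightarrow> nat \<Rightarrow> real.
    (\<forall>k l. \<not> (1 \<le> k \<and> 1 \<le> l \<and> k + l < n) \<longrightarrow> z k l = 0) \<and>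
    (\<forall>k l. 1 \<le> k \<and> 1 \<le> l \<and> k + l < n \<longrightarrow>
      2 * z k l = A k l * (z (Suc k) l + z (k - 1) l) + B k l * (z k (Suc l) + z k (l - 1)) + f k l)"
proof -
  define I where "I k l \<longleftrightarrow> 1 \<le> k \<and> 1 \<le> l \<and> k + l < n" for k l
  define G where "G z k l = A k l * (z (Suc k, l) + z (k - 1, l)) + B k l * (z (k, Suc l) + z (k, l - 1)) + f k l"
    for z :: "nat \<times> nat \<Rightarrow> real" and k l
  define F where "F z = (\<lambda>(k, l). if I k l then G z k l / 2 else 0)" for z
  \<comment> \<open>The second difference is -2 in each variable, and the values are nonnegative for
    indices up to \<open>n\<close>. At \<open>d * \<phi>\<close> the map \<open>G\<close> deviates
    from \<open>2 * d * \<phi>\<close> by \<open>f - 2 * d\<close>, whose sign for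
    \<open>d = c\<close> and \<open>d = - c\<close> is fixed because \<open>c\<close> bounds all
    absolute values of \<open>f\<close>.\<close>
  define v :: "nat \<Rightarrow> nat \<Rightarrow> real" where "v k l = 2 * (real n)\<^sup>2 - ((real k)\<^sup>2 + (real l)\<^sup>2)" for k l
  define \<phi> :: "nat \<times> nat \<Rightarrow> real" where "\<phi> = (\<lambda>(k, l). if k \<le> n \<and> l \<le> n then v k l else 0)"
  define c where "c = (\<Sum>k<n. \<Sum>l<n. \<bar>f k l\<bar>)"
  have c: "\<bar>f k l\<bar> \<le> c" if "I k l" for k l
  proof -
    have "\<bar>f k l\<bar> \<le> (\<Sum>l<n. \<bar>f k l\<bar>)" by (rule member_le_sum) (use that in \<open>auto simp: I_def\<close>)
    also have "\<dots> \<le> c" unfolding c_def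
      by (rule member_le_sum) (use that in \<open>auto simp: I_def intro: sum_nonneg\<close>)
    finally show ?thesis .
  qed
  have c0: "0 \<le> c" unfolding c_def by (intro sum_nonneg) auto
  have phi0: "0 \<le> \<phi> p" for p
  proof -
    have "0 \<le> v k l" if "k \<le> n" "l \<le> n" for k l
    proof -
      have "(real k)\<^sup>2 \<le> (real n)\<^sup>2" "(real l)\<^sup>2 \<le> (real n)\<^sup>2" using that by (simp_all add: power_mono)
      then show ?thesis unfolding v_def by linarith
    qed
    then show ?thesis by (auto simp: \<phi>_def split: prod.split)
  qed
  have phi: "\<phi> (Suc k, l) + \<phi> (k - 1, l) = 2 * \<phi> (k, l) - 2" "\<phi> (k, Suc l) + \<phi> (k, l - 1) = 2 * \<phi> (k, l) - 2"
    if "I k l" for k l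
    using that by (auto simp: \<phi>_def v_def I_def of_nat_diff power2_eq_square field_simps)
  have Gphi: "G (\<lambda>p. d * \<phi> p) k l = 2 * (d * \<phi> (k, l)) - 2 * d + f k l" if "I k l" for d k l
  proof -
    have 1: "d * \<phi> (Suc k, l) + d * \<phi> (k - 1, l) = d * (2 * \<phi> (k, l) - 2)"
      "d * \<phi> (k, Suc l) + d * \<phi> (k, l - 1) = d * (2 * \<phi> (k, l) - 2)"
      using phi[OF that] by (simp_all flip: distrib_left)
    have "G (\<lambda>p. d * \<phi> p) k l = (A k l + B k l) * (d * (2 * \<phi> (k, l) - 2)) + f k l"
      unfolding G_def 1 by (simp add: algebra_simps)
    moreover have "A k l + B k l = 1" using AB that by (simp add: I_def)
    ultimately show ?thesis by (simp add: algebra_simps)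
  qed
  have "\<exists>z. (\<lambda>p. (- c) * \<phi> p) \<le> z \<and> z \<le> (\<lambda>p. c * \<phi> p) \<and> F z = z"
  proof (rule Tarski_between)
    show "F z \<le> F w" if "z \<le> w" for z w
    proof (rule le_funI)
      fix p :: "nat \<times> nat"
      obtain k l where p: "p = (k, l)" by (cases p)
      have "z q \<le> w q" for q using le_funD[OF that, of q] .
      then show "F z p \<le> F w p"
        using AB[of k l] unfolding p F_def G_def I_def
        by (auto intro!: add_mono mult_left_mono divide_right_mono)
    qed
    show "(\<lambda>p. (- c) * \<phi> p) \<le> F (\<lambda>p. (- c) * \<phi> p)"
    proof (rule le_funI)
      fix p :: "nat \<times> nat"
      obtain k l where p: "p = (k, l)" by (cases p)
      show "(- c) * \<phi> p \<le> F (\<lambda>p. (- c) * \<phi> p) p"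
      proof (cases "I k l")
        case True
        then have "F (\<lambda>p. (- c) * \<phi> p) p = (2 * ((- c) * \<phi> (k, l)) - 2 * (- c) + f k l) / 2"
          unfolding F_def p prod.case Gphi[OF True] by simp
        then show ?thesis using c[OF True] c0 by (simp add: p)
      next
        case False
        then show ?thesis using c0 phi0[of p] by (simp add: p F_def)
      qed
    qed
    show "F (\<lambda>p. c * \<phi> p) \<le> (\<lambda>p. c * \<phi> p)"
    proof (rule le_funI)
      fix p :: "nat \<times> nat"
      obtain k l where p: "p = (k, l)" by (cases p)
      show "F (\<lambda>p. c * \<phi> p) p \<le> c * \<phi> p"
      proof (cases "I k l")
        case True
        then have "F (\<lambda>p. c * \<phi> p) p = (2 * (c * \<phi> (k, l)) - 2 * c + f k l) / 2"
          unfolding F_def p prod.case Gphi[OF True] by simp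
        then show ?thesis using c[OF True] c0 by (simp add: p)
      next
        case False
        then show ?thesis using c0 phi0[of p] by (simp add: p F_def)
      qed
    qed
    show "(\<lambda>p. (- c) * \<phi> p) \<le> (\<lambda>p. c * \<phi> p)"
      using c0 phi0 by (auto simp: le_fun_def intro: order_trans[of _ 0])
  qed
  then obtain z where z: "F z = z" by blast
  have "z (k, l) = 0" if "\<not> I k l" for k l
    using fun_cong[OF z, of "(k, l)"] that by (simp add: F_def)
  moreover have "2 * z (k, l) = G z k l" if "I k l" for k l
    using fun_cong[OF z, of "(k, l)"] that by (simp add: F_def)
  ultimately show ?thesis
    by (intro exI[of _ "\<lambda>k l. z (k, l)"]) (auto simp: I_def G_def)
qed

lemma linearization_complex:
  fixes A B :: "nat \<Rightarrow> nat \<Rightarrow> real" and f :: "nat \<Rightarrow> nat \<Rightarrow> complex"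
  assumes AB: "\<And>k l. 1 \<le> k \<Longrightarrow> 1 \<le> l \<Longrightarrow> k + l < n \<Longrightarrow> 0 \<le> A k l \<and> 0 \<le> B k l \<and> A k l + B k l = 1"
  shows "\<exists>z :: nat \<Rightarrow> nat \<Rightarrow> complex.
    (\<forall>k l. \<not> (1 \<le> k \<and> 1 \<le> l \<and> k + l < n) \<longrightarrow> z k l = 0) \<and>
    (\<forall>k l. 1 \<le> k \<and> 1 \<le> l \<and> k + l < n \<longrightarrow>
      2 * z k l = of_real (A k l) * (z (Suc k) l + z (k - 1) l) + of_real (B k l) * (z k (Suc l) + z k (l - 1)) + f k l)"
proof -
  from linearization_real[of n A B "\<lambda>k l. Re (f k l)", OF AB]
  obtain x where x: "\<And>k l. \<not> (1 \<le> k \<and> 1 \<le> l \<and> k + l < n) \<Longrightarrow> x k l = 0"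
    "\<And>k l. 1 \<le> k \<and> 1 \<le> l \<and> k + l < n \<Longrightarrow>
      2 * x k l = A k l * (x (Suc k) l + x (k - 1) l) + B k l * (x k (Suc l) + x k (l - 1)) + Re (f k l)"
    by auto
  from linearization_real[of n A B "\<lambda>k l. Im (f k l)", OF AB]
  obtain y where y: "\<And>k l. \<not> (1 \<le> k \<and> 1 \<le> l \<and> k + l < n) \<Longrightarrow> y k l = 0"
    "\<And>k l. 1 \<le> k \<and> 1 \<le> l \<and> k + l < n \<Longrightarrow>
      2 * y k l = A k l * (y (Suc k) l + y (k - 1) l) + B k l * (y k (Suc l) + y k (l - 1)) + Im (f k l)"
    by auto
  show ?thesis
    using x y by (intro exI[of _ "\<lambda>k l. Complex (x k l) (y k l)"]) (auto simp: complex_eq_iff)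
qed

section \<open>Lifting to Puiseux series\<close>

definition agree :: "nat \<Rightarrow> 'a::comm_ring_1 fps \<Rightarrow> 'a fps \<Rightarrow> bool" where
  "agree m f g \<longleftrightarrow> (\<forall>j<m. fps_nth f j = fps_nth g j)"

lemma agree_refl [simp]: "agree m f f"
  by (simp add: agree_def)

lemma agree_add: "agree m f g \<Longrightarrow> agree m f' g' \<Longrightarrow> agree m (f + f') (g + g')"
  by (simp add: agree_def)

lemma agree_diff: "agree m f g \<Longrightarrow> agree m f' g' \<Longrightarrow> agree m (f - f') (g - g')"
  by (simp add: agree_def)

lemma agree_mult: "agree m f g \<Longrightarrow> agree m f' g' \<Longrightarrow> agree m (f * f') (g * g')"
  by (auto simp: agree_def fps_mult_nth intro!: sum.cong)

lemma agree_X_mult: "agree m f g \<Longrightarrow> agree (Suc m) (fps_X * f) (fps_X * g)"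
  by (auto simp: agree_def less_Suc_eq_0_disj)

lemma agree_mono: "agree m f g \<Longrightarrow> k \<le> m \<Longrightarrow> agree k f g"
  by (simp add: agree_def)

text \<open>Banach's fixed point theorem for the \<open>fps_X\<close>-adic metric: iterating from 0,
  the coefficient of degree \<open>m\<close> no longer changes after \<open>m + 1\<close>
  steps.\<close>

lemma fps_contraction_fixpoint:
  fixes \<Phi> :: "('i \<Rightarrow> 'a::comm_ring_1 fps) \<Rightarrow> 'i \<Rightarrow> 'a fps"
  assumes contr: "\<And>m y z. (\<And>i. agree m (y i) (z i)) \<Longrightarrow> (\<And>i. agree (Suc m) (\<Phi> y i) (\<Phi> z i))"
  shows "\<exists>y. \<Phi> y = y"
proof -
  define Z where "Z j = (\<Phi> ^^ j) (\<lambda>_. 0)" for j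
  have Z: "Z (Suc j) = \<Phi> (Z j)" for j by (simp add: Z_def)
  have step: "agree j (Z j i) (Z (Suc j) i)" for i j
  proof (induction j arbitrary: i)
    case 0
    then show ?case by (simp add: agree_def)
  next
    case (Suc j)
    then show ?case using contr[of j "Z j" "Z (Suc j)" i] by (simp add: Z)
  qed
  have mono: "agree j (Z j i) (Z k i)" if "j \<le> k" for i j k
    using that
  proof (induction k rule: dec_induct)
    case (step k)
    then show ?case using agree_mono[OF \<open>\<And>i j. agree j (Z j i) (Z (Suc j) i)\<close>, of j k i] by (simp add: agree_def)
  qed simp
  define y where "y i = Abs_fps (\<lambda>m. fps_nth (Z (Suc m) i) m)" for i
  have y: "agree j (y i) (Z j i)" for i j
    using mono[of "Suc _" j i] by (auto simp: agree_def y_def Suc_le_eq)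
  have "agree j (\<Phi> y i) (y i)" for i j
    using agree_mono[OF contr[of j y "Z j" i, OF y], of j] y[of j i] agree_mono[OF y[of "Suc j" i], of j]
    by (simp add: agree_def Z)
  then have "\<Phi> y i = y i" for i
    by (auto simp: agree_def fps_eq_iff)
  then show ?thesis by blast
qed

text \<open>The exponents measure how far each term lies above the leading order; only terms with
  exponent 0 enter the leading equation, solved by \<open>s\<close>. With
  \<open>f = s * (1 + fps_X * y)\<close>, division by \<open>fps_X\<close> leaves
  \<open>2 * y\<close> equal to a linear part plus \<open>G y\<close>, where \<open>y\<close> enters
  \<open>G\<close> only with a factor \<open>fps_X\<close>. Inverting the linear operator in each
  degree turns this into a contraction.\<close>

lemma T_system_fps_solution:
  fixes e1 e2 :: "nat \<Rightarrow> nat \<Rightarrow> nat"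
  assumes e: "\<And>k l. 1 \<le> k \<Longrightarrow> 1 \<le> l \<Longrightarrow> k + l < n \<Longrightarrow> e1 k l = 0 \<or> e2 k l = 0"
  shows "\<exists>f :: nat \<Rightarrow> nat \<Rightarrow> complex fps. (\<forall>k l. \<exists>r>0. fps_nth (f k l) 0 = complex_of_real r) \<and>
    (\<forall>k l. \<not> (1 \<le> k \<and> 1 \<le> l \<and> k + l < n) \<longrightarrow> f k l = 1) \<and>
    (\<forall>k l. 1 \<le> k \<and> 1 \<le> l \<and> k + l < n \<longrightarrow> (f k l)\<^sup>2 =
      fps_X ^ e1 k l * (f (Suc k) l * f (k - 1) l) + fps_X ^ e2 k l * (f k (Suc l) * f k (l - 1)))"
proof -
  define I where "I k l \<longleftrightarrow> 1 \<le> k \<and> 1 \<le> l \<and> k + l < n" for k l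
  obtain s :: "nat \<Rightarrow> nat \<Rightarrow> real" where s0: "\<And>k l. 0 < s k l"
    and s1: "\<And>k l. \<not> I k l \<Longrightarrow> s k l = 1"
    and s: "\<And>k l. I k l \<Longrightarrow> (s k l)\<^sup>2 =
      (if e1 k l = 0 then s (Suc k) l * s (k - 1) l else 0) + (if e2 k l = 0 then s k (Suc l) * s k (l - 1) else 0)"
    using leading_coeffs_exist[of n "\<lambda>k l. e1 k l = 0" "\<lambda>k l. e2 k l = 0", OF e] unfolding I_def by blast
  \<comment> \<open>Relative weights of the two terms; the leading equation for \<open>s\<close>
    becomes \<open>A + B = 1\<close>, the averaging condition of
    \<open>linearization_complex\<close>.\<close>
  define a where "a k l = s (Suc k) l * s (k - 1) l / (s k l)\<^sup>2" for k l
  define b where "b k l = s k (Suc l) * s k (l - 1) / (s k l)\<^sup>2" for k l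
  define A where "A k l = (if e1 k l = 0 then a k l else 0)" for k l
  define B where "B k l = (if e2 k l = 0 then b k l else 0)" for k l
  have AB: "0 \<le> A k l \<and> 0 \<le> B k l \<and> A k l + B k l = 1" if "1 \<le> k" "1 \<le> l" "k + l < n" for k l
  proof -
    have "I k l" using that by (simp add: I_def)
    have nz: "(s k l)\<^sup>2 \<noteq> 0" using s0[of k l] by simp
    have "A k l + B k l = ((if e1 k l = 0 then s (Suc k) l * s (k - 1) l else 0) + (if e2 k l = 0 then s k (Suc l) * s k (l - 1) else 0)) / (s k l)\<^sup>2"
      by (simp add: A_def B_def a_def b_def add_divide_distrib)
    also have "\<dots> = 1" unfolding s[OF \<open>I k l\<close>, symmetric] using nz by simp
    finally show ?thesis using s0 by (simp add: A_def B_def a_def b_def less_imp_le)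
  qed
  define sol where "sol f z \<longleftrightarrow> (\<forall>k l. \<not> I k l \<longrightarrow> z k l = 0) \<and> (\<forall>k l. I k l \<longrightarrow>
      2 * z k l = of_real (A k l) * (z (Suc k) l + z (k - 1) l) + of_real (B k l) * (z k (Suc l) + z k (l - 1)) + f k l)"
    for f z :: "nat \<Rightarrow> nat \<Rightarrow> complex"
  have "\<forall>f. \<exists>z. sol f z"
    using linearization_complex[of n A B, OF AB] unfolding sol_def I_def by simp
  \<comment> \<open>One solution is fixed for each right-hand side, so that right-hand sides
    agreeing in a degree give solutions agreeing there.\<close>
  from choice[OF this] obtain J where "\<forall>f. sol f (J f)" ..
  then have sol: "sol f (J f)" for f by simp
  note J = sol[unfolded sol_def]
  define c :: "real \<Rightarrow> complex fps" where "c x = fps_const (of_real x)" for x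
  \<comment> \<open>\<open>A\<close> and \<open>A'\<close> split \<open>a * fps_X ^ e1\<close> into
    its constant term and \<open>fps_X\<close> times the rest.\<close>
  define A' where "A' k l = (if e1 k l = 0 then 0 else c (a k l) * fps_X ^ (e1 k l - 1))" for k l
  define B' where "B' k l = (if e2 k l = 0 then 0 else c (b k l) * fps_X ^ (e2 k l - 1))" for k l
  define G where "G y k l = fps_X * (c (A k l) * (y (Suc k, l) * y (k - 1, l)) + c (B k l) * (y (k, Suc l) * y (k, l - 1)) - y (k, l) * y (k, l))
      + A' k l * ((1 + fps_X * y (Suc k, l)) * (1 + fps_X * y (k - 1, l)))
      + B' k l * ((1 + fps_X * y (k, Suc l)) * (1 + fps_X * y (k, l - 1)))"
    for y :: "nat \<times> nat \<Rightarrow> complex fps" and k l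
  define \<Phi> where "\<Phi> y = (\<lambda>(k, l). Abs_fps (\<lambda>m. J (\<lambda>k l. fps_nth (G y k l) m) k l))" for y
  have "\<exists>y. \<Phi> y = y"
  proof (rule fps_contraction_fixpoint)
    fix m :: nat and y z :: "nat \<times> nat \<Rightarrow> complex fps" and i
    assume yz: "\<And>i. agree m (y i) (z i)"
    have "agree (Suc m) (G y k l) (G z k l)" for k l
      unfolding G_def by (intro agree_add agree_mult agree_X_mult agree_diff agree_refl yz)
    then have "fps_nth (G y k l) j = fps_nth (G z k l) j" if "j < Suc m" for j k l
      using that unfolding agree_def by blast
    then show "agree (Suc m) (\<Phi> y i) (\<Phi> z i)"
      by (simp add: agree_def \<Phi>_def split: prod.split)
  qed
  then obtain y where y: "\<Phi> y = y" by blast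
  have ynth: "fps_nth (y (k, l)) m = J (\<lambda>k l. fps_nth (G y k l) m) k l" for k l m
    using fun_cong[OF y, of "(k, l)"] by (metis (mono_tags, lifting) \<Phi>_def case_prod_conv fps_nth_Abs_fps)
  have y0: "y (k, l) = 0" if "\<not> I k l" for k l
    using J that by (simp add: fps_eq_iff ynth)
  have eq: "2 * y (k, l) = c (A k l) * (y (Suc k, l) + y (k - 1, l)) + c (B k l) * (y (k, Suc l) + y (k, l - 1)) + G y k l"
    if "I k l" for k l
  proof (rule fps_ext)
    fix m
    have "fps_nth (2 * y (k, l)) m = 2 * fps_nth (y (k, l)) m"
      by (metis fps_mult_left_const_nth numeral_fps_const)
    then show "fps_nth (2 * y (k, l)) m = fps_nth (c (A k l) * (y (Suc k, l) + y (k - 1, l)) + c (B k l) * (y (k, Suc l) + y (k, l - 1)) + G y k l) m"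
      using J[of "\<lambda>k l. fps_nth (G y k l) m"] that by (simp add: c_def ynth)
  qed
  define g where "g p = 1 + fps_X * y p" for p
  have cAB: "c (A k l) + c (B k l) = 1" if "I k l" for k l
    using AB[of k l] that unfolding I_def c_def by (simp add: fps_const_add flip: of_real_add)
  have ca: "c (a k l) * fps_X ^ e1 k l = c (A k l) + fps_X * A' k l" for k l
    by (cases "e1 k l") (simp_all add: A_def A'_def c_def)
  have cb: "c (b k l) * fps_X ^ e2 k l = c (B k l) + fps_X * B' k l" for k l
    by (cases "e2 k l") (simp_all add: B_def B'_def c_def)
  have main: "(g (k, l))\<^sup>2 = c (a k l) * fps_X ^ e1 k l * (g (Suc k, l) * g (k - 1, l)) + c (b k l) * fps_X ^ e2 k l * (g (k, Suc l) * g (k, l - 1))"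
    if "I k l" for k l
  proof -
    have poly: "(1 + X * y0) ^ 2 = (A0 + X * A1) * ((1 + X * y1) * (1 + X * y2)) + (B0 + X * B1) * ((1 + X * y3) * (1 + X * y4))"
      if "2 * y0 = A0 * (y1 + y2) + B0 * (y3 + y4) + (X * (A0 * (y1 * y2) + B0 * (y3 * y4) - y0 * y0)
        + A1 * ((1 + X * y1) * (1 + X * y2)) + B1 * ((1 + X * y3) * (1 + X * y4)))" "A0 + B0 = 1"
      for X y0 y1 y2 y3 y4 A0 A1 B0 B1 :: "complex fps"
    proof -
      have "(1 + X * y0) ^ 2 = 1 + X * (2 * y0) + X * X * (y0 * y0)"
        by (simp add: power2_eq_square algebra_simps)
      also have "\<dots> = (A0 + B0) + X * (2 * y0) + X * X * (y0 * y0)" using that(2) by simp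
      also have "\<dots> = (A0 + X * A1) * ((1 + X * y1) * (1 + X * y2)) + (B0 + X * B1) * ((1 + X * y3) * (1 + X * y4))"
        unfolding that(1) by (simp add: algebra_simps)
      finally show ?thesis .
    qed
    show ?thesis
      unfolding ca cb g_def by (rule poly[OF eq[OF that, unfolded G_def] cAB[OF that]])
  qed
  define f where "f k l = c (s k l) * g (k, l)" for k l
  have cm: "c (x * y) = c x * c y" for x y by (simp add: c_def)
  have "fps_nth (f k l) 0 = of_real (s k l)" for k l by (simp add: f_def c_def g_def)
  moreover have "f k l = 1" if "\<not> I k l" for k l
    using that by (simp add: f_def g_def y0 s1 c_def)
  moreover have "(f k l)\<^sup>2 = fps_X ^ e1 k l * (f (Suc k) l * f (k - 1) l) + fps_X ^ e2 k l * (f k (Suc l) * f k (l - 1))"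
    if "I k l" for k l
  proof -
    have nz: "(s k l)\<^sup>2 \<noteq> 0" using s0[of k l] by simp
    have "(f k l)\<^sup>2 = c ((s k l)\<^sup>2) * (g (k, l))\<^sup>2" by (simp add: f_def power_mult_distrib cm power2_eq_square)
    also have "\<dots> = c ((s k l)\<^sup>2 * a k l) * fps_X ^ e1 k l * (g (Suc k, l) * g (k - 1, l))
        + c ((s k l)\<^sup>2 * b k l) * fps_X ^ e2 k l * (g (k, Suc l) * g (k, l - 1))"
      unfolding main[OF that] cm by (simp add: algebra_simps)
    also have "(s k l)\<^sup>2 * a k l = s (Suc k) l * s (k - 1) l" using nz by (simp add: a_def)
    also have "(s k l)\<^sup>2 * b k l = s k (Suc l) * s k (l - 1)" using nz by (simp add: b_def)
    finally show ?thesis unfolding f_def cm by (simp add: algebra_simps)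
  qed
  ultimately show ?thesis
    using s0 by (intro exI[of _ f]) (auto simp: I_def)
qed

section \<open>Rescaling to integer exponents\<close>

lemma common_denominator:
  fixes A :: "rat set"
  assumes "finite A"
  shows "\<exists>d>0. \<forall>x\<in>A. x * of_nat d \<in> \<int>"
  using assms
proof induction
  case empty
  then show ?case by (intro exI[of _ 1]) simp
next
  case (insert x A)
  then obtain d where d: "d > 0" "\<forall>x\<in>A. x * of_nat d \<in> \<int>" by blast
  obtain p q where x: "x = Fract p q" "0 < q" by (cases x)
  have x': "x * of_nat (nat q) = of_int p" using x by (simp add: Fract_of_int_quotient)
  have "y * of_nat (d * nat q) \<in> \<int>" if "y \<in> insert x A" for y
  proof (cases "y = x")
    case True
    have "x * of_nat (d * nat q) = of_int p * of_nat d"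
      unfolding of_nat_mult x'[symmetric] by (simp only: ac_simps)
    moreover have "of_int p * of_nat d \<in> (\<int> :: rat set)" by simp
    ultimately show ?thesis unfolding True by (simp only:)
  next
    case False
    then have "y * of_nat d \<in> \<int>" using d(2) that by simp
    from Ints_mult[OF this Ints_of_nat[of "nat q"]] show ?thesis
      by (simp only: of_nat_mult mult.assoc)
  qed
  then show ?case using d x by (intro exI[of _ "d * nat q"]) auto
qed

lemma lead_of_fls_shift:
  assumes "d > 0"
  shows "lead (- of_int m / of_nat d) (fps_nth f 0) (of_fls d (fls_shift m (fps_to_fls f)))"
proof -
  have "pcoeff (of_fls d (fls_shift m (fps_to_fls f))) (of_int (- m) / of_nat d) = fps_nth f 0"
    unfolding pcoeff_of_fls_frac[OF assms] by simp
  moreover have "pcoeff (of_fls d (fls_shift m (fps_to_fls f))) q = 0" if "q < - of_int m / of_nat d" for q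
  proof (rule ccontr)
    assume *: "pcoeff (of_fls d (fls_shift m (fps_to_fls f))) q \<noteq> 0"
    then obtain j where q: "q = of_int j / of_nat d" using of_fls_supp[OF assms] by blast
    have "rat_of_int j / of_nat d < of_int (- m) / of_nat d" using that by (simp add: q)
    then have "rat_of_int j < of_int (- m)"
      using assms by (auto simp: divide_less_cancel simp del: of_int_minus)
    then have "j < - m" by linarith
    then show False using * unfolding q pcoeff_of_fls_frac[OF assms] by simp
  qed
  ultimately show ?thesis by (simp add: lead_def)
qed

text \<open>Mixed quotients invert the formation of rectangular products: the product over a row
  telescopes to \<open>S (k + 1) l / S k l\<close>, and these telescope over the rows.\<close>

lemma rect_prod_of_ratios:
  fixes S :: "nat \<Rightarrow> nat \<Rightarrow> 'a::field"
  assumes nz: "\<And>k l. S k l \<noteq> 0" and S1: "\<And>k. S k 0 = 1" "\<And>l. S 0 l = 1"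
  shows "rect_prod (\<lambda>k l. S k l * S (k - 1) (l - 1) / (S (k - 1) l * S k (l - 1))) k l = S k l"
proof -
  let ?a = "\<lambda>k l. S k l * S (k - 1) (l - 1) / (S (k - 1) l * S k (l - 1))"
  have row: "(\<Prod>j=1..l. ?a (Suc k) j) = S (Suc k) l / S k l" for k
    by (induction l) (simp_all add: S1 nz)
  show ?thesis
  proof (induction k)
    case (Suc k)
    then show ?case unfolding rect_prod_Suc row by (simp add: nz)
  qed (simp add: S1)
qed

text \<open>Put \<open>S = t^(- W / d) * f(t^(1 / d))\<close> with the rectangular sums
  \<open>W\<close> of the integers \<open>M = d * \<mu>\<close>. Dividing the T-system by the power
  of \<open>t\<close> on its left leaves the exponents \<open>- R\<close> and \<open>- C\<close>,
  which are nonnegative and not both positive because the filling is ideal.\<close>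

lemma T_system_solution:
  fixes \<mu> :: "nat \<Rightarrow> nat \<Rightarrow> rat"
  assumes ideal: "\<And>k l. 1 \<le> k \<Longrightarrow> 1 \<le> l \<Longrightarrow> k + l < n \<Longrightarrow> \<mu> k l = max (\<mu> (Suc k) l) (\<mu> k (Suc l))"
  shows "\<exists>a :: nat \<Rightarrow> nat \<Rightarrow> complex puiseux. (\<forall>k l. pos_leading_coeff (a k l)) \<and>
    (\<forall>k l. 1 \<le> k \<and> 1 \<le> l \<and> k + l \<le> n \<longrightarrow> Val (a k l) = - \<mu> k l) \<and> T_system n (rect_prod a)"
proof -
  obtain d where d: "d > 0" "\<And>k l. k \<le> n \<Longrightarrow> l \<le> n \<Longrightarrow> \<mu> k l * of_nat d \<in> \<int>"
    using common_denominator[of "(\<lambda>(k, l). \<mu> k l) ` ({..n} \<times> {..n})"] by auto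
  define M where "M k l = \<lfloor>\<mu> k l * of_nat d\<rfloor>" for k l
  have M: "of_int (M k l) = \<mu> k l * of_nat d" if "k + l \<le> n" for k l
    using d(2)[of k l] that by (auto simp: M_def elim: Ints_cases)
  have M_ideal: "M k l = max (M (Suc k) l) (M k (Suc l))" if "1 \<le> k" "1 \<le> l" "k + l < n" for k l
  proof -
    have mono: "\<lfloor>x * of_nat d\<rfloor> \<le> \<lfloor>y * of_nat d\<rfloor>" if "x \<le> y" for x y :: rat
      using that by (intro floor_mono mult_right_mono) simp_all
    show ?thesis
      using ideal[OF that] mono[of "\<mu> (Suc k) l" "\<mu> k (Suc l)"] mono[of "\<mu> k (Suc l)" "\<mu> (Suc k) l"]
      unfolding M_def by (cases "\<mu> (Suc k) l \<le> \<mu> k (Suc l)") (simp_all add: max_def)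
  qed
  define W where "W k l = (\<Sum>i=1..k. \<Sum>j=1..l. M i j)" for k l
  have W0: "W 0 l = 0" "W k 0 = 0" for k l by (simp_all add: W_def)
  have WS1: "W (Suc k) l = W k l + (\<Sum>j=1..l. M (Suc k) j)" for k l by (simp add: W_def)
  have WS2: "W k (Suc l) = W k l + (\<Sum>i=1..k. M i (Suc l))" for k l by (simp add: W_def sum.distrib)
  define R where "R k l = (\<Sum>j=1..l. M (Suc k) j - M k j)" for k l
  define C where "C k l = (\<Sum>i=1..k. M i (Suc l) - M i l)" for k l
  have WR: "W (Suc k) l + W (k - 1) l = 2 * W k l + R k l" if "1 \<le> k" for k l
    using that WS1[of k l] WS1[of "k - 1" l] by (simp add: R_def sum_subtractf)
  have WC: "W k (Suc l) + W k (l - 1) = 2 * W k l + C k l" if "1 \<le> l" for k l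
    using that WS2[of k l] WS2[of k "l - 1"] by (simp add: C_def sum_subtractf)
  have RC: "max (R k l) (C k l) = 0" if "1 \<le> k" "1 \<le> l" "k + l < n" for k l
    unfolding R_def C_def by (rule ideal_imp_tropical_T_system[where \<mu> = M and n = n, OF M_ideal that])
  have RC0: "R k l \<le> 0" "C k l \<le> 0" "R k l = 0 \<or> C k l = 0" if "1 \<le> k" "1 \<le> l" "k + l < n" for k l
    using RC[OF that] by (auto simp: max_def split: if_splits)
  obtain f :: "nat \<Rightarrow> nat \<Rightarrow> complex fps"
    where f0: "\<And>k l. \<exists>r>0. fps_nth (f k l) 0 = complex_of_real r"
      and f1: "\<And>k l. \<not> (1 \<le> k \<and> 1 \<le> l \<and> k + l < n) \<Longrightarrow> f k l = 1"
      and f: "\<And>k l. 1 \<le> k \<Longrightarrow> 1 \<le> l \<Longrightarrow> k + l < n \<Longrightarrow> (f k l)\<^sup>2 =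
        fps_X ^ nat (- R k l) * (f (Suc k) l * f (k - 1) l) + fps_X ^ nat (- C k l) * (f k (Suc l) * f k (l - 1))"
  proof -
    have e: "nat (- R k l) = 0 \<or> nat (- C k l) = 0" if "1 \<le> k" "1 \<le> l" "k + l < n" for k l
      using RC0(3)[OF that] by auto
    show thesis using T_system_fps_solution[of n "\<lambda>k l. nat (- R k l)" "\<lambda>k l. nat (- C k l)", OF e] that by blast
  qed
  \<comment> \<open>\<open>fls_shift\<close> by \<open>W\<close> lowers the exponents, which gives
    the sign in \<open>Val (a k l) = - \<mu> k l\<close>.\<close>
  define F where "F k l = fls_shift (W k l) (fps_to_fls (f k l))" for k l
  define S where "S k l = of_fls d (F k l)" for k l
  have Fmult: "F k l * F k' l' = fls_shift (W k l + W k' l') (fps_to_fls (f k l * f k' l'))" for k l k' l'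
    by (simp add: F_def fls_times_both_shifted_simp fls_times_fps_to_fls)
  have shift_X: "fps_to_fls (fps_X ^ e * g) = fls_shift (- int e) (fps_to_fls g)" for e and g :: "complex fps"
    by (simp add: fls_times_fps_to_fls fps_to_fls_power fls_X_power_times_conv_shift)
  have FT: "(F k l)\<^sup>2 = F (Suc k) l * F (k - 1) l + F k (Suc l) * F k (l - 1)"
    if kl: "1 \<le> k" "1 \<le> l" "k + l < n" for k l
  proof -
    have "(F k l)\<^sup>2 = fls_shift (2 * W k l) (fps_to_fls ((f k l)\<^sup>2))"
      unfolding power2_eq_square Fmult by (simp only: mult_2)
    also have "\<dots> = fls_shift (2 * W k l + R k l) (fps_to_fls (f (Suc k) l * f (k - 1) l)) +
        fls_shift (2 * W k l + C k l) (fps_to_fls (f k (Suc l) * f k (l - 1)))"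
      unfolding f[OF kl] fps_to_fls_plus shift_X fls_shift_plus using RC0[OF kl] by (simp add: add.commute)
    also have "\<dots> = F (Suc k) l * F (k - 1) l + F k (Suc l) * F k (l - 1)"
      unfolding Fmult using WR[OF kl(1), of l] WC[OF kl(2), of k] by simp
    finally show ?thesis .
  qed
  have ST: "T_system n S"
    unfolding T_system_def S_def
    by (auto simp: power2_eq_square of_fls_mult[OF d(1)] of_fls_add[OF d(1)] FT[unfolded power2_eq_square])
  have pos: "pos_leading_coeff (S k l)" "Val (S k l) = - of_int (W k l) / of_nat d" for k l
  proof -
    obtain r where "r > 0" "fps_nth (f k l) 0 = complex_of_real r" using f0 by blast
    then show "pos_leading_coeff (S k l)" "Val (S k l) = - of_int (W k l) / of_nat d"
      using pos_leadI[of "- of_int (W k l) / of_nat d" r "S k l"] lead_of_fls_shift[OF d(1), of "W k l" "f k l"]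
      by (simp_all add: S_def F_def)
  qed
  have S1: "S k 0 = 1" "S 0 l = 1" for k l
    by (simp_all add: S_def F_def W0 f1 of_fls_1[OF d(1)])
  define a where "a k l = S k l * S (k - 1) (l - 1) / (S (k - 1) l * S k (l - 1))" for k l
  have "rect_prod a = S"
    using rect_prod_of_ratios[of S] pos_leading_coeff_nonzero[OF pos(1)] S1 by (auto simp: fun_eq_iff a_def[abs_def])
  moreover have "pos_leading_coeff (a k l)" for k l
    unfolding a_def by (intro pos_divide pos_mult pos)
  moreover have "Val (a k l) = - \<mu> k l" if kl: "1 \<le> k" "1 \<le> l" "k + l \<le> n" for k l
  proof -
    obtain k' l' where k': "k = Suc k'" "l = Suc l'" using kl by (metis Suc_le_D One_nat_def)
    have "W (Suc k') (Suc l') + W k' l' - W k' (Suc l') - W (Suc k') l' = M k l"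
      by (simp add: WS1[of k'] k')
    from arg_cong[OF this, of rat_of_int]
    have M': "of_int (W (Suc k') (Suc l')) + of_int (W k' l') - of_int (W k' (Suc l')) - of_int (W (Suc k') l') = rat_of_int (M k l)"
      by (simp only: of_int_add of_int_diff)
    have "Val (a k l) = Val (S (Suc k') (Suc l')) + Val (S k' l') - (Val (S k' (Suc l')) + Val (S (Suc k') l'))"
      by (simp add: a_def pos_divide pos_mult pos(1) k')
    also have "\<dots> = - of_int (M k l) / of_nat d"
      unfolding pos(2) M'[symmetric] by (simp add: add_divide_distrib diff_divide_distrib)
    finally have "Val (a k l) = - of_int (M k l) / of_nat d" .
    then show ?thesis using M[OF kl(3)] d(1) by simp
  qed
  ultimately show ?thesis using ST by (intro exI[of _ a]) auto
qed

section \<open>Ideal fillings\<close>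

text \<open>Unfolding the recursion down to the simple roots shows that \<open>\<mu> i k\<close> is
  the maximum of \<open>\<mu> t (t + 1)\<close> over \<open>i \<le> t < k\<close>, and this interval
  splits at any \<open>j\<close>.\<close>

lemma ideal_imp_ultra:
  fixes \<mu> :: "nat \<Rightarrow> nat \<Rightarrow> 'a::linorder"
  assumes ideal: "\<And>i j. 1 \<le> i \<Longrightarrow> j \<le> n \<Longrightarrow> i + 2 \<le> j \<Longrightarrow> \<mu> i j = max (\<mu> (i + 1) j) (\<mu> i (j - 1))"
  shows "ultra n \<mu>"
proof -
  have Max: "\<mu> i k = Max ((\<lambda>t. \<mu> t (Suc t)) ` {i..<k})" if "1 \<le> i" "i < k" "k \<le> n" for i k
    using that
  proof (induction "k - i" arbitrary: i k rule: less_induct)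
    case less
    show ?case
    proof (cases "k = Suc i")
      case False
      then have ik: "i + 2 \<le> k" using less.prems by simp
      then have un: "{i..<k} = {i + 1..<k} \<union> {i..<k - 1}" by auto
      have "\<mu> i k = max (\<mu> (i + 1) k) (\<mu> i (k - 1))" using ideal ik less.prems by simp
      also have "\<mu> (i + 1) k = Max ((\<lambda>t. \<mu> t (Suc t)) ` {i + 1..<k})"
        using less.prems ik by (intro less.hyps) auto
      also have "\<mu> i (k - 1) = Max ((\<lambda>t. \<mu> t (Suc t)) ` {i..<k - 1})"
        using less.prems ik by (intro less.hyps) auto
      finally show ?thesis
        unfolding un image_Un using ik by (subst Max_Un) auto
    qed simp
  qed
  show ?thesis
    unfolding ultra_def
  proof (intro allI impI, elim conjE)
    fix i j k assume ijk: "1 \<le> i" "i < j" "j < k" "k \<le> n"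
    then have un: "{i..<k} = {i..<j} \<union> {j..<k}" by auto
    have "\<mu> i k = Max ((\<lambda>t. \<mu> t (Suc t)) ` {i..<k})" using ijk by (intro Max) auto
    also have "\<dots> = max (Max ((\<lambda>t. \<mu> t (Suc t)) ` {i..<j})) (Max ((\<lambda>t. \<mu> t (Suc t)) ` {j..<k}))"
      unfolding un image_Un using ijk by (intro Max_Un) auto
    also have "\<dots> = max (\<mu> i j) (\<mu> j k)" using ijk Max[of i j] Max[of j k] by simp
    finally show "\<mu> i k = max (\<mu> i j) (\<mu> j k)" .
  qed
qed

text \<open>By positivity the valuation of the right-hand side of the T-system is the minimum of
  those of its two terms. The double signs make the conclusion literally the hypothesis of
  \<open>tropical_T_system_imp_ideal\<close> for \<open>- Val (a k l)\<close>.\<close>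

lemma T_system_Val:
  fixes a :: "nat \<Rightarrow> nat \<Rightarrow> complex puiseux"
  assumes pos: "\<And>k l. 1 \<le> k \<Longrightarrow> 1 \<le> l \<Longrightarrow> k + l \<le> n \<Longrightarrow> pos_leading_coeff (a k l)"
    and T: "T_system n (rect_prod a)" and kl: "1 \<le> k" "1 \<le> l" "k + l < n"
  shows "max (\<Sum>j=1..l. - Val (a (Suc k) j) - - Val (a k j)) (\<Sum>i=1..k. - Val (a i (Suc l)) - - Val (a i l)) = 0"
proof -
  let ?S = "rect_prod a"
  have posS: "pos_leading_coeff (?S k l)" and ValS: "Val (?S k l) = (\<Sum>i=1..k. \<Sum>j=1..l. Val (a i j))"
    if "k + l \<le> n" for k l
  proof -
    have row: "pos_leading_coeff (\<Prod>j=1..l. a i j)" "Val (\<Prod>j=1..l. a i j) = (\<Sum>j=1..l. Val (a i j))"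
      if "i \<in> {1..k}" for i
      using that \<open>k + l \<le> n\<close> by (intro pos_prod pos; simp)+
    show "pos_leading_coeff (?S k l)" "Val (?S k l) = (\<Sum>i=1..k. \<Sum>j=1..l. Val (a i j))"
      unfolding rect_prod_def using row pos_prod[of "{1..k}" "\<lambda>i. \<Prod>j=1..l. a i j"] by simp_all
  qed
  define V where "V k l = Val (?S k l)" for k l
  have V1: "V (Suc k) l = V k l + (\<Sum>j=1..l. Val (a (Suc k) j))" if "Suc k + l \<le> n" for k l
    using that by (simp add: V_def ValS)
  have V2: "V k (Suc l) = V k l + (\<Sum>i=1..k. Val (a i (Suc l)))" if "k + Suc l \<le> n" for k l
    using that by (simp add: V_def ValS sum.distrib)
  have "?S k l * ?S k l = ?S (Suc k) l * ?S (k - 1) l + ?S k (Suc l) * ?S k (l - 1)"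
    using T kl by (simp add: T_system_def power2_eq_square)
  moreover have p: "pos_leading_coeff (?S k l)" "pos_leading_coeff (?S (Suc k) l)" "pos_leading_coeff (?S (k - 1) l)"
    "pos_leading_coeff (?S k (Suc l))" "pos_leading_coeff (?S k (l - 1))"
    using kl by (auto intro!: posS)
  ultimately have "2 * V k l = min (V (Suc k) l + V (k - 1) l) (V k (Suc l) + V k (l - 1))"
    using arg_cong[of _ _ Val] by (metis V_def mult_2 pos_add(2) pos_mult)
  moreover have "(\<Sum>j=1..l. - Val (a (Suc k) j) - - Val (a k j)) = 2 * V k l - (V (Suc k) l + V (k - 1) l)"
    using V1[of k l] V1[of "k - 1" l] kl by (simp add: sum_subtractf sum_negf)
  moreover have "(\<Sum>i=1..k. - Val (a i (Suc l)) - - Val (a i l)) = 2 * V k l - (V k (Suc l) + V k (l - 1))"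
    using V2[of k l] V2[of k "l - 1"] kl by (simp add: sum_subtractf sum_negf)
  ultimately show ?thesis by (simp add: max_def min_def)
qed

lemma fits_iff:
  assumes "length as = length w"
  shows "fits \<mu> w as \<longleftrightarrow> (\<forall>j<length w. Val (as ! j) = - case_prod \<mu> (roots id w ! j))"
  using assms by (simp add: fits_def list_all2_conv_all_nth case_prod_beta)

text \<open>The parameters are moved to the standard word, where the T-system shows that their
  valuations are ideal. As \<open>transfers\<close> gives an equivalence for each
  \<open>ultra\<close> filling, the filling read off there also fits the parameters on
  \<open>w\<close>.\<close>

lemma toeplitz_imp_ideal_filling:
  assumes n: "1 \<le> n" and w: "set w \<subseteq> {1..<n}" "ascending_word w" "inversions (word_perm w) = pairs n"
    and m: "\<And>x y. 1 \<le> x \<Longrightarrow> x < y \<Longrightarrow> y \<le> n \<Longrightarrow> pos_leading_coeff (m (alpha x y)) \<and> 0 \<le> Val (m (alpha x y))"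
    and T: "toeplitz (y_product n w m)"
  shows "ideal_filling n (\<lambda>i j. of_rat (Val (m (alpha i j))))"
proof -
  note std = std_word_reduced[OF n]
  have perm: "word_perm w = word_perm (std_word n)"
    by (rule inversions_full_unique[OF word_perm_permutes[OF w(1)] w(3) word_perm_permutes[OF std(1)] std(3)])
  have trans: "transfers n w (std_word n)" by (rule transfers_ascending[OF w(1) std(1) w(2) std(2) perm])
  define as where "as = map (\<lambda>j. inverse (m (word_root w j))) [0..<length w]"
  have len: "length as = length w" by (simp add: as_def)
  have nth: "as ! j = inverse (m (case_prod alpha (roots id w ! j)))" if "j < length w" for j
    using that by (simp add: as_def word_root_eq_alpha)
  have root: "roots id w ! j \<in> pairs n" if "j < length w" for j
    using roots_ascending(2)[OF w(2)] nth_mem[of j "roots id w"] that w(3) by simp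
  have pos: "pos_leading_coeff (m (case_prod alpha (roots id w ! j)))" if "j < length w" for j
    using root[OF that] m by auto
  have "pos_leading_coeff (as ! j)" if "j < length w" for j
    using pos_inverse(1)[OF pos[OF that]] nth[OF that] by simp
  then have "length as = length w \<and> (\<forall>a\<in>set as. pos_leading_coeff a)"
    using len by (auto simp: in_set_conv_nth)
  from trans[unfolded transfers_def, rule_format, OF this]
  obtain bs where bs: "length bs = length (std_word n)" "\<forall>a\<in>set bs. pos_leading_coeff a"
    "yprod n w as = yprod n (std_word n) bs" "\<forall>\<mu>. ultra n \<mu> \<longrightarrow> (fits \<mu> w as \<longleftrightarrow> fits \<mu> (std_word n) bs)"
    by blast
  obtain a where a: "bs = std_params n a" using std_params_surj[OF n bs(1)] .
  have posa: "pos_leading_coeff (a k l)" if "1 \<le> k" "1 \<le> l" "k + l \<le> n" for k l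
    using bs(2) that unfolding a set_std_params by blast
  have nz: "a k l \<noteq> 0" if "1 \<le> k" "1 \<le> l" "k + l \<le> n" for k l
    using pos_leading_coeff_nonzero[OF posa[OF that]] .
  have "toeplitz (yprod n (std_word n) (std_params n a))"
    using T bs(3) unfolding y_product_eq_yprod as_def[symmetric] a by simp
  then have "T_system n (rect_prod a)" using toeplitz_iff_T_system[OF n nz] by simp
  note trop = T_system_Val[OF posa this]
  have ideal: "- Val (a k l) = max (- Val (a (Suc k) l)) (- Val (a k (Suc l)))"
    if "1 \<le> k" "1 \<le> l" "k + l < n" for k l
    using tropical_T_system_imp_ideal[where \<mu> = "\<lambda>k l. - Val (a k l)" and n = n, OF trop that] .
  \<comment> \<open>Back from positions in the standard word to roots; raising \<open>l\<close>
    lowers \<open>j\<close>.\<close>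
  define \<mu> where "\<mu> i j = - Val (a i (Suc n - j))" for i j
  have mu: "\<mu> i j = max (\<mu> (i + 1) j) (\<mu> i (j - 1))" if "1 \<le> i" "j \<le> n" "i + 2 \<le> j" for i j
  proof -
    have "Suc n - (j - 1) = Suc (Suc n - j)" using that by auto
    then show ?thesis using ideal[of i "Suc n - j"] that by (simp add: \<mu>_def)
  qed
  have "fits \<mu> (std_word n) bs"
    unfolding a fits_std_word[OF n] by (simp add: \<mu>_def)
  then have fits: "fits \<mu> w as" using bs(4) ideal_imp_ultra[where \<mu> = \<mu> and n = n, OF mu] by blast
  have Val: "Val (m (alpha x y)) = \<mu> x y" if "1 \<le> x" "x < y" "y \<le> n" for x y
  proof -
    have "(x, y) \<in> set (roots id w)" using that roots_ascending(2)[OF w(2)] w(3) by simp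
    then obtain j where j: "j < length w" "roots id w ! j = (x, y)" by (auto simp: in_set_conv_nth)
    then have "Val (as ! j) = - \<mu> x y" using fits[unfolded fits_iff[OF len]] by simp
    then have "Val (inverse (m (alpha x y))) = - \<mu> x y" using nth[OF j(1)] j(2) by simp
    then show ?thesis using pos_inverse(2)[of "m (alpha x y)"] m[OF that] by simp
  qed
  have of_rat_max: "of_rat (max x y) = max (of_rat x) (of_rat y :: real)" for x y
    by (simp add: max_def of_rat_less_eq)
  show ?thesis
    unfolding ideal_filling_def filling_def
  proof (intro conjI allI impI)
    fix i j assume "1 \<le> i \<and> i < j \<and> j \<le> n"
    then show "0 \<le> (of_rat (Val (m (alpha i j))) :: real)" using m by simp
  next
    fix i j assume ij: "1 \<le> i \<and> j \<le> n \<and> i + 2 \<le> j"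
    then have "i < j - 1" "j - 1 \<le> n" by auto
    then have "Val (m (alpha i j)) = max (Val (m (alpha (i + 1) j))) (Val (m (alpha i (j - 1))))"
      using mu[of i j] Val[of i j] Val[of "i + 1" j] Val[of i "j - 1"] ij by simp
    then show "(of_rat (Val (m (alpha i j))) :: real) = max (of_rat (Val (m (alpha (i + 1) j)))) (of_rat (Val (m (alpha i (j - 1)))))"
      by (simp only: of_rat_max)
  qed
qed

lemma ideal_filling_imp_toeplitz:
  assumes n: "1 \<le> n" and w: "set w \<subseteq> {1..<n}" "ascending_word w" "inversions (word_perm w) = pairs n"
    and f: "ideal_filling n f" "\<And>i j. 1 \<le> i \<Longrightarrow> i < j \<Longrightarrow> j \<le> n \<Longrightarrow> f i j \<in> \<rat>"
  shows "\<exists>m. (\<forall>i j. 1 \<le> i \<and> i < j \<and> j \<le> n \<longrightarrow>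
      pos_leading_coeff (m (alpha i j)) \<and> of_rat (Val (m (alpha i j))) = f i j) \<and> toeplitz (y_product n w m)"
proof -
  note std = std_word_reduced[OF n]
  have perm: "word_perm (std_word n) = word_perm w"
    by (rule inversions_full_unique[OF word_perm_permutes[OF std(1)] std(3) word_perm_permutes[OF w(1)] w(3)])
  have trans: "transfers n (std_word n) w" by (rule transfers_ascending[OF std(1) w(1) std(2) w(2) perm])
  define \<mu> where "\<mu> i j = (SOME q. f i j = of_rat q)" for i j
  have fmu: "f i j = of_rat (\<mu> i j)" if "1 \<le> i" "i < j" "j \<le> n" for i j
    unfolding \<mu>_def by (rule someI_ex) (use f(2)[OF that] in \<open>auto elim: Rats_cases\<close>)
  have mu: "\<mu> i j = max (\<mu> (i + 1) j) (\<mu> i (j - 1))" if "1 \<le> i" "j \<le> n" "i + 2 \<le> j" for i j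
  proof -
    have "f i j = max (f (i + 1) j) (f i (j - 1))" using f(1) that unfolding ideal_filling_def by blast
    then have "(of_rat (\<mu> i j) :: real) = max (of_rat (\<mu> (i + 1) j)) (of_rat (\<mu> i (j - 1)))"
      using fmu[of i j] fmu[of "i + 1" j] fmu[of i "j - 1"] that by simp
    then show ?thesis by (auto simp: max_def of_rat_less_eq split: if_splits)
  qed
  have "\<mu> k (Suc n - l) = max (\<mu> (Suc k) (Suc n - l)) (\<mu> k (Suc n - Suc l))"
    if "1 \<le> k" "1 \<le> l" "k + l < n" for k l
    using mu[of k "Suc n - l"] that by simp
  from T_system_solution[where \<mu> = "\<lambda>k l. \<mu> k (Suc n - l)" and n = n, OF this]
  obtain a where a: "\<And>k l. pos_leading_coeff (a k l)"
    "\<And>k l. 1 \<le> k \<and> 1 \<le> l \<and> k + l \<le> n \<Longrightarrow> Val (a k l) = - \<mu> k (Suc n - l)" "T_system n (rect_prod a)"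
    by blast
  have "length (std_params n a) = length (std_word n) \<and> (\<forall>a\<in>set (std_params n a). pos_leading_coeff a)"
    using a(1) by (auto simp: std_params_def std_word_def)
  from trans[unfolded transfers_def, rule_format, OF this]
  obtain as where as: "length as = length w" "\<forall>a\<in>set as. pos_leading_coeff a"
    "yprod n (std_word n) (std_params n a) = yprod n w as"
    "\<forall>\<mu>. ultra n \<mu> \<longrightarrow> (fits \<mu> (std_word n) (std_params n a) \<longleftrightarrow> fits \<mu> w as)"
    by blast
  have "fits \<mu> (std_word n) (std_params n a)" unfolding fits_std_word[OF n] using a(2) by blast
  then have fits: "fits \<mu> w as" using as(4) ideal_imp_ultra[where \<mu> = \<mu> and n = n, OF mu] by blast
  have toep: "toeplitz (yprod n w as)"
    using toeplitz_iff_T_system[where a = a, OF n pos_leading_coeff_nonzero[OF a(1)]] a(3) as(3) by simp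
  have root: "roots id w ! j \<in> pairs n" if "j < length w" for j
    using roots_ascending(2)[OF w(2)] nth_mem[of j "roots id w"] that w(3) by simp
  \<comment> \<open>Distinct positions have distinct roots, so the position is unique for a positive
    root; elsewhere the value is arbitrary.\<close>
  define m where "m \<alpha> = inverse (as ! (SOME j. j < length w \<and> word_root w j = \<alpha>))" for \<alpha>
  have m: "m (word_root w j) = inverse (as ! j)" if "j < length w" for j
  proof -
    have "(SOME i. i < length w \<and> word_root w i = word_root w j) = j"
    proof (rule some_equality)
      fix i assume i: "i < length w \<and> word_root w i = word_root w j"
      then have "roots id w ! i = roots id w ! j"
        using root[of i] root[OF that] that alpha_inject by (auto simp: word_root_eq_alpha)
      then show "i = j" using roots_ascending(1)[OF w(2)] i that by (simp add: nth_eq_iff_index_eq)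
    qed (use that in simp)
    then show ?thesis by (simp add: m_def)
  qed
  have "map (\<lambda>j. inverse (m (word_root w j))) [0..<length w] = as"
    using as(1) by (intro nth_equalityI) (auto simp: m)
  then have "toeplitz (y_product n w m)" unfolding y_product_eq_yprod using toep by simp
  moreover have "pos_leading_coeff (m (alpha x y)) \<and> of_rat (Val (m (alpha x y))) = f x y"
    if "1 \<le> x" "x < y" "y \<le> n" for x y
  proof -
    have "(x, y) \<in> set (roots id w)" using that roots_ascending(2)[OF w(2)] w(3) by simp
    then obtain j where j: "j < length w" "roots id w ! j = (x, y)" by (auto simp: in_set_conv_nth)
    have "m (alpha x y) = inverse (as ! j)" using m[OF j(1)] j by (simp add: word_root_eq_alpha)
    moreover have "pos_leading_coeff (as ! j)" using as j(1) by simp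
    moreover have "Val (as ! j) = - \<mu> x y" using fits[unfolded fits_iff[OF as(1)]] j by simp
    ultimately show ?thesis using fmu[OF that] by (simp add: pos_inverse)
  qed
  ultimately show ?thesis by blast
qed

theorem theorem1p0p1:
  fixes n :: nat and w0 :: "nat \<Rightarrow> nat" and w :: "nat list"
  assumes "n \<ge> 2"
    and "longest_element n w0"
    and "length w = n choose 2"
    and "reduced_expression n w w0"
  shows "(\<forall>m :: (nat \<Rightarrow> int) \<Rightarrow> complex puiseux.
            (\<forall>\<alpha>\<in>positive_roots n. pos_leading_coeff (m \<alpha>) \<and> 0 \<le> Val (m \<alpha>)) \<longrightarrow>
            toeplitz (y_product n w m) \<longrightarrow>
            ideal_filling n (\<lambda>i j. of_rat (Val (m (alpha i j)))))
       \<and> (\<forall>f :: nat \<Rightarrow> nat \<Rightarrow> real.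
            ideal_filling n f \<and> (\<forall>i j. 1 \<le> i \<and> i < j \<and> j \<le> n \<longrightarrow> f i j \<in> \<rat>) \<longrightarrow>
            (\<exists>m :: (nat \<Rightarrow> int) \<Rightarrow> complex puiseux.
               (\<forall>\<alpha>\<in>positive_roots n. pos_leading_coeff (m \<alpha>)) \<and>
               (\<forall>i j. 1 \<le> i \<and> i < j \<and> j \<le> n \<longrightarrow> of_rat (Val (m (alpha i j))) = f i j) \<and>
               toeplitz (y_product n w m)))"
proof -
  note w = reduced_expression_longest[OF assms(2-4)]
  have n: "1 \<le> n" using assms(1) by simp
  show ?thesis
  proof (intro conjI allI impI)
    fix m :: "(nat \<Rightarrow> int) \<Rightarrow> complex puiseux"
    assume m: "\<forall>\<alpha>\<in>positive_roots n. pos_leading_coeff (m \<alpha>) \<and> 0 \<le> Val (m \<alpha>)"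
      and T: "toeplitz (y_product n w m)"
    have "alpha x y \<in> positive_roots n" if "1 \<le> x" "x < y" "y \<le> n" for x y
      using that unfolding positive_roots_def by blast
    then show "ideal_filling n (\<lambda>i j. of_rat (Val (m (alpha i j))))"
      using m by (intro toeplitz_imp_ideal_filling[OF n w _ T]) blast
  next
    fix f assume f: "ideal_filling n f \<and> (\<forall>i j. 1 \<le> i \<and> i < j \<and> j \<le> n \<longrightarrow> f i j \<in> \<rat>)"
    then obtain m where "\<forall>i j. 1 \<le> i \<and> i < j \<and> j \<le> n \<longrightarrow>
        pos_leading_coeff (m (alpha i j)) \<and> of_rat (Val (m (alpha i j))) = f i j"
      "toeplitz (y_product n w m)"
      using ideal_filling_imp_toeplitz[OF n w, of f] by blast
    then show "\<exists>m :: (nat \<Rightarrow> int) \<Rightarrow> complex puiseux.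
        (\<forall>\<alpha>\<in>positive_roots n. pos_leading_coeff (m \<alpha>)) \<and>
        (\<forall>i j. 1 \<le> i \<and> i < j \<and> j \<le> n \<longrightarrow> of_rat (Val (m (alpha i j))) = f i j) \<and>
        toeplitz (y_product n w m)"
      by (intro exI[of _ m]) (auto simp: positive_roots_def)
  qed
qed

end
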